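(* Assume CH. Let $\mathbb P$ be a proper forcing poset of cardinality $\leq\omega_1$ such that for every $\mathbb P$-name $\dot f$ and every $p\in\mathbb P$, if $p\Vdash\dot f\in\omega^\omega$ then there exists $h\in\omega^\omega$ (in the ground model) such that $p\Vdash\dot f\leq^*\check h$. Then every countably infinite almost disjoint family on $\omega$ can be extended to a $\mathbb P$-indestructible fin-intersecting MAD family $\mathcal A$ on $\omega$ such that $\Vdash_{\mathbb P}$ "$\check{\mathcal A}$ is fin-intersecting". In other words, $\mathbb P$-indestructible fin-intersecting MAD families for which forcing with $\mathbb P$ preserves the fin-intersecting property exist generically.
   Context: An almost disjoint family on $\omega$ is an infinite set $\mathcal A$ of infinite subsets of $\omega$ such that $a\cap b$ is finite for all distinct $a,b\in\mathcal A$; it is MAD if it is not properly contained in any other almost disjoint family on $\omega$. A fin sequence is a function $C:\omega\to[\omega]^{<\omega}\setminus\{\emptyset\}$ with $C(n)\cap C(m)=\emptyset$ whenever $n\neq m$. A collection of sets is centered if every finite nonempty subcollection has infinite intersection. An almost disjoint family $\mathcal A$ is fin-intersecting if for every fin sequence $C$ there exists an infinite $I\subseteq\omega$ such that $\{\{n\in I: a\cap C(n)\neq\emptyset\}: a\in\mathcal A\}\setminus[I]^{<\omega}$ is centered, where $[I]^{<\omega}$ is the set of finite subsets of $I$. For $f,g\in\omega^\omega$, $f\leq^* g$ means that $\{n\in\omega: g(n)<f(n)\}$ is finite. A MAD family $\mathcal A$ is $\mathbb P$-indestructible if $\Vdash_{\mathbb P}$ "$\check{\mathcal A}$ is MAD".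 Almost disjoint families with a property $\phi$ exist generically if every almost disjoint family of cardinality less than $\mathfrak c=2^{\aleph_0}$ is contained in an almost disjoint family with property $\phi$. *)

theory Defs
  imports Complex_Main "HOL-Library.Countable_Set"
begin

unbundle cardinal_syntax

definition almost_disjoint :: "nat set set \<Rightarrow> bool" where
  "almost_disjoint A \<longleftrightarrow> infinite A \<and> (\<forall>a\<in>A. infinite a) \<and>
     (\<forall>a\<in>A. \<forall>b\<in>A. a \<noteq> b \<longrightarrow> finite (a \<inter> b))"

definition MAD :: "nat set set \<Rightarrow> bool" where
  "MAD A \<longleftrightarrow> almost_disjoint A \<and> \<not> (\<exists>B. almost_disjoint B \<and> A \<subset> B)"

definition fin_sequence :: "(nat \<Rightarrow> nat set) \<Rightarrow> bool" where
  "fin_sequence C \<longleftrightarrow> (\<forall>n. finite (C n) \<and> C n \<noteq> {}) \<and> (\<forall>n m. n \<noteq> m \<longrightarrow> C n \<inter> C m = {})"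

definition centered :: "nat set set \<Rightarrow> bool" where
  "centered K \<longleftrightarrow> (\<forall>F. F \<subseteq> K \<and> finite F \<and> F \<noteq> {} \<longrightarrow> infinite (\<Inter>F))"

definition fin_intersecting :: "nat set set \<Rightarrow> bool" where
  "fin_intersecting A \<longleftrightarrow> almost_disjoint A \<and> (\<forall>C. fin_sequence C \<longrightarrow>
     (\<exists>I. infinite I \<and>
        centered ((\<lambda>a. {n \<in> I. a \<inter> C n \<noteq> {}}) ` A - {X. X \<subseteq> I \<and> finite X})))"

definition exist_generically :: "(nat set set \<Rightarrow> bool) \<Rightarrow> bool" where
  "exist_generically \<phi> \<longleftrightarrow>
     (\<forall>B. almost_disjoint B \<and> |B| <o |UNIV :: nat set set| \<longrightarrow>
        (\<exists>A. B \<subseteq> A \<and> almost_disjoint A \<and> \<phi> A))"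

definition CH :: bool where
  "CH \<longleftrightarrow> |UNIV :: nat set set| =o cardSuc natLeq"

text \<open>
  The ground model is the ambient logic, and a forcing poset is a type \<open>'p\<close> of class
  \<^class>\<open>preorder\<close> (smaller conditions are stronger; antisymmetry and a largest condition
  play no role). Instead of one cumulative universe of names there is a universe of names above
  each type of the ground model:
  \<^item> an element of the ground model is its own (check) name;
  \<^item> a name for a subset of a ground model type \<open>'a\<close> is a set of pairs (element, condition);
  \<^item> a name for a family of such subsets is a set of pairs (name of a subset, condition).

  Every name that is forced to denote a subset of a ground model set, or a family of such subsets,
  is forced to be equal to one of this form, so quantifying over these names is quantifying over
  all the objects of that kind in the generic extension.

  A sentence of the forcing language is represented by the set of conditions that force it. The
  clauses are the usual ones for negation, conjunction, the universal quantifier and atomic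
  sentences; the other connectives are defined from these classically.
\<close>

type_synonym ('a, 'p) name = "('a \<times> 'p) set"

type_synonym 'p sentence = "'p \<Rightarrow> bool"

definition forces :: "'p \<Rightarrow> 'p sentence \<Rightarrow> bool" (infix "\<tturnstile>" 15) where
  "(p \<tturnstile> \<phi>) \<longleftrightarrow> \<phi> p"

definition forced :: "'p sentence \<Rightarrow> bool" ("\<tturnstile> _" [16] 15) where
  "(\<tturnstile> \<phi>) \<longleftrightarrow> (\<forall>p. p \<tturnstile> \<phi>)"

definition dense_below :: "'p::preorder \<Rightarrow> 'p set \<Rightarrow> bool" where
  "dense_below p D \<longleftrightarrow> (\<forall>q\<le>p. \<exists>r\<le>q. r \<in> D)"

definition fnot :: "'p::preorder sentence \<Rightarrow> 'p sentence" ("\<^bold>\<not> _" [40] 40) where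
  "(\<^bold>\<not> \<phi>) = (\<lambda>p. \<not> (\<exists>q\<le>p. q \<tturnstile> \<phi>))"

definition fand :: "'p sentence \<Rightarrow> 'p sentence \<Rightarrow> 'p sentence" (infixr "\<^bold>\<and>" 35) where
  "(\<phi> \<^bold>\<and> \<psi>) = (\<lambda>p. (p \<tturnstile> \<phi>) \<and> (p \<tturnstile> \<psi>))"

definition fall :: "('x \<Rightarrow> 'p sentence) \<Rightarrow> 'p sentence" (binder "\<^bold>\<forall>" 10) where
  "(\<^bold>\<forall>x. \<phi> x) = (\<lambda>p. \<forall>x. p \<tturnstile> \<phi> x)"

definition fimp :: "'p::preorder sentence \<Rightarrow> 'p sentence \<Rightarrow> 'p sentence" (infixr "\<^bold>\<longrightarrow>" 25) where
  "(\<phi> \<^bold>\<longrightarrow> \<psi>) = (\<^bold>\<not> (\<phi> \<^bold>\<and> \<^bold>\<not> \<psi>))"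

definition fiff :: "'p::preorder sentence \<Rightarrow> 'p sentence \<Rightarrow> 'p sentence" (infixr "\<^bold>\<longleftrightarrow>" 25) where
  "(\<phi> \<^bold>\<longleftrightarrow> \<psi>) = ((\<phi> \<^bold>\<longrightarrow> \<psi>) \<^bold>\<and> (\<psi> \<^bold>\<longrightarrow> \<phi>))"

definition fex :: "('x \<Rightarrow> 'p::preorder sentence) \<Rightarrow> 'p sentence" (binder "\<^bold>\<exists>" 10) where
  "(\<^bold>\<exists>x. \<phi> x) = (\<^bold>\<not> (\<^bold>\<forall>x. \<^bold>\<not> \<phi> x))"

text \<open>Atomic statements about elements of the ground model are absolute.\<close>

definition ground :: "bool \<Rightarrow> 'p sentence" where
  "ground b = (\<lambda>p. b)"

definition mem :: "'a \<Rightarrow> ('a, 'p::preorder) name \<Rightarrow> 'p sentence" (infix "\<^bold>\<in>" 50) where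
  "(a \<^bold>\<in> x) = (\<lambda>p. dense_below p {q. \<exists>s. (a, s) \<in> x \<and> q \<le> s})"

definition sub :: "('a, 'p::preorder) name \<Rightarrow> ('a, 'p) name \<Rightarrow> 'p sentence" (infix "\<^bold>\<subseteq>" 50) where
  "(x \<^bold>\<subseteq> y) = (\<^bold>\<forall>a. a \<^bold>\<in> x \<^bold>\<longrightarrow> a \<^bold>\<in> y)"

definition eq :: "('a, 'p::preorder) name \<Rightarrow> ('a, 'p) name \<Rightarrow> 'p sentence" (infix "\<^bold>=" 50) where
  "(x \<^bold>= y) = (\<^bold>\<forall>a. a \<^bold>\<in> x \<^bold>\<longleftrightarrow> a \<^bold>\<in> y)"

definition Mem :: "('a, 'p::preorder) name \<Rightarrow> (('a, 'p) name, 'p) name \<Rightarrow> 'p sentence"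
    (infix "\<^bold>\<in>\<^bold>\<in>" 50) where
  "(x \<^bold>\<in>\<^bold>\<in> F) = (\<lambda>p. dense_below p {q. \<exists>y s. (y, s) \<in> F \<and> q \<le> s \<and> (q \<tturnstile> x \<^bold>= y)})"

definition Sub :: "(('a, 'p::preorder) name, 'p) name \<Rightarrow> (('a, 'p) name, 'p) name \<Rightarrow> 'p sentence"
    (infix "\<^bold>\<subseteq>\<^bold>\<subseteq>" 50) where
  "(F \<^bold>\<subseteq>\<^bold>\<subseteq> G) = (\<^bold>\<forall>x. x \<^bold>\<in>\<^bold>\<in> F \<^bold>\<longrightarrow> x \<^bold>\<in>\<^bold>\<in> G)"

definition check :: "'a set \<Rightarrow> ('a, 'p) name" where
  "check A = A \<times> UNIV"

definition Check :: "'a set set \<Rightarrow> (('a, 'p) name, 'p) name" where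
  "Check \<A> = (check ` \<A>) \<times> UNIV"

text \<open>
  A name for a subset of \<open>'i \<times> 'a\<close> serves as a name for a (partial) function from \<open>'i\<close> to
  \<open>'a\<close>, and also as a name for an \<open>'i\<close>-indexed sequence of subsets of \<open>'a\<close>, whose \<open>i\<close>-th
  term has the name given by \<open>section_at\<close>.
\<close>

definition single_valued_name :: "('i \<times> 'a, 'p::preorder) name \<Rightarrow> 'p sentence" where
  "single_valued_name f =
     (\<^bold>\<forall>i. \<^bold>\<forall>a. \<^bold>\<forall>b. (i, a) \<^bold>\<in> f \<^bold>\<and> (i, b) \<^bold>\<in> f \<^bold>\<longrightarrow> ground (a = b))"

definition total_function :: "('i \<times> 'a, 'p::preorder) name \<Rightarrow> 'p sentence" where
  "total_function f = (single_valued_name f \<^bold>\<and> (\<^bold>\<forall>i. \<^bold>\<exists>a. (i, a) \<^bold>\<in> f))"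

definition check_fun :: "('i \<Rightarrow> 'a) \<Rightarrow> ('i \<times> 'a, 'p) name" where
  "check_fun h = check {(i, h i) | i. True}"

definition section_at :: "('i \<times> 'a, 'p) name \<Rightarrow> 'i \<Rightarrow> ('a, 'p) name" where
  "section_at S i = {(a, p). ((i, a), p) \<in> S}"

definition finite_name :: "('a, 'p::preorder) name \<Rightarrow> 'p sentence" where
  "finite_name x = (\<^bold>\<exists>k::nat. \<^bold>\<exists>e::(nat \<times> 'a, 'p) name.
     single_valued_name e \<^bold>\<and> (\<^bold>\<forall>a. a \<^bold>\<in> x \<^bold>\<longrightarrow> (\<^bold>\<exists>i. ground (i < k) \<^bold>\<and> (i, a) \<^bold>\<in> e)))"

definition countable_name :: "('a, 'p::preorder) name \<Rightarrow> 'p sentence" where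
  "countable_name x = (\<^bold>\<exists>e::(nat \<times> 'a, 'p) name.
     single_valued_name e \<^bold>\<and> (\<^bold>\<forall>a. a \<^bold>\<in> x \<^bold>\<longrightarrow> (\<^bold>\<exists>i. (i, a) \<^bold>\<in> e)))"

definition Finite_name :: "(('a, 'p::preorder) name, 'p) name \<Rightarrow> 'p sentence" where
  "Finite_name F = (\<^bold>\<exists>k::nat. \<^bold>\<exists>S::(nat \<times> 'a, 'p) name.
     \<^bold>\<forall>x. x \<^bold>\<in>\<^bold>\<in> F \<^bold>\<longrightarrow> (\<^bold>\<exists>i. ground (i < k) \<^bold>\<and> x \<^bold>= section_at S i))"

definition le_star :: "(nat \<times> nat, 'p::preorder) name \<Rightarrow> (nat \<times> nat, 'p) name \<Rightarrow> 'p sentence"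
    (infix "\<^bold>\<le>\<^sup>*" 50) where
  "(f \<^bold>\<le>\<^sup>* g) = (\<^bold>\<exists>x. finite_name x \<^bold>\<and>
     (\<^bold>\<forall>n. n \<^bold>\<in> x \<^bold>\<longleftrightarrow> (\<^bold>\<exists>i. \<^bold>\<exists>j. (n, i) \<^bold>\<in> g \<^bold>\<and> (n, j) \<^bold>\<in> f \<^bold>\<and> ground (i < j))))"

definition inter :: "('a, 'p::preorder) name \<Rightarrow> ('a, 'p) name \<Rightarrow> ('a, 'p) name" where
  "inter x y = {(a, p). (p \<tturnstile> a \<^bold>\<in> x) \<and> (p \<tturnstile> a \<^bold>\<in> y)}"

definition almost_disjoint_name :: "((nat, 'p::preorder) name, 'p) name \<Rightarrow> 'p sentence" where
  "almost_disjoint_name F = (\<^bold>\<not> Finite_name F \<^bold>\<and>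
     (\<^bold>\<forall>x. x \<^bold>\<in>\<^bold>\<in> F \<^bold>\<longrightarrow> \<^bold>\<not> finite_name x) \<^bold>\<and>
     (\<^bold>\<forall>x. \<^bold>\<forall>y. x \<^bold>\<in>\<^bold>\<in> F \<^bold>\<and> y \<^bold>\<in>\<^bold>\<in> F \<^bold>\<and> \<^bold>\<not> (x \<^bold>= y) \<^bold>\<longrightarrow> finite_name (inter x y)))"

definition MAD_name :: "((nat, 'p::preorder) name, 'p) name \<Rightarrow> 'p sentence" where
  "MAD_name F = (almost_disjoint_name F \<^bold>\<and>
     \<^bold>\<not> (\<^bold>\<exists>G. almost_disjoint_name G \<^bold>\<and> F \<^bold>\<subseteq>\<^bold>\<subseteq> G \<^bold>\<and> \<^bold>\<not> (G \<^bold>\<subseteq>\<^bold>\<subseteq> F)))"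

definition fin_sequence_name :: "(nat \<times> nat, 'p::preorder) name \<Rightarrow> 'p sentence" where
  "fin_sequence_name C =
     ((\<^bold>\<forall>n. finite_name (section_at C n) \<^bold>\<and> (\<^bold>\<exists>k. k \<^bold>\<in> section_at C n)) \<^bold>\<and>
      (\<^bold>\<forall>n. \<^bold>\<forall>m. ground (n \<noteq> m) \<^bold>\<longrightarrow>
         \<^bold>\<not> (\<^bold>\<exists>k. k \<^bold>\<in> section_at C n \<^bold>\<and> k \<^bold>\<in> section_at C m)))"

text \<open>
  Here \<open>K\<close> is not a name but a formula: it stands for the class of subsets of the natural
  numbers satisfying it in the extension.
\<close>

definition centered_name :: "((nat, 'p::preorder) name \<Rightarrow> 'p sentence) \<Rightarrow> 'p sentence" where
  "centered_name K = (\<^bold>\<forall>F::((nat, 'p) name, 'p) name.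
     (\<^bold>\<forall>x. x \<^bold>\<in>\<^bold>\<in> F \<^bold>\<longrightarrow> K x) \<^bold>\<and> Finite_name F \<^bold>\<and> (\<^bold>\<exists>x. x \<^bold>\<in>\<^bold>\<in> F) \<^bold>\<longrightarrow>
     (\<^bold>\<exists>y. (\<^bold>\<forall>n. n \<^bold>\<in> y \<^bold>\<longleftrightarrow> (\<^bold>\<forall>x. x \<^bold>\<in>\<^bold>\<in> F \<^bold>\<longrightarrow> n \<^bold>\<in> x)) \<^bold>\<and> \<^bold>\<not> finite_name y))"

definition fin_intersecting_name :: "((nat, 'p::preorder) name, 'p) name \<Rightarrow> 'p sentence" where
  "fin_intersecting_name \<A> = (almost_disjoint_name \<A> \<^bold>\<and>
     (\<^bold>\<forall>C. fin_sequence_name C \<^bold>\<longrightarrow>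
       (\<^bold>\<exists>I. \<^bold>\<not> finite_name I \<^bold>\<and>
         centered_name (\<lambda>x.
           (\<^bold>\<exists>a. a \<^bold>\<in>\<^bold>\<in> \<A> \<^bold>\<and>
              (\<^bold>\<forall>n. n \<^bold>\<in> x \<^bold>\<longleftrightarrow> n \<^bold>\<in> I \<^bold>\<and> (\<^bold>\<exists>k. k \<^bold>\<in> a \<^bold>\<and> k \<^bold>\<in> section_at C n))) \<^bold>\<and>
           \<^bold>\<not> (x \<^bold>\<subseteq> I \<^bold>\<and> finite_name x)))))"

definition indestructible_MAD :: "'p::preorder itself \<Rightarrow> nat set set \<Rightarrow> bool" where
  "indestructible_MAD _ A \<longleftrightarrow> MAD A \<and> (\<tturnstile> MAD_name (Check A :: ((nat, 'p) name, 'p) name))"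

definition preserves_fin_intersecting :: "'p::preorder itself \<Rightarrow> nat set set \<Rightarrow> bool" where
  "preserves_fin_intersecting _ A \<longleftrightarrow>
     (\<tturnstile> fin_intersecting_name (Check A :: ((nat, 'p) name, 'p) name))"

text \<open>
  Properness in Shelah's original form: for every uncountable set \<open>X\<close>, every stationary subset of
  \<open>[X]\<^sup>\<omega>\<close> remains stationary in the generic extension.
\<close>

definition countable_subsets :: "'x set \<Rightarrow> 'x set set" where
  "countable_subsets X = {x. x \<subseteq> X \<and> countable x \<and> infinite x}"

definition club :: "'x set \<Rightarrow> 'x set set \<Rightarrow> bool" where
  "club X C \<longleftrightarrow> C \<subseteq> countable_subsets X \<and>
     (\<forall>x\<in>countable_subsets X. \<exists>y\<in>C. x \<subseteq> y) \<and>
     (\<forall>s::nat \<Rightarrow> 'x set. (\<forall>n. s n \<in> C \<and> s n \<subseteq> s (Suc n)) \<longrightarrow> (\<Union>n. s n) \<in> C)"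

definition stationary :: "'x set \<Rightarrow> 'x set set \<Rightarrow> bool" where
  "stationary X S \<longleftrightarrow> S \<subseteq> countable_subsets X \<and> (\<forall>C. club X C \<longrightarrow> S \<inter> C \<noteq> {})"

definition in_countable_subsets :: "'x set \<Rightarrow> ('x, 'p::preorder) name \<Rightarrow> 'p sentence" where
  "in_countable_subsets X x =
     (x \<^bold>\<subseteq> check X \<^bold>\<and> countable_name x \<^bold>\<and> \<^bold>\<not> finite_name x)"

definition club_name :: "'x set \<Rightarrow> (('x, 'p::preorder) name, 'p) name \<Rightarrow> 'p sentence" where
  "club_name X C =
     ((\<^bold>\<forall>x. x \<^bold>\<in>\<^bold>\<in> C \<^bold>\<longrightarrow> in_countable_subsets X x) \<^bold>\<and>
      (\<^bold>\<forall>x. in_countable_subsets X x \<^bold>\<longrightarrow> (\<^bold>\<exists>y. y \<^bold>\<in>\<^bold>\<in> C \<^bold>\<and> x \<^bold>\<subseteq> y)) \<^bold>\<and>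
      (\<^bold>\<forall>s::(nat \<times> 'x, 'p) name.
         (\<^bold>\<forall>n. section_at s n \<^bold>\<in>\<^bold>\<in> C \<^bold>\<and> section_at s n \<^bold>\<subseteq> section_at s (Suc n)) \<^bold>\<longrightarrow>
         (\<^bold>\<exists>u. (\<^bold>\<forall>a. a \<^bold>\<in> u \<^bold>\<longleftrightarrow> (\<^bold>\<exists>n. a \<^bold>\<in> section_at s n)) \<^bold>\<and> u \<^bold>\<in>\<^bold>\<in> C)))"

definition stationary_name :: "'x set \<Rightarrow> (('x, 'p::preorder) name, 'p) name \<Rightarrow> 'p sentence" where
  "stationary_name X S =
     ((\<^bold>\<forall>x. x \<^bold>\<in>\<^bold>\<in> S \<^bold>\<longrightarrow> in_countable_subsets X x) \<^bold>\<and>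
      (\<^bold>\<forall>C. club_name X C \<^bold>\<longrightarrow> (\<^bold>\<exists>x. x \<^bold>\<in>\<^bold>\<in> S \<^bold>\<and> x \<^bold>\<in>\<^bold>\<in> C)))"

text \<open>
  No single formula can range over all sets \<open>X\<close>, so \<open>X\<close> ranges over the subsets of a type
  \<open>'x\<close>, which is \<open>'p set\<close> in \<open>proper_forcing\<close>. Once \<open>'x\<close> has at least \<open>2\<close> to the power \<open>|'p|\<close> elements, the choice of \<open>'x\<close> does
  not matter: preservation for such an \<open>'x\<close> already yields generic conditions, because these only
  concern the trace of an elementary submodel on the conditions and on the sets of conditions.
\<close>

definition preserves_stationary :: "'x itself \<Rightarrow> 'p::preorder itself \<Rightarrow> bool" where
  "preserves_stationary _ _ \<longleftrightarrow>
     (\<forall>(X::'x set) S. uncountable X \<and> stationary X S \<longrightarrow>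
        (\<tturnstile> stationary_name X (Check S :: (('x, 'p) name, 'p) name)))"

definition proper_forcing :: "'p::preorder itself \<Rightarrow> bool" where
  "proper_forcing P \<longleftrightarrow> preserves_stationary TYPE('p set) P"

end

theory Submission
  imports Defs "HOL-Library.Infinite_Set"
begin

text \<open>
  The forcing is analysed by sampling. A name is evaluated at those filters that meet countably
  many prescribed dense sets, and \<open>generics p\<close> is the filter of all properties that hold for
  every filter through \<open>p\<close> that is generic in this weak sense. Such filters exist in the ground
  model. A sentence about subsets of countable sets is forced by \<open>p\<close> exactly if its literal
  meaning holds eventually along \<open>generics p\<close> (the \<open>represents\<close> lemmas, which rest on
  \<open>eventually_generics_local\<close> and \<open>truth\<close>). Arguments in the generic extension thus become
  arguments about ordinary sets, one sampled filter at a time.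

  The combinatorial idea is to attach to every fin sequence \<open>c\<close> an infinite set \<open>I\<close> on which the
  trace \<open>{n \<in> I. a \<inter> c n \<noteq> {}}\<close> of every member \<open>a\<close> of the family is finite or cofinite. The
  infinite traces are then cofinite in \<open>I\<close>, hence centered. If in addition some member has an
  infinite trace, the same device yields maximality: apply it to the singletons that list an
  infinite set \<open>X\<close>, and a member with an infinite trace meets \<open>X\<close> in an infinite set.

  For a countable almost disjoint family \<open>a 0, a 1, \<dots>\<close> such an \<open>I\<close> comes from a diagonal
  argument. It has to stay good when new members join, and there are two ways to achieve that.
  Either finitely many members cover almost all \<open>c n\<close>, \<open>n \<in> I\<close> (\<open>dead\<close>); then every later
  member, being almost disjoint from these, has a finite trace. Or infinitely many members have
  a cofinite trace (\<open>alive\<close>); then no finite subfamily covers infinitely many \<open>c n\<close>, one can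
  pick from the \<open>c n\<close> a set that is almost disjoint from the family (\<open>escape\<close>), and a new member
  has a cofinite trace as soon as it almost contains this set. If only finitely many members
  have an infinite trace but do not cover, what they leave of the \<open>c n\<close> is almost disjoint from
  the family (\<open>residue\<close>), and a new member that almost contains it makes \<open>I\<close> dead.

  So at each step a new member must almost contain countably many sets \<open>z\<close> of the extension,
  each almost disjoint from the family. The set \<open>{x. \<forall>i. x \<in> a i \<longrightarrow> x < g i}\<close> is almost disjoint
  from all \<open>a i\<close> for every \<open>g\<close>, and it almost contains \<open>z\<close> if \<open>g\<close> eventually dominates the
  bounds of \<open>z \<inter> a i\<close>. Since the forcing adds no unbounded functions, \<open>g\<close> can be taken in the
  ground model: this is \<open>common_cover\<close>, and \<open>extension_step\<close> combines it with the combinatorics.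

  It remains to see that \<open>\<omega>\<^sub>1\<close> steps suffice. The bounding hypothesis gives one bound for the
  condition \<open>p\<close> itself. Mixing all functions of the ground model along an uncountable antichain
  below \<open>p\<close> would violate it, so by CH antichains below \<open>p\<close> are countable, every name of a real
  is equal below \<open>p\<close> to a countable name, and there are only \<open>\<omega>\<^sub>1\<close> pairs of a condition and a
  countable name.

  The set \<open>I\<close> is obtained from \<open>c\<close> by a function of the ground model. For a fin sequence of the
  ground model it therefore lies in the ground model as well, and the properties of the family
  in the ground model and in the extension follow from one construction.
\<close>

section \<open>Generic filters\<close>

definition compatible :: "'p::preorder \<Rightarrow> 'p \<Rightarrow> bool" where
  "compatible q r \<longleftrightarrow> (\<exists>t. t \<le> q \<and> t \<le> r)"

definition antichain :: "'p::preorder set \<Rightarrow> bool" where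
  "antichain W \<longleftrightarrow> (\<forall>v\<in>W. \<forall>w\<in>W. compatible v w \<longrightarrow> v = w)"

text \<open>
  Compatibility is reflexive, so a maximal antichain inside \<open>R\<close> is predense for \<open>R\<close>.
\<close>

lemma maximal_antichain:
  obtains W where "W \<subseteq> R" "antichain W" "\<And>r. r \<in> R \<Longrightarrow> \<exists>w\<in>W. compatible r w"
proof -
  let ?\<A> = "{W. W \<subseteq> R \<and> antichain W}"
  have "\<Union>\<C> \<in> ?\<A>" if "subset.chain ?\<A> \<C>" for \<C>
  proof -
    have sub: "\<C> \<subseteq> ?\<A>" and tot: "\<And>X Y. X \<in> \<C> \<Longrightarrow> Y \<in> \<C> \<Longrightarrow> X \<subseteq> Y \<or> Y \<subseteq> X"
      using that by (auto simp: subset_chain_def)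
    have "antichain (\<Union>\<C>)"
      unfolding antichain_def
    proof (intro ballI impI)
      fix v w assume "v \<in> \<Union>\<C>" "w \<in> \<Union>\<C>" and c: "compatible v w"
      then obtain X Y where XY: "X \<in> \<C>" "Y \<in> \<C>" "v \<in> X" "w \<in> Y" by blast
      with tot[of X Y] obtain Z where "Z \<in> \<C>" "v \<in> Z" "w \<in> Z" by blast
      with sub c show "v = w" by (auto simp: antichain_def)
    qed
    then show ?thesis using sub by auto
  qed
  from subset_Zorn'[of ?\<A>, OF this]
  obtain W where W: "W \<subseteq> R" "antichain W"
    and max: "\<And>X. X \<subseteq> R \<Longrightarrow> antichain X \<Longrightarrow> W \<subseteq> X \<Longrightarrow> X = W"
    by auto
  have "\<exists>w\<in>W. compatible r w" if "r \<in> R" for r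
  proof (rule ccontr)
    assume none: "\<not> ?thesis"
    have "compatible r r" by (auto simp: compatible_def)
    with none have "r \<notin> W" by blast
    have "antichain (insert r W)"
      using W none by (auto simp: antichain_def compatible_def)
    from max[OF _ this] W that have "insert r W = W" by blast
    with \<open>r \<notin> W\<close> show False by blast
  qed
  with W that show ?thesis by blast
qed

definition condition_filter :: "'p::preorder set \<Rightarrow> bool" where
  "condition_filter G \<longleftrightarrow>
     (\<forall>r\<in>G. \<forall>s. r \<le> s \<longrightarrow> s \<in> G) \<and> (\<forall>r\<in>G. \<forall>s\<in>G. \<exists>t\<in>G. t \<le> r \<and> t \<le> s)"

lemma condition_filter_up: "condition_filter G \<Longrightarrow> r \<in> G \<Longrightarrow> r \<le> s \<Longrightarrow> s \<in> G"
  by (auto simp: condition_filter_def)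

lemma condition_filter_meet:
  "condition_filter G \<Longrightarrow> r \<in> G \<Longrightarrow> s \<in> G \<Longrightarrow> \<exists>t. t \<le> r \<and> t \<le> s"
  unfolding condition_filter_def by blast

definition generic_for :: "'p::preorder \<Rightarrow> (nat \<Rightarrow> 'p set) \<Rightarrow> 'p set \<Rightarrow> bool" where
  "generic_for p D G \<longleftrightarrow> condition_filter G \<and> p \<in> G \<and> (\<forall>n. G \<inter> D n \<noteq> {})"

text \<open>
  An event is large if there are countably many dense sets such that it contains every filter
  through \<open>p\<close> that meets all of them; this is comeagerness in the space of filters.
\<close>

definition generics :: "'p::preorder \<Rightarrow> 'p set filter" where
  "generics p = Abs_filter (\<lambda>E. \<exists>D. (\<forall>n. dense_below p (D n)) \<and> (\<forall>G. generic_for p D G \<longrightarrow> E G))"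

lemma eventually_generics:
  "eventually E (generics p) \<longleftrightarrow>
     (\<exists>D. (\<forall>n. dense_below p (D n)) \<and> (\<forall>G. generic_for p D G \<longrightarrow> E G))"
  unfolding generics_def
proof (subst eventually_Abs_filter, rule is_filter.intro, goal_cases)
  case 1
  show ?case by (intro exI[of _ "\<lambda>_. UNIV"]) (auto simp: dense_below_def)
next
  case (2 E F)
  then obtain D D' where
    D: "\<And>n. dense_below p (D n)" "\<And>n. dense_below p (D' n)"
    and E: "\<And>G. generic_for p D G \<Longrightarrow> E G" and F: "\<And>G. generic_for p D' G \<Longrightarrow> F G"
    by blast
  let ?D = "\<lambda>n. if even n then D (n div 2) else D' (n div 2)"
  have "E G \<and> F G" if G: "generic_for p ?D G" for G
  proof (intro conjI)
    have m: "\<forall>n. G \<inter> ?D n \<noteq> {}" using G by (auto simp: generic_for_def)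
    have "G \<inter> D n \<noteq> {}" for n using m[rule_format, of "2 * n"] by simp
    then show "E G" using G by (intro E) (auto simp: generic_for_def)
    have "G \<inter> D' n \<noteq> {}" for n using m[rule_format, of "2 * n + 1"] by simp
    then show "F G" using G by (intro F) (auto simp: generic_for_def)
  qed
  with D show ?case by (intro exI[of _ ?D]) auto
next
  case (3 E F)
  then show ?case by blast
qed simp

lemma eventually_generics_dense_set:
  assumes "dense_below p D"
  shows "\<forall>\<^sub>F G in generics p. condition_filter G \<and> p \<in> G \<and> G \<inter> D \<noteq> {}"
  unfolding eventually_generics using assms
  by (intro exI[of _ "\<lambda>_. D"]) (auto simp: generic_for_def)

lemma eventually_generics_filter: "\<forall>\<^sub>F G in generics p. condition_filter G \<and> p \<in> G"
  by (rule eventually_mono[OF eventually_generics_dense_set[of p UNIV]])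
    (auto simp: dense_below_def)

lemma generics_mono:
  assumes "q \<le> p" "eventually E (generics p)"
  shows "eventually E (generics q)"
proof -
  obtain D where D: "\<And>n. dense_below p (D n)" and E: "\<And>G. generic_for p D G \<Longrightarrow> E G"
    using assms(2) unfolding eventually_generics by blast
  have "dense_below q (D n)" for n
    using D[of n] assms(1) unfolding dense_below_def by (meson order_trans)
  moreover have "E G" if "generic_for q D G" for G
    using that assms(1) by (intro E) (auto simp: generic_for_def intro: condition_filter_up)
  ultimately show ?thesis unfolding eventually_generics by blast
qed

lemma eventually_generics_all:
  assumes "countable S" "\<And>i. i \<in> S \<Longrightarrow> eventually (E i) (generics p)"
  shows "\<forall>\<^sub>F G in generics p. \<forall>i\<in>S. E i G"
proof (cases "S = {}")
  case False
  have "\<forall>i\<in>S. \<exists>D. (\<forall>n. dense_below p (D n)) \<and> (\<forall>G. generic_for p D G \<longrightarrow> E i G)"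
    using assms(2) unfolding eventually_generics by blast
  from bchoice[OF this] obtain D
    where D: "\<And>i n. i \<in> S \<Longrightarrow> dense_below p (D i n)"
      and E: "\<And>i G. i \<in> S \<Longrightarrow> generic_for p (D i) G \<Longrightarrow> E i G"
    by blast
  let ?D = "\<lambda>k. case prod_decode k of (m, n) \<Rightarrow> D (from_nat_into S m) n"
  have "E i G" if G: "generic_for p ?D G" and i: "i \<in> S" for G i
  proof (rule E[OF i])
    obtain k where "i = from_nat_into S k" using i assms(1) by (metis from_nat_into_surj)
    moreover have m: "\<forall>k. G \<inter> ?D k \<noteq> {}" using G by (auto simp: generic_for_def)
    ultimately have "G \<inter> D i n \<noteq> {}" for n using m[rule_format, of "prod_encode (k, n)"] by simp
    then show "generic_for p (D i) G" using G by (auto simp: generic_for_def)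
  qed
  moreover have "dense_below p (?D k)" for k
    using D from_nat_into[OF False] by (simp split: prod.split)
  ultimately show ?thesis unfolding eventually_generics by (intro exI[of _ ?D]) auto
qed simp

lemma eventually_generics_all_type:
  fixes E :: "'i::countable \<Rightarrow> 'p::preorder set \<Rightarrow> bool"
  assumes "\<And>i. eventually (E i) (generics p)"
  shows "\<forall>\<^sub>F G in generics p. \<forall>i. E i G"
  using eventually_generics_all[of UNIV E p] assms by simp

text \<open>
  The Rasiowa-Sikorski lemma: a descending sequence of conditions that enters one dense set
  after the other generates a filter that meets them all.
\<close>

lemma generics_nontrivial: "generics p \<noteq> bot"
proof
  assume "generics p = bot"
  then have "eventually (\<lambda>_. False) (generics p)" by simp
  then obtain D where D: "\<And>n. dense_below p (D n)" and none: "\<And>G. \<not> generic_for p D G"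
    unfolding eventually_generics by blast
  have "\<exists>s. \<forall>n. s n \<le> p \<and> (s (Suc n) \<le> s n \<and> s (Suc n) \<in> D n)"
  proof (rule dependent_nat_choice)
    show "\<exists>x. x \<le> p" by auto
    show "\<exists>y. y \<le> p \<and> y \<le> x \<and> y \<in> D n" if "x \<le> p" for x n
      using D[of n] that unfolding dense_below_def by (meson order_trans)
  qed
  then obtain s where s: "\<And>n. s n \<le> p" "\<And>n. s (Suc n) \<le> s n" "\<And>n. s (Suc n) \<in> D n" by blast
  have dec: "s n \<le> s m" if "m \<le> n" for m n
    using that by (induction rule: dec_induct) (simp, metis order_trans s(2))
  define G where "G = {r. \<exists>n. s n \<le> r}"
  have "condition_filter G"
    unfolding condition_filter_def
  proof (intro conjI ballI allI impI)
    show "t \<in> G" if "r \<in> G" "r \<le> t" for r t using that unfolding G_def by (blast intro: order_trans)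
    fix r t assume "r \<in> G" "t \<in> G"
    then obtain m n where "s m \<le> r" "s n \<le> t" unfolding G_def by blast
    moreover have "s (max m n) \<le> s m" "s (max m n) \<le> s n" by (simp_all add: dec)
    ultimately have "s (max m n) \<le> r" "s (max m n) \<le> t" by (meson order_trans)+
    then show "\<exists>u\<in>G. u \<le> r \<and> u \<le> t" unfolding G_def by (intro bexI[of _ "s (max m n)"]) auto
  qed
  moreover have "p \<in> G" using s(1) by (auto simp: G_def)
  moreover have "G \<inter> D n \<noteq> {}" for n
  proof -
    have "s (Suc n) \<in> G" by (auto simp: G_def)
    with s(3)[of n] show ?thesis by blast
  qed
  ultimately show False using none by (auto simp: generic_for_def)
qed

lemma not_eventually_generics_False: "\<not> (\<forall>\<^sub>F G in generics p. False)"
  using generics_nontrivial by (simp add: trivial_limit_def)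

lemma generics_contradiction:
  assumes "eventually E (generics q)" "eventually (\<lambda>G. \<not> E G) (generics q)"
  shows False
proof -
  have "\<forall>\<^sub>F G in generics q. False" using assms by eventually_elim simp
  then show False using not_eventually_generics_False by blast
qed

lemma eventually_generics_ground [simp]: "(\<forall>\<^sub>F G in generics p. b) \<longleftrightarrow> b"
  by (cases b) (auto simp: not_eventually_generics_False)

text \<open>
  This is the step from countably many dense sets to arbitrarily many. The conditions that make
  the event large are too numerous to treat all their dense sets at once. Along a maximal
  antichain the \<open>n\<close>-th dense sets can be united into a single one, and a filter meets the
  antichain only once.
\<close>

lemma eventually_generics_local:
  assumes loc: "\<And>q. q \<le> p \<Longrightarrow> \<exists>r\<le>q. eventually E (generics r)"
  shows "eventually E (generics (p::'p::preorder))"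
proof -
  obtain W where W: "W \<subseteq> {r. r \<le> p \<and> eventually E (generics r)}" "antichain W"
    and max: "\<And>r. r \<in> {r. r \<le> p \<and> eventually E (generics r)} \<Longrightarrow> \<exists>w\<in>W. compatible r w"
    using maximal_antichain by blast
  have "\<forall>w\<in>W. \<exists>D. (\<forall>n. dense_below w (D n)) \<and> (\<forall>G. generic_for w D G \<longrightarrow> E G)"
    using W(1) unfolding eventually_generics by blast
  from bchoice[OF this] obtain D
    where D: "\<And>w n. w \<in> W \<Longrightarrow> dense_below w (D w n)"
      and E: "\<And>w G. w \<in> W \<Longrightarrow> generic_for w (D w) G \<Longrightarrow> E G"
    by blast
  define D' where "D' n = {s. \<exists>w\<in>W. s \<le> w \<and> s \<in> D w n}" for n
  have "dense_below p (D' n)" for n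
    unfolding dense_below_def
  proof (intro allI impI)
    fix q assume "q \<le> p"
    then obtain r where r: "r \<le> q" "r \<le> p" "eventually E (generics r)"
      using loc by (meson order_trans)
    then obtain w t where w: "w \<in> W" "t \<le> r" "t \<le> w"
      using max[of r] unfolding compatible_def by blast
    then obtain s where "s \<le> t" "s \<in> D w n" using D[of w n] unfolding dense_below_def by blast
    moreover from this(1) w r have "s \<le> w" "s \<le> q" by (meson order_trans)+
    ultimately show "\<exists>r\<le>q. r \<in> D' n" using w(1) unfolding D'_def by blast
  qed
  moreover have "E G" if "generic_for p D' G" for G
  proof -
    have G: "condition_filter G" and m: "\<forall>n. G \<inter> D' n \<noteq> {}"
      using that by (auto simp: generic_for_def)
    have "\<exists>s w. s \<in> G \<and> w \<in> W \<and> w \<in> G \<and> s \<in> D w n" for n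
      using m[rule_format, of n] condition_filter_up[OF G] unfolding D'_def by blast
    then obtain s w where sw: "\<And>n. s n \<in> G" "\<And>n. w n \<in> W" "\<And>n. w n \<in> G" "\<And>n. s n \<in> D (w n) n"
      by metis
    \<comment> \<open>All the members of the antichain that were met are compatible, hence they are one and
      the same.\<close>
    have "w n = w 0" for n
      using W(2) sw(2) condition_filter_meet[OF G sw(3)[of n] sw(3)[of 0]]
      unfolding antichain_def compatible_def by metis
    then have "G \<inter> D (w 0) n \<noteq> {}" for n using sw(1,4)[of n] by (metis disjoint_iff)
    then have "generic_for (w 0) (D (w 0)) G" using G sw(3) by (simp add: generic_for_def)
    then show "E G" by (rule E[OF sw(2)])
  qed
  ultimately show ?thesis unfolding eventually_generics by blast
qed

section \<open>Decided events and the truth lemma\<close>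

text \<open>
  The analogue of the Baire property. It is what allows a set that depends on the sampled filter
  to be replaced by a name.
\<close>

definition decided :: "('p::preorder set \<Rightarrow> bool) \<Rightarrow> bool" where
  "decided E \<longleftrightarrow> (\<forall>q. \<exists>r\<le>q. eventually E (generics r) \<or> eventually (\<lambda>G. \<not> E G) (generics r))"

lemma decided_not: "decided E \<Longrightarrow> decided (\<lambda>G. \<not> E G)"
  unfolding decided_def by (simp add: disj_commute)

lemma decided_const: "decided (\<lambda>G. b)"
  unfolding decided_def by (cases b) auto

text \<open>
  If no extension of \<open>q\<close> refutes one of the \<open>E i\<close>, then each \<open>E i\<close> holds densely often below
  \<open>q\<close>, hence eventually at \<open>q\<close>.
\<close>

lemma decided_ball:
  assumes "countable S" "\<And>i. i \<in> S \<Longrightarrow> decided (E i)"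
  shows "decided (\<lambda>G. \<forall>i\<in>S. E i G)"
  unfolding decided_def
proof
  fix q
  show "\<exists>r\<le>q. (\<forall>\<^sub>F G in generics r. \<forall>i\<in>S. E i G) \<or> (\<forall>\<^sub>F G in generics r. \<not> (\<forall>i\<in>S. E i G))"
  proof (cases "\<exists>r\<le>q. \<exists>i\<in>S. eventually (\<lambda>G. \<not> E i G) (generics r)")
    case True
    then obtain r i where "r \<le> q" "i \<in> S" "eventually (\<lambda>G. \<not> E i G) (generics r)" by blast
    then have "\<forall>\<^sub>F G in generics r. \<not> (\<forall>i\<in>S. E i G)" by (auto elim: eventually_mono)
    with \<open>r \<le> q\<close> show ?thesis by blast
  next
    case False
    have "eventually (E i) (generics q)" if "i \<in> S" for i
    proof (rule eventually_generics_local)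
      fix s assume "s \<le> q"
      from assms(2)[OF that] obtain r where "r \<le> s"
        "eventually (E i) (generics r) \<or> eventually (\<lambda>G. \<not> E i G) (generics r)"
        unfolding decided_def by blast
      with False \<open>s \<le> q\<close> that show "\<exists>r\<le>s. eventually (E i) (generics r)" by (meson order_trans)
    qed
    then have "\<forall>\<^sub>F G in generics q. \<forall>i\<in>S. E i G" by (rule eventually_generics_all[OF assms(1)])
    then show ?thesis by blast
  qed
qed

lemma decided_all: "(\<And>i::'i::countable. decided (E i)) \<Longrightarrow> decided (\<lambda>G. \<forall>i. E i G)"
  using decided_ball[of "UNIV :: 'i set" E] by simp

lemma decided_conj: "decided E \<Longrightarrow> decided F \<Longrightarrow> decided (\<lambda>G. E G \<and> F G)"
proof -
  assume "decided E" "decided F"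
  then have "decided (if b then E else F)" for b by simp
  from decided_all[of "\<lambda>b. if b then E else F", OF this] show ?thesis by (simp add: all_bool_eq)
qed

lemma decided_disj: "decided E \<Longrightarrow> decided F \<Longrightarrow> decided (\<lambda>G. E G \<or> F G)"
  using decided_not[OF decided_conj[OF decided_not decided_not], of E F] by simp

lemma decided_imp: "decided E \<Longrightarrow> decided F \<Longrightarrow> decided (\<lambda>G. E G \<longrightarrow> F G)"
  unfolding imp_conv_disj by (intro decided_disj decided_not)

lemma decided_iff: "decided E \<Longrightarrow> decided F \<Longrightarrow> decided (\<lambda>G. E G \<longleftrightarrow> F G)"
  unfolding iff_conv_conj_imp by (intro decided_conj decided_imp)

lemma decided_ex:
  assumes "\<And>i::'i::countable. decided (E i)"
  shows "decided (\<lambda>G. \<exists>i. E i G)"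
  using decided_not[OF decided_all, of "\<lambda>i G. \<not> E i G"] decided_not[OF assms] by simp

lemmas decided_intros = decided_const decided_not decided_conj decided_disj decided_imp decided_iff
  decided_all decided_ex

lemma decided_finite:
  assumes "\<And>n::nat. decided (\<lambda>G. n \<in> X G)"
  shows "decided (\<lambda>G. finite (X G))"
proof -
  have "decided (\<lambda>G. \<exists>m. \<forall>n. n \<in> X G \<longrightarrow> n < m)" by (intro decided_intros assms)
  then show ?thesis by (simp add: finite_nat_set_iff_bounded Ball_def)
qed

lemma decided_holds:
  assumes "decided E" "\<And>q. q \<le> p \<Longrightarrow> \<not> eventually (\<lambda>G. \<not> E G) (generics q)"
  shows "eventually E (generics p)"
proof (rule eventually_generics_local)
  fix q assume "q \<le> p"
  obtain r where r: "r \<le> q" "eventually E (generics r) \<or> eventually (\<lambda>G. \<not> E G) (generics r)"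
    using assms(1) unfolding decided_def by blast
  moreover from r(1) \<open>q \<le> p\<close> have "r \<le> p" by (rule order_trans)
  ultimately have "eventually E (generics r)" using assms(2)[of r] by simp
  with r(1) show "\<exists>r\<le>q. eventually E (generics r)" by blast
qed

lemma truth:
  assumes "decided E"
  shows "\<forall>\<^sub>F G in generics p. E G \<longleftrightarrow> (\<exists>r\<in>G. eventually E (generics r))"
proof (rule eventually_generics_local)
  fix q assume "q \<le> p"
  from assms obtain r where r: "r \<le> q"
    "eventually E (generics r) \<or> eventually (\<lambda>G. \<not> E G) (generics r)"
    unfolding decided_def by blast
  from r(2) have "\<forall>\<^sub>F G in generics r. E G \<longleftrightarrow> (\<exists>r\<in>G. eventually E (generics r))"
  proof
    assume "eventually E (generics r)"
    then show ?thesis using eventually_generics_filter[of r]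
      by eventually_elim (use \<open>eventually E (generics r)\<close> in blast)
  next
    assume neg: "eventually (\<lambda>G. \<not> E G) (generics r)"
    then show ?thesis using eventually_generics_filter[of r]
    proof eventually_elim
      case (elim G)
      have False if "s \<in> G" "eventually E (generics s)" for s
      proof -
        from elim have "condition_filter G" "r \<in> G" by simp_all
        from condition_filter_meet[OF this that(1)] obtain t where "t \<le> r" "t \<le> s" by auto
        then show False
          using generics_contradiction[OF generics_mono[OF _ that(2)] generics_mono[OF _ neg], of t] by simp
      qed
      with elim show ?case by blast
    qed
  qed
  with r show "\<exists>r\<le>q. \<forall>\<^sub>F G in generics r. E G \<longleftrightarrow> (\<exists>r\<in>G. eventually E (generics r))" by blast
qed

section \<open>Names as random sets\<close>

definition val :: "('a, 'p::preorder) name \<Rightarrow> 'p set \<Rightarrow> 'a set" where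
  "val x G = {a. \<exists>s\<in>G. (a, s) \<in> x}"

text \<open>
  The inverse of \<open>val\<close>: the membership of \<open>a\<close> is forced by the conditions at which it holds
  eventually.
\<close>

definition name_of :: "('p::preorder set \<Rightarrow> 'a set) \<Rightarrow> ('a, 'p) name" where
  "name_of X = {(a, r). \<forall>\<^sub>F G in generics r. a \<in> X G}"

text \<open>
  A condition with no extension that puts \<open>a\<close> into \<open>x\<close> keeps \<open>a\<close> out, because the members of a
  filter are compatible.
\<close>

lemma decided_val: "decided (\<lambda>G. a \<in> val x G)"
  unfolding decided_def
proof
  fix q
  show "\<exists>r\<le>q. (\<forall>\<^sub>F G in generics r. a \<in> val x G) \<or> (\<forall>\<^sub>F G in generics r. a \<notin> val x G)"
  proof (cases "\<exists>r\<le>q. \<exists>s. (a, s) \<in> x \<and> r \<le> s")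
    case True
    then obtain r s where "r \<le> q" "(a, s) \<in> x" "r \<le> s" by blast
    moreover have "\<forall>\<^sub>F G in generics r. a \<in> val x G"
      using eventually_generics_filter[of r]
    proof eventually_elim
      case (elim G)
      with \<open>r \<le> s\<close> have "s \<in> G" by (blast intro: condition_filter_up)
      with \<open>(a, s) \<in> x\<close> show ?case by (auto simp: val_def)
    qed
    ultimately show ?thesis by blast
  next
    case False
    have "\<forall>\<^sub>F G in generics q. a \<notin> val x G"
      using eventually_generics_filter[of q]
    proof eventually_elim
      case (elim G)
      have False if "s \<in> G" "(a, s) \<in> x" for s
      proof -
        from elim have "condition_filter G" "q \<in> G" by simp_all
        from condition_filter_meet[OF this that(1)] obtain t where "t \<le> q" "t \<le> s" by auto
        with False that(2) show False by blast
      qed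
      then show ?case unfolding val_def by blast
    qed
    then show ?thesis by blast
  qed
qed

lemma val_name_of:
  fixes X :: "'p::preorder set \<Rightarrow> 'a::countable set"
  assumes "\<And>a. decided (\<lambda>G. a \<in> X G)"
  shows "\<forall>\<^sub>F G in generics p. val (name_of X) G = X G"
proof -
  have "\<forall>\<^sub>F G in generics p. \<forall>a. a \<in> X G \<longleftrightarrow> (\<exists>r\<in>G. \<forall>\<^sub>F G in generics r. a \<in> X G)"
    by (intro eventually_generics_all_type truth assms)
  then show ?thesis by eventually_elim (auto simp: val_def name_of_def)
qed

section \<open>Translating sentences of the forcing language\<close>

lemma forces_and: "(p \<tturnstile> \<phi> \<^bold>\<and> \<psi>) \<longleftrightarrow> (p \<tturnstile> \<phi>) \<and> (p \<tturnstile> \<psi>)"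
  by (simp add: fand_def forces_def)

lemma forces_all: "(p \<tturnstile> (\<^bold>\<forall>x. \<phi> x)) \<longleftrightarrow> (\<forall>x. p \<tturnstile> \<phi> x)"
  by (simp add: fall_def forces_def)

lemma forces_not: "(p \<tturnstile> \<^bold>\<not> \<phi>) \<longleftrightarrow> (\<forall>q\<le>p. \<not> (q \<tturnstile> \<phi>))"
  by (auto simp: fnot_def forces_def)

text \<open>
  The double negation hidden in the classical definition of implication amounts to allowing one
  extension of the condition before the conclusion is forced.
\<close>

lemma forces_imp: "(p \<tturnstile> \<phi> \<^bold>\<longrightarrow> \<psi>) \<longleftrightarrow> (\<forall>q\<le>p. (q \<tturnstile> \<phi>) \<longrightarrow> (\<exists>r\<le>q. r \<tturnstile> \<psi>))"
  by (auto simp: fimp_def forces_not forces_and)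

lemma forces_impI: "(\<And>q. q \<le> p \<Longrightarrow> q \<tturnstile> \<phi> \<Longrightarrow> \<exists>r\<le>q. r \<tturnstile> \<psi>) \<Longrightarrow> p \<tturnstile> \<phi> \<^bold>\<longrightarrow> \<psi>"
  by (simp add: forces_imp)

lemma forces_ex: "(p \<tturnstile> (\<^bold>\<exists>x. \<phi> x)) \<longleftrightarrow> (\<forall>q\<le>p. \<exists>r\<le>q. \<exists>x. r \<tturnstile> \<phi> x)"
  by (simp add: fex_def forces_not forces_all) blast

lemma forces_exD: "p \<tturnstile> (\<^bold>\<exists>x. \<phi> x) \<Longrightarrow> q \<le> p \<Longrightarrow> \<exists>r\<le>q. \<exists>x. r \<tturnstile> \<phi> x"
  by (simp add: forces_ex)

lemma forces_exI:
  fixes p :: "'p::preorder"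
  assumes "\<And>q. q \<le> p \<Longrightarrow> q \<tturnstile> \<phi> x"
  shows "p \<tturnstile> (\<^bold>\<exists>x. \<phi> x)"
  unfolding forces_ex using assms by blast

text \<open>
  The truth lemma for one sentence. It is available for sentences that quantify over countable
  types; quantifiers over names are treated separately.
\<close>

definition represents :: "'p::preorder sentence \<Rightarrow> ('p set \<Rightarrow> bool) \<Rightarrow> bool" where
  "represents \<phi> E \<longleftrightarrow> decided E \<and> (\<forall>p. (p \<tturnstile> \<phi>) \<longleftrightarrow> eventually E (generics p))"

lemma represents_forces: "represents \<phi> E \<Longrightarrow> (p \<tturnstile> \<phi>) \<longleftrightarrow> eventually E (generics p)"
  by (simp add: represents_def)

lemma represents_decided: "represents \<phi> E \<Longrightarrow> decided E"
  by (simp add: represents_def)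

lemma represents_ground: "represents (ground b) (\<lambda>G. b)"
  by (simp add: represents_def decided_const ground_def forces_def)

lemma represents_mem: "represents (a \<^bold>\<in> x) (\<lambda>G. a \<in> val x G)"
  unfolding represents_def
proof (intro conjI allI iffI)
  show "decided (\<lambda>G. a \<in> val x G)" by (rule decided_val)
  fix p
  let ?D = "{q. \<exists>s. (a, s) \<in> x \<and> q \<le> s}"
  show "\<forall>\<^sub>F G in generics p. a \<in> val x G" if "p \<tturnstile> a \<^bold>\<in> x"
  proof -
    have "dense_below p ?D" using that by (simp add: mem_def forces_def)
    from eventually_generics_dense_set[OF this] show ?thesis
      by eventually_elim (auto simp: val_def intro: condition_filter_up)
  qed
  show "p \<tturnstile> a \<^bold>\<in> x" if ev: "\<forall>\<^sub>F G in generics p. a \<in> val x G"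
    unfolding mem_def forces_def dense_below_def
  proof (intro allI impI)
    fix q assume "q \<le> p"
    from generics_mono[OF this ev] eventually_generics_filter[of q]
    have "\<forall>\<^sub>F G in generics q. \<exists>r\<le>q. r \<in> ?D"
    proof eventually_elim
      case (elim G)
      then obtain s where s: "s \<in> G" "(a, s) \<in> x" by (auto simp: val_def)
      from elim have "condition_filter G" "q \<in> G" by simp_all
      from condition_filter_meet[OF this s(1)] obtain t where "t \<le> q" "t \<le> s" by auto
      with s(2) show ?case by auto
    qed
    then show "\<exists>r\<le>q. r \<in> ?D" by simp
  qed
qed

lemma represents_and:
  "represents \<phi> E \<Longrightarrow> represents \<psi> F \<Longrightarrow> represents (\<phi> \<^bold>\<and> \<psi>) (\<lambda>G. E G \<and> F G)"
  by (simp add: represents_def decided_conj forces_and eventually_conj_iff)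

lemma represents_not:
  assumes "represents \<phi> E"
  shows "represents (\<^bold>\<not> \<phi>) (\<lambda>G. \<not> E G)"
  unfolding represents_def
proof (intro conjI allI iffI)
  have dec: "decided E" by (rule represents_decided[OF assms])
  show "decided (\<lambda>G. \<not> E G)" by (rule decided_not[OF dec])
  fix p
  show "\<forall>\<^sub>F G in generics p. \<not> E G" if "p \<tturnstile> \<^bold>\<not> \<phi>"
    using that by (intro decided_holds decided_not[OF dec])
      (simp add: forces_not represents_forces[OF assms])
  show "p \<tturnstile> \<^bold>\<not> \<phi>" if ev: "\<forall>\<^sub>F G in generics p. \<not> E G"
    unfolding forces_not represents_forces[OF assms]
    using generics_contradiction[OF _ generics_mono[OF _ ev]] by blast
qed

lemma represents_all:
  assumes "\<And>i::'i::countable. represents (\<phi> i) (E i)"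
  shows "represents (\<^bold>\<forall>i. \<phi> i) (\<lambda>G. \<forall>i. E i G)"
  unfolding represents_def
proof (intro conjI allI)
  show "decided (\<lambda>G. \<forall>i. E i G)" by (intro decided_all represents_decided[OF assms])
  show "(p \<tturnstile> (\<^bold>\<forall>i. \<phi> i)) \<longleftrightarrow> (\<forall>\<^sub>F G in generics p. \<forall>i. E i G)" for p
    unfolding forces_all represents_forces[OF assms]
    by (auto intro: eventually_generics_all_type elim: eventually_mono)
qed

lemma represents_imp:
  assumes "represents \<phi> E" "represents \<psi> F"
  shows "represents (\<phi> \<^bold>\<longrightarrow> \<psi>) (\<lambda>G. E G \<longrightarrow> F G)"
  using represents_not[OF represents_and[OF assms(1) represents_not[OF assms(2)]]]
  by (simp add: fimp_def)

lemma represents_iff: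
  assumes "represents \<phi> E" "represents \<psi> F"
  shows "represents (\<phi> \<^bold>\<longleftrightarrow> \<psi>) (\<lambda>G. E G \<longleftrightarrow> F G)"
  unfolding fiff_def iff_conv_conj_imp by (intro represents_and represents_imp assms)

lemma represents_ex:
  assumes "\<And>i::'i::countable. represents (\<phi> i) (E i)"
  shows "represents (\<^bold>\<exists>i. \<phi> i) (\<lambda>G. \<exists>i. E i G)"
  using represents_not[OF represents_all, of "\<lambda>i. \<^bold>\<not> \<phi> i" "\<lambda>i G. \<not> E i G"]
    represents_not[OF assms]
  by (simp add: fex_def)

lemmas represents_intros = represents_ground represents_mem represents_and represents_not
  represents_all represents_imp represents_iff represents_ex

lemma represents_eq:
  fixes x y :: "('a::countable, 'p::preorder) name"
  shows "represents (x \<^bold>= y) (\<lambda>G. val x G = val y G)"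
  unfolding eq_def set_eq_iff by (intro represents_intros)

lemma represents_sub:
  fixes x y :: "('a::countable, 'p::preorder) name"
  shows "represents (x \<^bold>\<subseteq> y) (\<lambda>G. val x G \<subseteq> val y G)"
  unfolding sub_def subset_eq Ball_def by (intro represents_intros)

lemma eventually_val_check: "\<forall>\<^sub>F G in generics p. val (check A) G = A"
  using eventually_generics_filter[of p]
  by eventually_elim (auto simp: val_def check_def)

lemma val_section_at: "val (section_at S i) G = val S G `` {i}"
  by (auto simp: val_def section_at_def)

lemma eventually_val_inter: "\<forall>\<^sub>F G in generics p. val (inter x y) G = val x G \<inter> val y G"
  for x y :: "('a::countable, 'p::preorder) name"
proof -
  let ?z = "\<lambda>G. val x G \<inter> val y G"
  have "inter x y = name_of ?z"
    unfolding inter_def name_of_def represents_forces[OF represents_mem]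
    by (simp add: eventually_conj_iff)
  moreover have "decided (\<lambda>G. a \<in> ?z G)" for a
    unfolding Int_iff by (intro decided_conj decided_val)
  ultimately show ?thesis using val_name_of[of ?z p] by simp
qed

text \<open>
  A finite subset of the natural numbers of the extension lies below some number \<open>k\<close> that an
  extension of the condition decides. The identity function then serves as its enumeration.
\<close>

lemma represents_finite_name:
  fixes x :: "(nat, 'p::preorder) name"
  shows "represents (finite_name x) (\<lambda>G. finite (val x G))"
  unfolding represents_def
proof (intro conjI allI iffI)
  show "decided (\<lambda>G. finite (val x G))" by (intro decided_finite decided_val)
  fix p
  have rep: "represents (single_valued_name e \<^bold>\<and> (\<^bold>\<forall>a. a \<^bold>\<in> x \<^bold>\<longrightarrow> (\<^bold>\<exists>i. ground (i < k) \<^bold>\<and> (i, a) \<^bold>\<in> e)))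
    (\<lambda>G. (\<forall>i a b. (i, a) \<in> val e G \<and> (i, b) \<in> val e G \<longrightarrow> a = b) \<and>
         (\<forall>a. a \<in> val x G \<longrightarrow> (\<exists>i. i < k \<and> (i, a) \<in> val e G)))" for k :: nat and e
    unfolding single_valued_name_def by (intro represents_intros)
  show "\<forall>\<^sub>F G in generics p. finite (val x G)" if "p \<tturnstile> finite_name x"
  proof (rule eventually_generics_local)
    fix q assume "q \<le> p"
    from forces_exD[OF that[unfolded finite_name_def] this] obtain r and k :: nat where "r \<le> q" and
      ex: "r \<tturnstile> (\<^bold>\<exists>e. single_valued_name e \<^bold>\<and> (\<^bold>\<forall>a. a \<^bold>\<in> x \<^bold>\<longrightarrow> (\<^bold>\<exists>i. ground (i < k) \<^bold>\<and> (i, a) \<^bold>\<in> e)))"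
      by blast
    from forces_exD[OF ex order_refl] obtain r' e where "r' \<le> r" and
      "r' \<tturnstile> single_valued_name e \<^bold>\<and> (\<^bold>\<forall>a. a \<^bold>\<in> x \<^bold>\<longrightarrow> (\<^bold>\<exists>i. ground (i < k) \<^bold>\<and> (i, a) \<^bold>\<in> e))"
      by blast
    from this(2) have "\<forall>\<^sub>F G in generics r'. finite (val x G)"
      unfolding represents_forces[OF rep]
    proof eventually_elim
      case (elim G)
      then have "val x G \<subseteq> (\<lambda>i. THE a. (i, a) \<in> val e G) ` {..<k}"
      proof (intro subsetI)
        fix a assume "a \<in> val x G"
        with elim obtain i where i: "i < k" "(i, a) \<in> val e G" by blast
        with elim have "(THE b. (i, b) \<in> val e G) = a" by (intro the_equality) blast+
        with i(1) show "a \<in> (\<lambda>i. THE a. (i, a) \<in> val e G) ` {..<k}" by auto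
      qed
      then show ?case by (rule finite_subset) simp
    qed
    with \<open>r' \<le> r\<close> \<open>r \<le> q\<close> show "\<exists>r\<le>q. \<forall>\<^sub>F G in generics r. finite (val x G)"
      by (meson order_trans)
  qed
  show "p \<tturnstile> finite_name x" if ev: "\<forall>\<^sub>F G in generics p. finite (val x G)"
    unfolding finite_name_def forces_ex[of p]
  proof (intro allI impI)
    fix q assume "q \<le> p"
    have "\<exists>k. \<exists>r\<le>q. \<forall>\<^sub>F G in generics r. val x G \<subseteq> {..<k}"
    proof (rule ccontr)
      assume none: "\<not> ?thesis"
      have "decided (\<lambda>G. val x G \<subseteq> {..<k})" for k
        unfolding subset_eq Ball_def lessThan_iff by (intro decided_intros decided_val)
      then have "\<forall>\<^sub>F G in generics q. \<not> val x G \<subseteq> {..<k}" for k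
        using none by (intro decided_holds decided_not) auto
      then have "\<forall>\<^sub>F G in generics q. \<forall>k. \<not> val x G \<subseteq> {..<k}"
        by (rule eventually_generics_all_type)
      with generics_mono[OF \<open>q \<le> p\<close> ev] have "\<forall>\<^sub>F G in generics q. False"
        by eventually_elim (auto dest: finite_nat_bounded)
      then show False by simp
    qed
    then obtain k r where r: "r \<le> q" "\<forall>\<^sub>F G in generics r. val x G \<subseteq> {..<k}" by blast
    let ?e = "check {(i, i) | i::nat. True}"
    have "r \<tturnstile> (\<^bold>\<exists>e. single_valued_name e \<^bold>\<and> (\<^bold>\<forall>a. a \<^bold>\<in> x \<^bold>\<longrightarrow> (\<^bold>\<exists>i. ground (i < k) \<^bold>\<and> (i, a) \<^bold>\<in> e)))"
    proof (rule forces_exI[of _ _ ?e])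
      fix s assume "s \<le> r"
      from generics_mono[OF this r(2)] eventually_val_check[of "{(i, i) | i::nat. True}" s]
      show "s \<tturnstile> single_valued_name ?e \<^bold>\<and> (\<^bold>\<forall>a. a \<^bold>\<in> x \<^bold>\<longrightarrow> (\<^bold>\<exists>i. ground (i < k) \<^bold>\<and> (i, a) \<^bold>\<in> ?e))"
        unfolding represents_forces[OF rep] by eventually_elim auto
    qed
    with r(1) show "\<exists>r\<le>q. \<exists>k::nat. r \<tturnstile> (\<^bold>\<exists>e. single_valued_name e \<^bold>\<and>
        (\<^bold>\<forall>a. a \<^bold>\<in> x \<^bold>\<longrightarrow> (\<^bold>\<exists>i. ground (i < k) \<^bold>\<and> (i, a) \<^bold>\<in> e)))"
      by blast
  qed
qed

lemma represents_fin_sequence_name: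
  "represents (fin_sequence_name C) (\<lambda>G. fin_sequence (\<lambda>n. val C G `` {n}))"
proof -
  have "represents (fin_sequence_name C)
    (\<lambda>G. (\<forall>n. finite (val (section_at C n) G) \<and> (\<exists>k. k \<in> val (section_at C n) G)) \<and>
      (\<forall>n m. n \<noteq> m \<longrightarrow> \<not> (\<exists>k. k \<in> val (section_at C n) G \<and> k \<in> val (section_at C m) G)))"
    unfolding fin_sequence_name_def by (intro represents_intros represents_finite_name)
  also have "(\<lambda>G. (\<forall>n. finite (val (section_at C n) G) \<and> (\<exists>k. k \<in> val (section_at C n) G)) \<and>
      (\<forall>n m. n \<noteq> m \<longrightarrow> \<not> (\<exists>k. k \<in> val (section_at C n) G \<and> k \<in> val (section_at C m) G))) =
    (\<lambda>G. fin_sequence (\<lambda>n. val C G `` {n}))"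
    unfolding val_section_at fin_sequence_def by (intro ext) blast
  finally show ?thesis .
qed

lemma forces_total_function:
  assumes "\<forall>\<^sub>F G in generics p. \<forall>i::nat. \<exists>!a::nat. (i, a) \<in> val f G"
  shows "p \<tturnstile> total_function f"
proof -
  have rep: "represents (total_function f)
    (\<lambda>G. (\<forall>i a b. (i, a) \<in> val f G \<and> (i, b) \<in> val f G \<longrightarrow> a = b) \<and> (\<forall>i. \<exists>a. (i, a) \<in> val f G))"
    unfolding total_function_def single_valued_name_def by (intro represents_intros)
  show ?thesis unfolding represents_forces[OF rep] using assms by eventually_elim blast
qed

lemma le_star_check_funD:
  assumes "p \<tturnstile> f \<^bold>\<le>\<^sup>* check_fun h"
  shows "\<forall>\<^sub>F G in generics p. finite {n. \<exists>j. (n, j) \<in> val f G \<and> h n < j}"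
proof (rule eventually_generics_local)
  fix q assume "q \<le> p"
  let ?g = "check_fun h"
  have rep: "represents (finite_name x \<^bold>\<and>
     (\<^bold>\<forall>n. n \<^bold>\<in> x \<^bold>\<longleftrightarrow> (\<^bold>\<exists>i. \<^bold>\<exists>j. (n, i) \<^bold>\<in> ?g \<^bold>\<and> (n, j) \<^bold>\<in> f \<^bold>\<and> ground (i < j))))
     (\<lambda>G. finite (val x G) \<and>
       (\<forall>n. n \<in> val x G \<longleftrightarrow> (\<exists>i j. (n, i) \<in> val ?g G \<and> (n, j) \<in> val f G \<and> i < j)))" for x
    by (intro represents_intros represents_finite_name)
  from forces_exD[OF assms[unfolded le_star_def] \<open>q \<le> p\<close>]
  obtain r x where "r \<le> q" and fx: "r \<tturnstile> finite_name x \<^bold>\<and>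
     (\<^bold>\<forall>n. n \<^bold>\<in> x \<^bold>\<longleftrightarrow> (\<^bold>\<exists>i. \<^bold>\<exists>j. (n, i) \<^bold>\<in> ?g \<^bold>\<and> (n, j) \<^bold>\<in> f \<^bold>\<and> ground (i < j)))"
    by blast
  have "\<forall>\<^sub>F G in generics r. val ?g G = {(i, h i) | i. True}"
    unfolding check_fun_def by (rule eventually_val_check)
  with fx have "\<forall>\<^sub>F G in generics r. finite {n. \<exists>j. (n, j) \<in> val f G \<and> h n < j}"
    unfolding represents_forces[OF rep]
  proof eventually_elim
    case (elim G)
    then have "{n. \<exists>j. (n, j) \<in> val f G \<and> h n < j} \<subseteq> val x G" by auto
    then show ?case using elim finite_subset by blast
  qed
  with \<open>r \<le> q\<close>
  show "\<exists>r\<le>q. \<forall>\<^sub>F G in generics r. finite {n. \<exists>j. (n, j) \<in> val f G \<and> h n < j}" by blast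
qed

lemma Mem_mono: "q \<le> p \<Longrightarrow> p \<tturnstile> x \<^bold>\<in>\<^bold>\<in> F \<Longrightarrow> q \<tturnstile> x \<^bold>\<in>\<^bold>\<in> F"
  unfolding Mem_def forces_def dense_below_def by (meson order_trans)

lemma Mem_local: "(\<And>q. q \<le> p \<Longrightarrow> \<exists>r\<le>q. r \<tturnstile> x \<^bold>\<in>\<^bold>\<in> F) \<Longrightarrow> p \<tturnstile> x \<^bold>\<in>\<^bold>\<in> F"
  unfolding Mem_def forces_def dense_below_def by (meson order_trans order_refl)

lemma Mem_cong:
  fixes x y :: "('a::countable, 'p::preorder) name"
  assumes "\<forall>\<^sub>F G in generics p. val x G = val y G" "p \<tturnstile> x \<^bold>\<in>\<^bold>\<in> F"
  shows "p \<tturnstile> y \<^bold>\<in>\<^bold>\<in> F"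
  unfolding Mem_def forces_def[of p] dense_below_def
proof (intro allI impI)
  fix q assume "q \<le> p"
  with assms(2) obtain r z s where r: "r \<le> q" "(z, s) \<in> F" "r \<le> s" "r \<tturnstile> x \<^bold>= z"
    unfolding Mem_def forces_def[of p] dense_below_def by blast
  have "r \<le> p" using r(1) \<open>q \<le> p\<close> by (rule order_trans)
  from generics_mono[OF this assms(1)] r(4) have "r \<tturnstile> y \<^bold>= z"
    unfolding represents_forces[OF represents_eq] by eventually_elim simp
  with r show "\<exists>r\<le>q. r \<in> {q. \<exists>z s. (z, s) \<in> F \<and> q \<le> s \<and> (q \<tturnstile> y \<^bold>= z)}" by blast
qed

lemma forces_Mem_Check:
  fixes x :: "('a::countable, 'p::preorder) name"
  shows "(p \<tturnstile> x \<^bold>\<in>\<^bold>\<in> Check \<A>) \<longleftrightarrow> (\<forall>q\<le>p. \<exists>r\<le>q. \<exists>a\<in>\<A>. \<forall>\<^sub>F G in generics r. val x G = a)"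
proof -
  have "(q \<tturnstile> x \<^bold>= check a) \<longleftrightarrow> (\<forall>\<^sub>F G in generics q. val x G = a)" for q a
  proof
    assume "q \<tturnstile> x \<^bold>= check a"
    with eventually_val_check[of a q] show "\<forall>\<^sub>F G in generics q. val x G = a"
      unfolding represents_forces[OF represents_eq] by eventually_elim simp
  next
    assume "\<forall>\<^sub>F G in generics q. val x G = a"
    with eventually_val_check[of a q] show "q \<tturnstile> x \<^bold>= check a"
      unfolding represents_forces[OF represents_eq] by eventually_elim simp
  qed
  moreover have "(\<exists>y s. (y, s) \<in> Check \<A> \<and> q \<le> s \<and> (q \<tturnstile> x \<^bold>= y)) \<longleftrightarrow>
      (\<exists>a\<in>\<A>. q \<tturnstile> x \<^bold>= check a)" for q
    unfolding Check_def by blast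
  ultimately show ?thesis unfolding Mem_def forces_def[of p] dense_below_def by simp
qed

lemma forces_check_Mem_Check:
  fixes a :: "'a::countable set" and p :: "'p::preorder"
  shows "a \<in> \<A> \<Longrightarrow> p \<tturnstile> check a \<^bold>\<in>\<^bold>\<in> Check \<A>"
  unfolding forces_Mem_Check using eventually_val_check by blast

section \<open>Traces on fin sequences\<close>

definition trace :: "nat set \<Rightarrow> (nat \<Rightarrow> nat set) \<Rightarrow> nat set \<Rightarrow> nat set" where
  "trace a c I = {n \<in> I. a \<inter> c n \<noteq> {}}"

text \<open>
  With the traces of all members settled on \<open>I\<close>, the infinite ones are cofinite in \<open>I\<close>.
\<close>

definition settled :: "nat set \<Rightarrow> (nat \<Rightarrow> nat set) \<Rightarrow> nat set \<Rightarrow> bool" where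
  "settled a c I \<longleftrightarrow> finite (trace a c I) \<or> finite (I - trace a c I)"

definition dead :: "nat set set \<Rightarrow> (nat \<Rightarrow> nat set) \<Rightarrow> nat set \<Rightarrow> bool" where
  "dead A c I \<longleftrightarrow> (\<exists>H\<subseteq>A. finite H \<and> finite {n \<in> I. \<not> c n \<subseteq> \<Union>H})"

definition alive :: "nat set set \<Rightarrow> (nat \<Rightarrow> nat set) \<Rightarrow> nat set \<Rightarrow> bool" where
  "alive A c I \<longleftrightarrow> infinite {a \<in> A. infinite (trace a c I)}"

lemma almost_disjointD:
  "almost_disjoint A \<Longrightarrow> a \<in> A \<Longrightarrow> b \<in> A \<Longrightarrow> a \<noteq> b \<Longrightarrow> finite (a \<inter> b)"
  by (simp add: almost_disjoint_def)

lemma dead_mono: "A \<subseteq> B \<Longrightarrow> dead A c I \<Longrightarrow> dead B c I"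
  unfolding dead_def by (meson subset_trans)

lemma alive_mono: "A \<subseteq> B \<Longrightarrow> alive A c I \<Longrightarrow> alive B c I"
  unfolding alive_def by (erule contrapos_nn) (auto elim: finite_subset[rotated])

lemma finite_indices_meeting:
  assumes "fin_sequence c" "finite X"
  shows "finite {n. X \<inter> c n \<noteq> {}}"
proof -
  have "finite {n. x \<in> c n}" for x
  proof -
    have "n = m" if "x \<in> c n" "x \<in> c m" for n m
      using assms(1) that unfolding fin_sequence_def by blast
    then have "{n. x \<in> c n} \<subseteq> {THE n. x \<in> c n}" by (auto intro!: the_equality[symmetric])
    then show ?thesis by (rule finite_subset) simp
  qed
  then have "finite (\<Union>x\<in>X. {n. x \<in> c n})" using assms(2) by simp
  moreover have "{n. X \<inter> c n \<noteq> {}} = (\<Union>x\<in>X. {n. x \<in> c n})" by auto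
  ultimately show ?thesis by simp
qed

lemma finite_Int_Union:
  assumes "finite H" "\<And>a. a \<in> H \<Longrightarrow> finite (b \<inter> a)"
  shows "finite (b \<inter> \<Union>H)"
proof -
  have "finite (\<Union>a\<in>H. b \<inter> a)" using assms by (rule finite_UN_I)
  then show ?thesis by (rule rev_finite_subset) blast
qed

text \<open>
  Outside finitely many indices \<open>b\<close> can meet \<open>c n\<close> only inside the finite set \<open>b \<inter> \<Union>H\<close>, and
  disjointness leaves only finitely many such indices.
\<close>

lemma finite_trace_covered:
  assumes "fin_sequence c" "finite H" "finite {n \<in> I. \<not> c n \<subseteq> \<Union>H}" "\<And>a. a \<in> H \<Longrightarrow> finite (b \<inter> a)"
  shows "finite (trace b c I)"
proof -
  have "finite (b \<inter> \<Union>H)" by (rule finite_Int_Union[OF assms(2,4)])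
  from finite_indices_meeting[OF assms(1) this] assms(3)
  have "finite ({n. (b \<inter> \<Union>H) \<inter> c n \<noteq> {}} \<union> {n \<in> I. \<not> c n \<subseteq> \<Union>H})" by simp
  then show ?thesis by (rule rev_finite_subset) (auto simp: trace_def)
qed

text \<open>
  Some \<open>a \<notin> H\<close> meets almost all \<open>c n\<close>, \<open>n \<in> I\<close>. Since \<open>a\<close> is almost disjoint from \<open>\<Union>H\<close>, it meets
  almost all of them outside \<open>\<Union>H\<close>.
\<close>

lemma alive_not_covered:
  assumes "fin_sequence c" "almost_disjoint A" "\<And>a. a \<in> A \<Longrightarrow> settled a c I" "alive A c I"
    and H: "H \<subseteq> A" "finite H"
  shows "finite {n \<in> I. c n \<subseteq> \<Union>H}"
proof -
  have "infinite ({a \<in> A. infinite (trace a c I)} - H)" using assms(4) H(2) by (simp add: alive_def)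
  then have "{a \<in> A. infinite (trace a c I)} - H \<noteq> {}" by (rule infinite_imp_nonempty)
  then obtain a where a: "a \<in> A" "infinite (trace a c I)" "a \<notin> H" by blast
  have "finite (a \<inter> b)" if "b \<in> H" for b
    using H(1) a that by (intro almost_disjointD[OF assms(2)]) auto
  then have "finite (a \<inter> \<Union>H)" by (rule finite_Int_Union[OF H(2)])
  from finite_indices_meeting[OF assms(1) this]
  have "finite ({n. (a \<inter> \<Union>H) \<inter> c n \<noteq> {}} \<union> (I - trace a c I))"
    using assms(3)[OF a(1)] a(2) by (simp add: settled_def)
  then show ?thesis by (rule rev_finite_subset) (auto simp: trace_def)
qed

text \<open>
  From each \<open>c n\<close> the sets \<open>a 0, a 1, \<dots>\<close> are removed as long as something remains and the index
  is at most \<open>n\<close>; the remainders are collected. The set is declared empty unless each finite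
  subfamily covers only finitely many \<open>c n\<close>, so that it is almost disjoint from all \<open>a i\<close> for
  every fin sequence. The inclusions are written out as quantifiers over numbers to make it
  evident that membership is a decided event.
\<close>

definition escape :: "(nat \<Rightarrow> nat set) \<Rightarrow> (nat \<Rightarrow> nat set) \<Rightarrow> nat set \<Rightarrow> nat set" where
  "escape a c I = {x. (\<forall>k. finite {n. n \<in> I \<and> (\<forall>y. y \<in> c n \<longrightarrow> y \<in> (\<Union>j\<le>k. a j))}) \<and>
     (\<exists>n. n \<in> I \<and> x \<in> c n \<and> (\<forall>i. i \<le> n \<and> x \<in> a i \<longrightarrow> (\<forall>y. y \<in> c n \<longrightarrow> y \<in> (\<Union>j\<le>i. a j))))}"

text \<open>
  A point of \<open>c n\<close> that lies in \<open>a i\<close> survives only if \<open>n < i\<close> or if \<open>a 0, \<dots>, a i\<close> cover \<open>c n\<close>,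
  which happens for finitely many \<open>n\<close>.
\<close>

lemma finite_escape_Int:
  assumes "fin_sequence c"
  shows "finite (escape a c I \<inter> a i)"
proof (cases "\<forall>k. finite {n. n \<in> I \<and> (\<forall>y. y \<in> c n \<longrightarrow> y \<in> (\<Union>j\<le>k. a j))}")
  case True
  let ?N = "{n. n \<in> I \<and> (\<forall>y. y \<in> c n \<longrightarrow> y \<in> (\<Union>j\<le>i. a j))} \<union> {..<i}"
  have "escape a c I \<inter> a i \<subseteq> (\<Union>n\<in>?N. c n)"
  proof
    fix x assume "x \<in> escape a c I \<inter> a i"
    then obtain n where n: "n \<in> I" "x \<in> c n"
      "i \<le> n \<longrightarrow> (\<forall>y. y \<in> c n \<longrightarrow> y \<in> (\<Union>j\<le>i. a j))"
      unfolding escape_def by blast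
    then have "n \<in> ?N" by (cases "i \<le> n") auto
    with n(2) show "x \<in> (\<Union>n\<in>?N. c n)" by blast
  qed
  moreover have "finite (\<Union>n\<in>?N. c n)"
    using True assms by (auto simp: fin_sequence_def)
  ultimately show ?thesis by (rule finite_subset)
next
  case False
  have "escape a c I = {}"
  proof (rule equals0I)
    fix x assume "x \<in> escape a c I"
    with False show False unfolding escape_def mem_Collect_eq by (elim conjE) (rule notE)
  qed
  then show ?thesis by simp
qed

lemma escape_meets:
  assumes "fin_sequence c" "n \<in> I" "\<And>k. finite {n \<in> I. c n \<subseteq> (\<Union>j\<le>k. a j)}"
  shows "escape a c I \<inter> c n \<noteq> {}"
proof -
  define Q where "Q i \<longleftrightarrow> c n \<subseteq> (\<Union>j\<le>i. a j)" for i
  \<comment> \<open>At \<open>m\<close> the removal of \<open>a 0, a 1, \<dots>\<close> from \<open>c n\<close> stops, either because \<open>a m\<close> would exhaust \<open>c n\<close> or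
    because the index exceeds \<open>n\<close>.\<close>
  obtain m where m: "m \<le> n \<Longrightarrow> Q m" and least: "\<And>k. k < m \<Longrightarrow> k \<le> n \<Longrightarrow> \<not> Q k"
    and "m \<le> Suc n"
  proof (cases "\<exists>i\<le>n. Q i")
    case True
    then have "Q (LEAST i. Q i)" by (metis LeastI)
    moreover have "(LEAST i. Q i) \<le> n" using True by (meson Least_le order_trans)
    ultimately show ?thesis using not_less_Least by (intro that[of "LEAST i. Q i"]) auto
  next
    case False
    then show ?thesis by (intro that[of "Suc n"]) auto
  qed
  have "\<not> c n \<subseteq> (\<Union>j<m. a j)"
  proof (cases m)
    case 0
    then show ?thesis using assms(1) by (simp add: fin_sequence_def)
  next
    case (Suc k)
    then have "\<not> Q k" using least[of k] \<open>m \<le> Suc n\<close> by simp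
    then show ?thesis unfolding Q_def Suc lessThan_Suc_atMost .
  qed
  then obtain x where x: "x \<in> c n" "\<And>j. j < m \<Longrightarrow> x \<notin> a j" by blast
  have "\<forall>y. y \<in> c n \<longrightarrow> y \<in> (\<Union>j\<le>i. a j)" if "i \<le> n \<and> x \<in> a i" for i
  proof -
    have "m \<le> i" using that x(2) by (meson not_le)
    with that have "c n \<subseteq> (\<Union>j\<le>m. a j)" by (intro m[unfolded Q_def]) simp
    also have "\<dots> \<subseteq> (\<Union>j\<le>i. a j)" using \<open>m \<le> i\<close> by (intro UN_mono) auto
    finally show ?thesis by blast
  qed
  moreover have "\<forall>k. finite {n. n \<in> I \<and> (\<forall>y. y \<in> c n \<longrightarrow> y \<in> (\<Union>j\<le>k. a j))}"
    using assms(3) by (simp add: subset_eq Ball_def)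
  ultimately have "x \<in> escape a c I" using assms(2) x(1) unfolding escape_def by blast
  with x(1) show ?thesis by blast
qed

lemma settled_if_escape:
  assumes c: "fin_sequence c" and A: "almost_disjoint (range a)"
    and settled: "\<And>i. settled (a i) c I" and alive: "alive (range a) c I"
    and esc: "finite (escape a c I - b)"
  shows "finite (I - trace b c I)"
proof -
  have "finite {n \<in> I. c n \<subseteq> (\<Union>j\<le>k. a j)}" for k
  proof -
    have "(\<Union>j\<le>k. a j) = \<Union>(a ` {..k})" by simp
    then show ?thesis
      using alive_not_covered[OF c A _ alive, of "a ` {..k}"] settled by auto
  qed
  from escape_meets[OF c _ this]
  have "I - trace b c I \<subseteq> {n. (escape a c I - b) \<inter> c n \<noteq> {}}"
    by (force simp: trace_def)
  then show ?thesis by (rule finite_subset[OF _ finite_indices_meeting[OF c esc]])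
qed

lemma settled_new_set:
  assumes c: "fin_sequence c" and A: "almost_disjoint (range a)"
    and settled: "\<And>i. settled (a i) c I" and da: "dead (range a) c I \<or> alive (range a) c I"
    and b: "\<And>i. finite (b \<inter> a i)" and esc: "finite (escape a c I - b)"
  shows "settled b c I"
  using da
proof
  assume "dead (range a) c I"
  then obtain H where "H \<subseteq> range a" "finite H" "finite {n \<in> I. \<not> c n \<subseteq> \<Union>H}"
    unfolding dead_def by blast
  then have "finite (trace b c I)" using b by (intro finite_trace_covered[OF c]) auto
  then show ?thesis by (simp add: settled_def)
next
  assume "alive (range a) c I"
  from settled_if_escape[OF c A settled this esc] show ?thesis by (simp add: settled_def)
qed

text \<open>
  What remains of the \<open>c n\<close> after the removal of all \<open>a i\<close> with an infinite trace. It is almost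
  disjoint from every \<open>a i\<close>: from those removed trivially, from the others because their traces
  are finite.
\<close>

definition residue :: "(nat \<Rightarrow> nat set) \<Rightarrow> (nat \<Rightarrow> nat set) \<Rightarrow> nat set \<Rightarrow> nat set" where
  "residue a c I = {x. \<exists>n. n \<in> I \<and> x \<in> c n \<and>
     (\<forall>i. x \<in> a i \<longrightarrow> finite {n. n \<in> I \<and> (\<exists>y. y \<in> a i \<and> y \<in> c n)})}"

lemma trace_alt: "trace a c I = {n. n \<in> I \<and> (\<exists>y. y \<in> a \<and> y \<in> c n)}"
  by (auto simp: trace_def)

lemma finite_residue_Int:
  assumes "fin_sequence c"
  shows "finite (residue a c I \<inter> a i)"
proof (cases "finite (trace (a i) c I)")
  case True
  have "residue a c I \<inter> a i \<subseteq> (\<Union>n\<in>trace (a i) c I. c n)"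
    unfolding residue_def trace_alt by blast
  moreover have "finite (\<Union>n\<in>trace (a i) c I. c n)"
    using True assms by (auto simp: fin_sequence_def)
  ultimately show ?thesis by (rule finite_subset)
next
  case False
  then have "residue a c I \<inter> a i = {}" unfolding residue_def trace_alt[symmetric] by blast
  then show ?thesis by simp
qed

text \<open>
  Let \<open>H\<close> consist of the \<open>a i\<close> with an infinite trace. If \<open>H\<close> is infinite, \<open>I\<close> is alive. If \<open>H\<close>
  is finite and covers almost all \<open>c n\<close>, then \<open>I\<close> is dead. Otherwise \<open>H\<close> covers only finitely
  many \<open>c n\<close>, because \<open>I\<close> decides this question, and \<open>b\<close> contains almost all of what \<open>H\<close> leaves:
  \<open>b\<close> meets almost all \<open>c n\<close>, and \<open>insert b H\<close> covers almost all of them.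
\<close>

lemma dead_or_alive_new:
  assumes c: "fin_sequence c" and A: "almost_disjoint (range a)"
    and settled: "\<And>i. settled (a i) c I"
    and covered: "\<And>S. finite S \<Longrightarrow>
      finite {n \<in> I. c n \<subseteq> \<Union>(a ` S)} \<or> finite {n \<in> I. \<not> c n \<subseteq> \<Union>(a ` S)}"
    and b: "\<And>i. finite (b \<inter> a i)" and esc: "finite (escape a c I - b)"
    and res: "finite (residue a c I - b)"
  shows "settled b c I \<and> (dead (insert b (range a)) c I \<or> alive (insert b (range a)) c I)"
proof (cases "alive (range a) c I")
  case True
  then have "settled b c I" by (intro settled_new_set[OF c A settled _ b esc]) simp
  with True show ?thesis using alive_mono[of "range a" "insert b (range a)"] by blast
next
  case False
  define H where "H = {x \<in> range a. infinite (trace x c I)}"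
  have H: "H \<subseteq> range a" "finite H" using False by (auto simp: alive_def H_def)
  then obtain S where S: "finite S" "H = a ` S" by (meson finite_subset_image)
  show ?thesis
  proof (cases "finite {n \<in> I. \<not> c n \<subseteq> \<Union>H}")
    case True
    then have "dead (insert b (range a)) c I" unfolding dead_def using H by blast
    moreover have "finite (trace b c I)"
      using H b True by (intro finite_trace_covered[OF c]) auto
    ultimately show ?thesis by (simp add: settled_def)
  next
    case False
    then have fin: "finite {n \<in> I. c n \<subseteq> \<Union>H}" using covered[OF S(1)] S(2) by simp
    have in_res: "x \<in> residue a c I" if "n \<in> I" "x \<in> c n" "x \<notin> \<Union>H" for n x
      using that unfolding residue_def trace_alt[symmetric] H_def by blast
    have fr: "finite {n. (residue a c I - b) \<inter> c n \<noteq> {}}" by (rule finite_indices_meeting[OF c res])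
    have "I - trace b c I \<subseteq> {n. (residue a c I - b) \<inter> c n \<noteq> {}} \<union> {n \<in> I. c n \<subseteq> \<Union>H}"
      using in_res unfolding trace_def by blast
    then have "finite (I - trace b c I)" by (rule finite_subset) (use fr fin in simp)
    moreover have "{n \<in> I. \<not> c n \<subseteq> \<Union>(insert b H)} \<subseteq> {n. (residue a c I - b) \<inter> c n \<noteq> {}}"
      using in_res by blast
    then have "finite {n \<in> I. \<not> c n \<subseteq> \<Union>(insert b H)}" by (rule finite_subset[OF _ fr])
    then have "dead (insert b (range a)) c I"
      unfolding dead_def using H by (intro exI[of _ "insert b H"]) auto
    ultimately show ?thesis by (simp add: settled_def)
  qed
qed

section \<open>An index set that decides countably many questions\<close>

text \<open>
  The recursion keeps the intersection with \<open>D i\<close> if it is infinite and the difference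
  otherwise. It is explicit, and not a matter of choice, so that \<open>diagonal\<close> is a decided
  function of \<open>D\<close>.
\<close>

primrec greedy :: "(nat \<Rightarrow> nat set) \<Rightarrow> nat \<Rightarrow> nat set" where
  "greedy D 0 = UNIV"
| "greedy D (Suc i) =
     (if finite {n. n \<in> greedy D i \<and> n \<in> D i} then {n. n \<in> greedy D i \<and> n \<notin> D i}
      else {n. n \<in> greedy D i \<and> n \<in> D i})"

text \<open>
  The set of the least elements \<open>\<ge> i\<close> of \<open>greedy D i\<close>, a pseudointersection of the decreasing
  sequence \<open>greedy D\<close>.
\<close>

definition diagonal :: "(nat \<Rightarrow> nat set) \<Rightarrow> nat set" where
  "diagonal D = {n. \<exists>i. i \<le> n \<and> n \<in> greedy D i \<and> (\<forall>m. i \<le> m \<and> m < n \<longrightarrow> m \<notin> greedy D i)}"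

lemma infinite_greedy: "infinite (greedy D i)"
proof (induction i)
  case (Suc i)
  have "greedy D i = {n. n \<in> greedy D i \<and> n \<in> D i} \<union> {n. n \<in> greedy D i \<and> n \<notin> D i}" by auto
  with Suc have "infinite ({n. n \<in> greedy D i \<and> n \<in> D i} \<union> {n. n \<in> greedy D i \<and> n \<notin> D i})" by simp
  then show ?case by auto
qed simp

lemma greedy_antimono: "i \<le> j \<Longrightarrow> greedy D j \<subseteq> greedy D i"
  by (rule lift_Suc_antimono_le[of "greedy D"]) auto

lemma infinite_diagonal: "infinite (diagonal D)"
  unfolding infinite_nat_iff_unbounded_le
proof
  fix i
  define n where "n = (LEAST n. i \<le> n \<and> n \<in> greedy D i)"
  have "\<exists>n. i \<le> n \<and> n \<in> greedy D i"
    using infinite_greedy[of D i] unfolding infinite_nat_iff_unbounded_le by blast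
  from LeastI_ex[OF this] have "i \<le> n" "n \<in> greedy D i" by (simp_all add: n_def)
  moreover have "m \<notin> greedy D i" if "i \<le> m" "m < n" for m
    using that not_less_Least unfolding n_def by blast
  ultimately show "\<exists>n\<ge>i. n \<in> diagonal D" unfolding diagonal_def by blast
qed

lemma finite_diagonal_minus_greedy: "finite (diagonal D - greedy D j)"
proof -
  have "diagonal D - greedy D j \<subseteq> (\<lambda>i. LEAST n. i \<le> n \<and> n \<in> greedy D i) ` {..<j}"
  proof
    fix n assume n: "n \<in> diagonal D - greedy D j"
    then obtain i where i: "i \<le> n" "n \<in> greedy D i" "\<And>m. i \<le> m \<Longrightarrow> m < n \<Longrightarrow> m \<notin> greedy D i"
      unfolding diagonal_def by blast
    then have "(LEAST n. i \<le> n \<and> n \<in> greedy D i) = n"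
      by (intro Least_equality) (auto simp: not_less[symmetric])
    moreover have "i < j" using n i(2) greedy_antimono[of j i D] by (force simp: not_less[symmetric])
    ultimately show "n \<in> (\<lambda>i. LEAST n. i \<le> n \<and> n \<in> greedy D i) ` {..<j}" by force
  qed
  then show ?thesis by (rule finite_subset) simp
qed

lemma diagonal_decides: "finite (diagonal D \<inter> D i) \<or> finite (diagonal D - D i)"
proof -
  have "greedy D (Suc i) \<inter> D i = {} \<or> greedy D (Suc i) \<subseteq> D i" by auto
  then show ?thesis
  proof
    assume "greedy D (Suc i) \<inter> D i = {}"
    then have "diagonal D \<inter> D i \<subseteq> diagonal D - greedy D (Suc i)" by blast
    then show ?thesis using finite_diagonal_minus_greedy finite_subset by blast
  next
    assume "greedy D (Suc i) \<subseteq> D i"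
    then have "diagonal D - D i \<subseteq> diagonal D - greedy D (Suc i)" by blast
    then show ?thesis using finite_diagonal_minus_greedy finite_subset by blast
  qed
qed

lemma decided_diagonal:
  assumes "\<And>i n. decided (\<lambda>G. n \<in> D G i)"
  shows "decided (\<lambda>G. n \<in> diagonal (D G))"
proof -
  have greedy: "decided (\<lambda>G. n \<in> greedy (D G) i)" for n i
  proof (induction i arbitrary: n)
    case (Suc i)
    have "decided (\<lambda>G. finite {n. n \<in> greedy (D G) i \<and> n \<in> D G i})"
      by (intro decided_finite) (simp add: decided_conj Suc assms)
    then have "decided (\<lambda>G. n \<in> greedy (D G) i \<and>
      (finite {n. n \<in> greedy (D G) i \<and> n \<in> D G i} \<longrightarrow> n \<notin> D G i) \<and>
      (\<not> finite {n. n \<in> greedy (D G) i \<and> n \<in> D G i} \<longrightarrow> n \<in> D G i))"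
      by (intro decided_intros Suc assms)
    also have "(\<lambda>G. n \<in> greedy (D G) i \<and>
      (finite {n. n \<in> greedy (D G) i \<and> n \<in> D G i} \<longrightarrow> n \<notin> D G i) \<and>
      (\<not> finite {n. n \<in> greedy (D G) i \<and> n \<in> D G i} \<longrightarrow> n \<in> D G i)) =
      (\<lambda>G. n \<in> greedy (D G) (Suc i))" by (intro ext) simp
    finally show ?case .
  qed (simp add: decided_const)
  show ?thesis unfolding diagonal_def mem_Collect_eq by (intro decided_intros greedy)
qed

section \<open>Ground model covers\<close>

text \<open>
  The bound \<open>h\<close> is for \<open>p\<close> itself, not only for an extension of \<open>p\<close>. The countability of
  antichains depends on this.
\<close>

definition bounding_forcing :: "'p::preorder itself \<Rightarrow> bool" where
  "bounding_forcing _ \<longleftrightarrow> (\<forall>(f :: (nat \<times> nat, 'p) name) p.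
     (p \<tturnstile> total_function f) \<longrightarrow> (\<exists>h. p \<tturnstile> f \<^bold>\<le>\<^sup>* check_fun h))"

lemma bound_of_intersections:
  fixes p :: "'p::preorder" and z :: "'p set \<Rightarrow> nat set" and a :: "nat \<Rightarrow> nat set"
  assumes bd: "bounding_forcing TYPE('p)" and dec: "\<And>x. decided (\<lambda>G. x \<in> z G)"
    and fin: "\<forall>\<^sub>F G in generics p. \<forall>i::nat. finite (z G \<inter> a i)"
  shows "\<exists>h. \<forall>\<^sub>F G in generics p. finite {i. \<not> z G \<inter> a i \<subseteq> {..<h i}}"
proof -
  define E where "E G i m \<longleftrightarrow> (\<forall>x. x \<in> z G \<and> x \<in> a i \<longrightarrow> x < m)" for G i and m :: nat
  \<comment> \<open>The function of the extension that sends \<open>i\<close> to the least strict bound of \<open>z \<inter> a i\<close>.\<close>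
  define X where "X G = {(i, m). E G i m \<and> (\<forall>m'. m' < m \<longrightarrow> \<not> E G i m')}" for G
  have "decided (\<lambda>G. E G i m)" for i m
    unfolding E_def by (intro decided_intros dec)
  then have "decided (\<lambda>G. e \<in> X G)" for e
    unfolding X_def by (cases e) (simp, intro decided_intros)
  note val = val_name_of[of X, OF this]
  have unique: "\<exists>!m. (i, m) \<in> X G" if z: "finite (z G \<inter> a i)" for G i
  proof -
    obtain k where "z G \<inter> a i \<subseteq> {..<k}" using finite_nat_bounded[OF z] by blast
    then have "E G i k" by (auto simp: E_def)
    then have "E G i (LEAST m. E G i m)" by (rule LeastI)
    then have "(i, LEAST m. E G i m) \<in> X G" using not_less_Least by (auto simp: X_def)
    moreover have "m = m'" if "(i, m) \<in> X G" "(i, m') \<in> X G" for m m'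
      using that by (auto simp: X_def) (meson linorder_neqE_nat)
    ultimately show ?thesis by blast
  qed
  have "\<forall>\<^sub>F G in generics p. \<forall>i. \<exists>!m. (i, m) \<in> val (name_of X) G"
    using val fin by eventually_elim (simp add: unique)
  from forces_total_function[OF this] bd
  obtain h where "p \<tturnstile> name_of X \<^bold>\<le>\<^sup>* check_fun h" unfolding bounding_forcing_def by blast
  from le_star_check_funD[OF this] val fin
  have "\<forall>\<^sub>F G in generics p. finite {i. \<not> z G \<inter> a i \<subseteq> {..<h i}}"
  proof eventually_elim
    case (elim G)
    have "{i. \<not> z G \<inter> a i \<subseteq> {..<h i}} \<subseteq> {n. \<exists>j. (n, j) \<in> val (name_of X) G \<and> h n < j}"
    proof safe
      fix i x assume x: "x \<in> z G" "x \<in> a i" "\<not> x < h i"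
      obtain m where m: "(i, m) \<in> X G" using unique elim by blast
      with x(1,2) have "x < m" by (auto simp: X_def E_def)
      with m elim x(3) show "\<exists>j. (i, j) \<in> val (name_of X) G \<and> h i < j" by auto
    qed
    then show ?case using elim finite_subset by blast
  qed
  then show ?thesis by blast
qed

text \<open>
  A function \<open>g\<close> that eventually dominates the countably many bounds gives \<open>b = {x. \<forall>i. x \<in> a i
  \<longrightarrow> x < g i}\<close>. For the finitely many \<open>i\<close> at which \<open>g\<close> is too small, \<open>z \<inter> a i\<close> is finite anyway.
\<close>

lemma common_cover:
  fixes Z :: "('p::preorder \<times> ('p set \<Rightarrow> nat set)) set" and a :: "nat \<Rightarrow> nat set"
  assumes bd: "bounding_forcing TYPE('p)" and Z: "countable Z"
    and dec: "\<And>p z x. (p, z) \<in> Z \<Longrightarrow> decided (\<lambda>G. x \<in> z G)"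
    and fin: "\<And>p z i. (p, z) \<in> Z \<Longrightarrow> \<forall>\<^sub>F G in generics p. finite (z G \<inter> a i)"
  shows "\<exists>b. (\<forall>i. finite (b \<inter> a i)) \<and> (\<forall>(p, z)\<in>Z. \<forall>\<^sub>F G in generics p. finite (z G - b))"
proof -
  have "\<forall>pz\<in>Z. \<exists>h. \<forall>\<^sub>F G in generics (fst pz). finite {i. \<not> snd pz G \<inter> a i \<subseteq> {..<h i}}"
    using dec fin by (intro ballI bound_of_intersections[OF bd] eventually_generics_all_type) auto
  from bchoice[OF this] obtain h where
    h: "\<And>p z. (p, z) \<in> Z \<Longrightarrow> \<forall>\<^sub>F G in generics p. finite {i. \<not> z G \<inter> a i \<subseteq> {..<h (p, z) i}}"
    by fastforce
  \<comment> \<open>The diagonal sum dominates the \<open>j\<close>-th bound from \<open>i = j\<close> on.\<close>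
  define g where "g i = (\<Sum>j\<le>i. h (from_nat_into Z j) i)" for i
  define b where "b = {x. \<forall>i. x \<in> a i \<longrightarrow> x < g i}"
  have "finite (b \<inter> a i)" for i
  proof (rule finite_subset)
    show "b \<inter> a i \<subseteq> {..<g i}" by (auto simp: b_def)
  qed simp
  moreover have "\<forall>\<^sub>F G in generics p. finite (z G - b)" if pz: "(p, z) \<in> Z" for p z
  proof -
    obtain j where j: "from_nat_into Z j = (p, z)" using Z pz by (metis from_nat_into_surj)
    have le: "h (p, z) i \<le> g i" if "j \<le> i" for i
      unfolding g_def j[symmetric] using that
      by (intro member_le_sum[of j "{..i}" "\<lambda>j. h (from_nat_into Z j) i"]) auto
    have "\<forall>\<^sub>F G in generics p. \<forall>i. finite (z G \<inter> a i)"
      by (intro eventually_generics_all_type fin pz)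
    with h[OF pz] show ?thesis
    proof eventually_elim
      case (elim G)
      let ?N = "{i. \<not> z G \<inter> a i \<subseteq> {..<h (p, z) i}} \<union> {..<j}"
      have "z G - b \<subseteq> (\<Union>i\<in>?N. z G \<inter> a i)"
      proof
        fix x assume x: "x \<in> z G - b"
        then obtain i where i: "x \<in> a i" "g i \<le> x" unfolding b_def by (auto simp: not_less)
        have "i \<in> ?N"
        proof (cases "j \<le> i")
          case True
          from le[OF this] i(2) have "\<not> x < h (p, z) i" by simp
          with x i(1) show ?thesis by auto
        qed simp
        with x i(1) show "x \<in> (\<Union>i\<in>?N. z G \<inter> a i)" by blast
      qed
      moreover have "finite (\<Union>i\<in>?N. z G \<inter> a i)" using elim by (intro finite_UN_I) auto
      ultimately show ?case by (rule finite_subset)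
    qed
  qed
  ultimately show ?thesis by blast
qed

lemma countable_not_MAD:
  fixes a :: "nat \<Rightarrow> nat set"
  assumes "almost_disjoint (range a)" "inj a"
  obtains d where "infinite d" "\<And>i. finite (d \<inter> a i)"
proof -
  have "\<exists>x. x \<in> a k \<and> k \<le> x \<and> (\<forall>j<k. x \<notin> a j)" for k
  proof -
    have "finite (a k \<inter> a j)" if "j < k" for j
      using that assms(2) by (intro almost_disjointD[OF assms(1)]) (auto dest: injD)
    then have "finite ((\<Union>j<k. a k \<inter> a j) \<union> {..<k})" by (intro finite_UnI finite_UN_I) auto
    moreover have "infinite (a k)" using assms(1) by (simp add: almost_disjoint_def)
    ultimately have "infinite (a k - ((\<Union>j<k. a k \<inter> a j) \<union> {..<k}))"
      by (rule Diff_infinite_finite)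
    then have "a k - ((\<Union>j<k. a k \<inter> a j) \<union> {..<k}) \<noteq> {}" by (rule infinite_imp_nonempty)
    then show ?thesis by (auto simp: not_less)
  qed
  then obtain x where x: "\<And>k. x k \<in> a k" "\<And>k. k \<le> x k" "\<And>k j. j < k \<Longrightarrow> x k \<notin> a j" by metis
  show thesis
  proof
    show "infinite (range x)"
      unfolding infinite_nat_iff_unbounded_le using x(2) by blast
    have "k \<le> i" if "x k \<in> a i" for k i using x(3)[of i k] that by (cases "i < k") auto
    then have "range x \<inter> a i \<subseteq> x ` {..i}" for i by blast
    then show "finite (range x \<inter> a i)" for i by (rule finite_subset) simp
  qed
qed

section \<open>Promises\<close>

text \<open>
  The traces are settled for each member of \<open>A\<close> separately, and the alternative of \<open>dead\<close> and
  \<open>alive\<close> refers to a countable subfamily. In this form a promise survives unions of increasing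
  chains of families, also uncountable ones.
\<close>

definition promise ::
  "nat set set \<Rightarrow> 'p::preorder \<Rightarrow> ('p set \<Rightarrow> nat \<Rightarrow> nat set) \<Rightarrow> ('p set \<Rightarrow> nat set) \<Rightarrow> bool" where
  "promise A p C I \<longleftrightarrow>
     (\<forall>\<^sub>F G in generics p. infinite (I G)) \<and>
     (\<forall>a\<in>A. \<forall>\<^sub>F G in generics p. settled a (C G) (I G)) \<and>
     (\<exists>A0\<subseteq>A. countable A0 \<and> (\<forall>\<^sub>F G in generics p. dead A0 (C G) (I G) \<or> alive A0 (C G) (I G)))"

text \<open>
  The answers of the first kind settle the traces. Those of the second kind say which \<open>c n\<close> are
  covered by finitely many \<open>a i\<close>; they ensure that a finite subfamily which does not cover
  almost all \<open>c n\<close> covers only finitely many.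
\<close>

definition questions :: "(nat \<Rightarrow> nat set) \<Rightarrow> (nat \<Rightarrow> nat set) \<Rightarrow> nat \<Rightarrow> nat set" where
  "questions a c k = (case from_nat k of
     Inl i \<Rightarrow> {n. \<exists>y. y \<in> a i \<and> y \<in> c n}
   | Inr xs \<Rightarrow> {n. \<forall>y. y \<in> c n \<longrightarrow> y \<in> (\<Union>i\<in>set xs. a i)})"

definition deciding_set :: "(nat \<Rightarrow> nat set) \<Rightarrow> (nat \<Rightarrow> nat set) \<Rightarrow> nat set" where
  "deciding_set a c = diagonal (questions a c)"

lemma decided_deciding_set:
  assumes "\<And>n k. decided (\<lambda>G. k \<in> C G n)"
  shows "decided (\<lambda>G. n \<in> deciding_set a (C G))"
  unfolding deciding_set_def
proof (rule decided_diagonal)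
  show "decided (\<lambda>G. n \<in> questions a (C G) k)" for k n
  proof (cases "from_nat k :: nat + nat list")
    case (Inl i)
    then show ?thesis
      unfolding questions_def by (simp add: decided_intros assms)
  next
    case (Inr xs)
    have "decided (\<lambda>G. \<forall>y. y \<in> C G n \<longrightarrow> y \<in> (\<Union>i\<in>set xs. a i))" by (intro decided_intros assms)
    then show ?thesis unfolding questions_def Inr by simp
  qed
qed

lemma settled_deciding_set: "settled (a i) c (deciding_set a c)"
proof -
  let ?k = "to_nat (Inl i :: nat + nat list)"
  have "trace (a i) c (deciding_set a c) = diagonal (questions a c) \<inter> questions a c ?k"
    by (auto simp: trace_def deciding_set_def questions_def)
  moreover have "deciding_set a c - trace (a i) c (deciding_set a c) =
      diagonal (questions a c) - questions a c ?k"
    by (auto simp: trace_def deciding_set_def questions_def)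
  ultimately show ?thesis
    unfolding settled_def using diagonal_decides[of "questions a c" ?k] by simp
qed

lemma covered_deciding_set:
  assumes "finite S"
  shows "finite {n \<in> deciding_set a c. c n \<subseteq> \<Union>(a ` S)} \<or>
    finite {n \<in> deciding_set a c. \<not> c n \<subseteq> \<Union>(a ` S)}"
proof -
  obtain xs where xs: "set xs = S" using finite_list[OF assms] by blast
  let ?k = "to_nat (Inr xs :: nat + nat list)"
  have q: "questions a c ?k = {n. c n \<subseteq> \<Union>(a ` S)}" by (auto simp: questions_def xs)
  show ?thesis
    using diagonal_decides[of "questions a c" ?k] unfolding deciding_set_def q
    by (simp add: Int_def set_diff_eq)
qed

text \<open>
  The new member must almost contain the set \<open>escape\<close> of every old promise, and \<open>escape\<close> and
  \<open>residue\<close> of the new one.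
\<close>

lemma extension_step:
  fixes S :: "'s set" and P :: "'s \<Rightarrow> 'p::preorder" and p :: 'p
    and C :: "'s \<Rightarrow> 'p set \<Rightarrow> nat \<Rightarrow> nat set" and I :: "'s \<Rightarrow> 'p set \<Rightarrow> nat set"
  assumes bd: "bounding_forcing TYPE('p)" and AD: "almost_disjoint A" and A: "countable A"
    and S: "countable S"
    and Cdec: "\<And>s n k. s \<in> S \<Longrightarrow> decided (\<lambda>G. k \<in> C s G n)"
    and Idec: "\<And>s n. s \<in> S \<Longrightarrow> decided (\<lambda>G. n \<in> I s G)"
    and Cfin: "\<And>s. s \<in> S \<Longrightarrow> \<forall>\<^sub>F G in generics (P s). fin_sequence (C s G)"
    and prom: "\<And>s. s \<in> S \<Longrightarrow> promise A (P s) (C s) (I s)"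
    and cdec: "\<And>n k. decided (\<lambda>G. k \<in> c G n)"
    and cfin: "\<forall>\<^sub>F G in generics p. fin_sequence (c G)"
  shows "\<exists>b \<Phi>. almost_disjoint (insert b A) \<and> (\<forall>s\<in>S. promise (insert b A) (P s) (C s) (I s)) \<and>
    (\<forall>n. decided (\<lambda>G. n \<in> \<Phi> (c G))) \<and> promise (insert b A) p c (\<lambda>G. \<Phi> (c G))"
proof -
  define a where "a = from_nat_into A"
  have "infinite A" using AD by (simp add: almost_disjoint_def)
  from bij_betw_from_nat_into[OF A this] have inj: "inj a" and ran: "range a = A"
    by (auto simp: a_def bij_betw_def)
  have AD': "almost_disjoint (range a)" using AD ran by simp
  define \<Phi> where "\<Phi> = deciding_set a"
  have \<Phi>dec: "decided (\<lambda>G. n \<in> \<Phi> (c G))" for n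
    unfolding \<Phi>_def by (rule decided_deciding_set[OF cdec])
  have escape_dec: "decided (\<lambda>G. x \<in> escape a (c G) (i G))"
    if "\<And>n k. decided (\<lambda>G. k \<in> c G n)" "\<And>n. decided (\<lambda>G. n \<in> i G)"
    for x and c :: "'p set \<Rightarrow> nat \<Rightarrow> nat set" and i
  proof -
    have "decided (\<lambda>G. finite {n. n \<in> i G \<and> (\<forall>y. y \<in> c G n \<longrightarrow> y \<in> (\<Union>j\<le>k. a j))})" for k
      unfolding mem_Collect_eq by (intro decided_finite) (unfold mem_Collect_eq, intro decided_intros that)
    then show ?thesis unfolding escape_def mem_Collect_eq by (intro decided_intros that)
  qed
  have residue_dec: "decided (\<lambda>G. x \<in> residue a (c G) (\<Phi> (c G)))" for x
  proof -
    have "decided (\<lambda>G. finite {n. n \<in> \<Phi> (c G) \<and> (\<exists>y. y \<in> a i \<and> y \<in> c G n)})" for i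
      by (intro decided_finite) (unfold mem_Collect_eq, intro decided_intros cdec \<Phi>dec)
    then show ?thesis
      unfolding residue_def mem_Collect_eq by (intro decided_intros cdec \<Phi>dec)
  qed
  let ?Z = "(\<lambda>s. (P s, \<lambda>G. escape a (C s G) (I s G))) ` S \<union>
    {(p, \<lambda>G. escape a (c G) (\<Phi> (c G))), (p, \<lambda>G. residue a (c G) (\<Phi> (c G)))}"
  have "\<exists>b. (\<forall>i. finite (b \<inter> a i)) \<and> (\<forall>(p, z)\<in>?Z. \<forall>\<^sub>F G in generics p. finite (z G - b))"
  proof (rule common_cover[OF bd])
    show "countable ?Z" using S by simp
    fix q z assume "(q, z) \<in> ?Z"
    then consider (old) s where "s \<in> S" "q = P s" "z = (\<lambda>G. escape a (C s G) (I s G))"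
      | (esc) "q = p" "z = (\<lambda>G. escape a (c G) (\<Phi> (c G)))"
      | (res) "q = p" "z = (\<lambda>G. residue a (c G) (\<Phi> (c G)))"
      by blast
    note cases = this
    show "decided (\<lambda>G. x \<in> z G)" for x
      using cases by cases (simp_all add: escape_dec residue_dec Cdec Idec cdec \<Phi>dec)
    show "\<forall>\<^sub>F G in generics q. finite (z G \<inter> a i)" for i
      using cases
    proof cases
      case old
      from Cfin[OF old(1)] show ?thesis unfolding old by eventually_elim (rule finite_escape_Int)
    next
      case esc
      from cfin show ?thesis unfolding esc by eventually_elim (rule finite_escape_Int)
    next
      case res
      from cfin show ?thesis unfolding res by eventually_elim (rule finite_residue_Int)
    qed
  qed
  then obtain b0 where b0: "\<And>i. finite (b0 \<inter> a i)"
    and cover: "\<forall>(p, z)\<in>?Z. \<forall>\<^sub>F G in generics p. finite (z G - b0)"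
    by blast
  \<comment> \<open>A member has to be infinite, which the cover need not be.\<close>
  obtain d where d: "infinite d" "\<And>i. finite (d \<inter> a i)" using countable_not_MAD[OF AD' inj] by blast
  define b where "b = b0 \<union> d"
  have b: "finite (b \<inter> a i)" for i using b0 d(2) by (simp add: b_def Int_Un_distrib2)
  have larger: "finite (z - b)" if "finite (z - b0)" for z
    using that by (rule rev_finite_subset) (auto simp: b_def)
  have "infinite b" using d(1) by (simp add: b_def)
  have bA: "finite (b \<inter> x)" if "x \<in> A" for x using b that ran by blast
  then have "finite (x \<inter> b)" if "x \<in> A" for x using that by (subst Int_commute)
  with AD bA \<open>infinite b\<close> have "almost_disjoint (insert b A)"
    by (simp add: almost_disjoint_def)
  moreover have "promise (insert b A) (P s) (C s) (I s)" if s: "s \<in> S" for s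
  proof -
    note prom = prom[OF s, unfolded promise_def]
    obtain A0 where A0: "A0 \<subseteq> A" "countable A0"
      "\<forall>\<^sub>F G in generics (P s). dead A0 (C s G) (I s G) \<or> alive A0 (C s G) (I s G)"
      using prom by blast
    have "\<forall>\<^sub>F G in generics (P s). \<forall>x\<in>A. settled x (C s G) (I s G)"
      using prom by (intro eventually_generics_all A) blast
    moreover have "\<forall>\<^sub>F G in generics (P s). finite (escape a (C s G) (I s G) - b0)"
      using cover s by auto
    ultimately have "\<forall>\<^sub>F G in generics (P s). settled b (C s G) (I s G)"
      using A0(3) Cfin[OF s]
    proof eventually_elim
      case (elim G)
      show ?case
      proof (rule settled_new_set[OF elim(4) AD' _ _ b larger[OF elim(2)]])
        show "settled (a i) (C s G) (I s G)" for i using elim(1) ran by blast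
        show "dead (range a) (C s G) (I s G) \<or> alive (range a) (C s G) (I s G)"
          unfolding ran using elim(3) dead_mono[OF A0(1)] alive_mono[OF A0(1)] by blast
      qed
    qed
    then show ?thesis unfolding promise_def using prom A0 by blast
  qed
  moreover have "promise (insert b A) p c (\<lambda>G. \<Phi> (c G))"
  proof -
    have "\<forall>\<^sub>F G in generics p. finite (escape a (c G) (\<Phi> (c G)) - b0)"
      "\<forall>\<^sub>F G in generics p. finite (residue a (c G) (\<Phi> (c G)) - b0)"
      using cover by auto
    with cfin have *: "\<forall>\<^sub>F G in generics p. settled b (c G) (\<Phi> (c G)) \<and>
        (dead (insert b A) (c G) (\<Phi> (c G)) \<or> alive (insert b A) (c G) (\<Phi> (c G)))"
    proof eventually_elim
      case (elim G)
      show ?case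
        using dead_or_alive_new[OF elim(1) AD' _ _ b larger[OF elim(2)] larger[OF elim(3)]]
        unfolding ran \<Phi>_def by (simp add: settled_deciding_set covered_deciding_set)
    qed
    have "\<forall>\<^sub>F G in generics p. settled x (c G) (\<Phi> (c G))" if x: "x \<in> insert b A" for x
    proof (cases "x = b")
      case True
      from * show ?thesis unfolding True by eventually_elim simp
    next
      case False
      with x ran obtain i where "x = a i" by blast
      then show ?thesis by (simp add: \<Phi>_def settled_deciding_set)
    qed
    moreover from * have "\<forall>\<^sub>F G in generics p.
        dead (insert b A) (c G) (\<Phi> (c G)) \<or> alive (insert b A) (c G) (\<Phi> (c G))"
      by eventually_elim simp
    moreover have "countable (insert b A)" using A by simp
    moreover have "\<forall>\<^sub>F G in generics p. infinite (\<Phi> (c G))"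
      by (simp add: \<Phi>_def deciding_set_def infinite_diagonal)
    ultimately show ?thesis unfolding promise_def by blast
  qed
  ultimately show ?thesis using \<Phi>dec by blast
qed

section \<open>Counting names\<close>

lemma countable_iff_natLeq: "countable W \<longleftrightarrow> |W| \<le>o natLeq"
proof -
  have "countable W \<longleftrightarrow> |W| \<le>o |UNIV :: nat set|"
    unfolding countable_def card_of_ordLeq[symmetric] by simp
  also have "\<dots> \<longleftrightarrow> |W| \<le>o natLeq"
    using card_of_nat ordLeq_ordIso_trans ordIso_symmetric by blast
  finally show ?thesis .
qed

lemma uncountable_onto_reals:
  assumes "CH" "uncountable W"
  obtains s where "s ` W = (UNIV :: nat set set)"
proof -
  have "natLeq <o |W|"
    using assms(2) not_ordLeq_iff_ordLess[OF natLeq_Well_order card_of_Well_order[of W]]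
    by (simp add: countable_iff_natLeq)
  then have "cardSuc natLeq \<le>o |W|"
    using cardSuc_ordLess_ordLeq[OF natLeq_Card_order card_of_Card_order[of W]] by blast
  with assms(1) have "|UNIV :: nat set set| \<le>o |W|"
    unfolding CH_def by (rule ordIso_ordLeq_trans)
  then show ?thesis using that by (auto simp flip: card_of_ordLeq2)
qed

text \<open>
  On an uncountable antichain there is room, by CH, for all functions \<open>F w\<close> of the ground model.
  The name that equals \<open>F w\<close> below each \<open>w\<close> has a bound \<open>h\<close> at \<open>p\<close>, but somewhere below \<open>p\<close> it
  equals \<open>\<lambda>n. Suc (h n)\<close>.
\<close>

lemma countable_antichain:
  fixes p :: "'p::preorder"
  assumes CH: "CH" and bd: "bounding_forcing TYPE('p)"
    and W: "antichain W" and below: "\<And>w. w \<in> W \<Longrightarrow> w \<le> p"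
  shows "countable W"
proof (rule ccontr)
  assume "uncountable W"
  with CH obtain s where s: "s ` W = (UNIV :: nat set set)" by (rule uncountable_onto_reals)
  define F where "F w n = (LEAST m. prod_encode (n, m) \<in> s w)" for w and n :: nat
  have F: "\<exists>w\<in>W. F w = h" for h
  proof -
    have "{prod_encode (n, h n) | n. True} \<in> s ` W" using s by simp
    then obtain w where w: "w \<in> W" "s w = {prod_encode (n, h n) | n. True}" by auto
    have "F w n = h n" for n unfolding F_def w(2) by (rule Least_equality) auto
    with w(1) show ?thesis by blast
  qed
  \<comment> \<open>The value 0 at the conditions incompatible with the whole antichain makes the function total.\<close>
  define f :: "(nat \<times> nat, 'p) name" where
    "f = {((n, m), r). (\<exists>w\<in>W. r \<le> w \<and> m = F w n) \<or> ((\<forall>w\<in>W. \<not> compatible r w) \<and> m = 0)}"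
  have total: "\<forall>\<^sub>F G in generics p. \<forall>n. \<exists>!m. (n, m) \<in> val f G"
  proof -
    have "dense_below p {r. (\<exists>w\<in>W. r \<le> w) \<or> (\<forall>w\<in>W. \<not> compatible r w)}"
      unfolding dense_below_def compatible_def by blast
    from eventually_generics_dense_set[OF this] show ?thesis
    proof eventually_elim
      case (elim G)
      then have G: "condition_filter G" by simp
      from elim obtain r where r: "r \<in> G" "(\<exists>w\<in>W. r \<le> w) \<or> (\<forall>w\<in>W. \<not> compatible r w)" by blast
      have agree: "m = m'" if "(n, m) \<in> val f G" "(n, m') \<in> val f G" for n m m'
      proof -
        from that obtain u u' where u: "u \<in> G" "((n, m), u) \<in> f" "u' \<in> G" "((n, m'), u') \<in> f"
          by (auto simp: val_def)
        obtain t where t: "t \<le> u" "t \<le> u'" using condition_filter_meet[OF G u(1,3)] by auto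
        have comp: "compatible v w" if "t \<le> v" "u \<le> w \<or> u' \<le> w" for v w
          using that t order_trans unfolding compatible_def by metis
        show ?thesis
        proof (cases "\<exists>w\<in>W. u \<le> w \<and> m = F w n")
          case True
          then obtain w where w: "w \<in> W" "u \<le> w" "m = F w n" by blast
          then have "compatible u' w" using comp t by blast
          with w(1) u(4) obtain w' where w': "w' \<in> W" "u' \<le> w'" "m' = F w' n"
            by (auto simp: f_def)
          have "t \<le> w'" using t(2) w'(2) by (rule order_trans)
          from comp[OF this] w(2) have "compatible w' w" by blast
          with W w w' show ?thesis by (auto simp: antichain_def)
        next
          case False
          with u(2) have u0: "m = 0" "\<forall>w\<in>W. \<not> compatible u w" by (auto simp: f_def)
          then have "m' = 0" using u(4) comp[OF t(1)] by (auto simp: f_def)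
          with u0 show ?thesis by simp
        qed
      qed
      moreover have "\<exists>m. (n, m) \<in> val f G" for n
        using r unfolding val_def f_def by blast
      ultimately show ?case by blast
    qed
  qed
  from bd forces_total_function[OF total] obtain h where "p \<tturnstile> f \<^bold>\<le>\<^sup>* check_fun h"
    unfolding bounding_forcing_def by blast
  note dom = le_star_check_funD[OF this]
  \<comment> \<open>The name takes the value of every ground model function somewhere below the condition.\<close>
  obtain w where w: "w \<in> W" "F w = (\<lambda>n. Suc (h n))" using F by blast
  have "\<forall>\<^sub>F G in generics w. {n. \<exists>j. (n, j) \<in> val f G \<and> h n < j} = UNIV"
    using eventually_generics_filter[of w]
  proof eventually_elim
    case (elim G)
    have "((n, Suc (h n)), w) \<in> f" for n using w unfolding f_def by auto
    then have "(n, Suc (h n)) \<in> val f G" for n using elim unfolding val_def by blast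
    then show ?case by blast
  qed
  with generics_mono[OF below[OF w(1)] dom] have "\<forall>\<^sub>F G in generics w. False"
    by eventually_elim simp
  then show False by simp
qed

text \<open>
  For each \<open>a\<close>, a maximal antichain of conditions that force \<open>a\<close> into \<open>x\<close> carries all the
  information.
\<close>

lemma countable_name_below:
  fixes x :: "('a::countable, 'p::preorder) name"
  assumes CH: "CH" and bd: "bounding_forcing TYPE('p)"
  obtains x' where "countable x'" "\<forall>\<^sub>F G in generics p. val x' G = val x G"
proof -
  define R where "R a = {r. r \<le> p \<and> (\<forall>\<^sub>F G in generics r. a \<in> val x G)}" for a
  have "\<exists>W. W \<subseteq> R a \<and> antichain W \<and> (\<forall>r\<in>R a. \<exists>w\<in>W. compatible r w)" for a
    by (rule maximal_antichain[of "R a"]) blast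
  then have "\<forall>a. \<exists>W. W \<subseteq> R a \<and> antichain W \<and> (\<forall>r\<in>R a. \<exists>w\<in>W. compatible r w)" by blast
  from choice[OF this] obtain W where W: "\<And>a. W a \<subseteq> R a" "\<And>a. antichain (W a)"
    and max: "\<And>a r. r \<in> R a \<Longrightarrow> \<exists>w\<in>W a. compatible r w"
    by blast
  have "countable (W a)" for a
    using W(1) by (intro countable_antichain[OF CH bd W(2), of _ p]) (auto simp: R_def)
  define x' where "x' = (SIGMA a:UNIV. W a)"
  have "countable x'" unfolding x'_def by (intro countable_SIGMA) (simp_all add: \<open>\<And>a. countable (W a)\<close>)
  have "\<forall>\<^sub>F G in generics p. a \<in> val x' G \<longleftrightarrow> a \<in> val x G" for a
  proof (rule eventually_generics_local)
    fix q assume "q \<le> p"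
    obtain r where r: "r \<le> q"
      "(\<forall>\<^sub>F G in generics r. a \<in> val x G) \<or> (\<forall>\<^sub>F G in generics r. a \<notin> val x G)"
      using decided_val[of a x] unfolding decided_def by blast
    have "r \<le> p" using r(1) \<open>q \<le> p\<close> by (rule order_trans)
    show "\<exists>r\<le>q. \<forall>\<^sub>F G in generics r. a \<in> val x' G \<longleftrightarrow> a \<in> val x G"
    proof (cases "\<forall>\<^sub>F G in generics r. a \<in> val x G")
      case True
      with \<open>r \<le> p\<close> obtain w where "w \<in> W a" "compatible r w"
        using max[of r a] by (auto simp: R_def)
      then obtain t where t: "w \<in> W a" "t \<le> r" "t \<le> w" by (auto simp: compatible_def)
      from generics_mono[OF t(2) True] eventually_generics_filter[of t]
      have "\<forall>\<^sub>F G in generics t. a \<in> val x' G \<longleftrightarrow> a \<in> val x G"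
      proof eventually_elim
        case (elim G)
        then have "w \<in> G" using t(3) by (auto intro: condition_filter_up)
        then have "a \<in> val x' G" using t(1) unfolding val_def x'_def by blast
        with elim show ?case by simp
      qed
      moreover have "t \<le> q" using t(2) r(1) by (rule order_trans)
      ultimately show ?thesis by blast
    next
      case False
      with r have neg: "\<forall>\<^sub>F G in generics r. a \<notin> val x G" by blast
      then have "\<forall>\<^sub>F G in generics r. a \<in> val x' G \<longleftrightarrow> a \<in> val x G"
        using eventually_generics_filter[of r]
      proof eventually_elim
        case (elim G)
        have False if "w \<in> G" "w \<in> W a" for w
        proof -
          from elim have "condition_filter G" "r \<in> G" by simp_all
          from condition_filter_meet[OF this that(1)] obtain t where t: "t \<le> r" "t \<le> w" by auto
          have "\<forall>\<^sub>F G in generics w. a \<in> val x G" using W(1) that(2) by (auto simp: R_def)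
          from generics_contradiction[OF generics_mono[OF t(2) this] generics_mono[OF t(1) neg]]
          show False .
        qed
        then have "a \<notin> val x' G" unfolding val_def x'_def by blast
        with elim show ?case by simp
      qed
      with r(1) show ?thesis by blast
    qed
  qed
  then have "\<forall>\<^sub>F G in generics p. \<forall>a. a \<in> val x' G \<longleftrightarrow> a \<in> val x G"
    by (rule eventually_generics_all_type)
  then have "\<forall>\<^sub>F G in generics p. val x' G = val x G" by eventually_elim blast
  with \<open>countable x'\<close> show ?thesis by (rule that)
qed

text \<open>
  The countable names are given by their enumerations. By CH a condition can be coded by a set
  of natural numbers, hence also a sequence of conditions.
\<close>

lemma card_countable_names:
  assumes CH: "CH" and card: "|UNIV :: 'p set| \<le>o cardSuc natLeq"
  shows "|T :: ('p \<times> (nat \<Rightarrow> (nat \<times> nat) \<times> 'p)) set| \<le>o cardSuc natLeq"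
proof -
  have CH': "cardSuc natLeq =o |UNIV :: nat set set|"
    using CH unfolding CH_def by (rule ordIso_symmetric)
  have "|UNIV :: 'p set| \<le>o |UNIV :: nat set set|" by (rule ordLeq_ordIso_trans[OF card CH'])
  then obtain i :: "'p \<Rightarrow> nat set" where i: "inj i" by (auto simp flip: card_of_ordLeq)
  \<comment> \<open>The three kinds of elements code the condition, the numbers and the conditions of the sequence.\<close>
  define code :: "'p \<times> (nat \<Rightarrow> (nat \<times> nat) \<times> 'p) \<Rightarrow> (nat + nat \<times> (nat \<times> nat) + nat \<times> nat) set"
    where "code t = Inl ` i (fst t) \<union> range (\<lambda>n. Inr (Inl (n, fst (snd t n)))) \<union>
      (\<Union>n. (\<lambda>m. Inr (Inr (n, m))) ` i (snd (snd t n)))" for t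
  have "inj code"
  proof (rule injI)
    fix t u assume eq: "code t = code u"
    have 1: "i (fst t) = {m. Inl m \<in> code t}" for t by (auto simp: code_def)
    have 2: "k = fst (snd t n) \<longleftrightarrow> Inr (Inl (n, k)) \<in> code t" for t n k by (auto simp: code_def)
    have 3: "i (snd (snd t n)) = {m. Inr (Inr (n, m)) \<in> code t}" for t n by (auto simp: code_def)
    have "fst t = fst u" by (intro injD[OF i]) (simp only: 1 eq)
    moreover have "snd t n = snd u n" for n
    proof (rule prod_eqI)
      show "fst (snd t n) = fst (snd u n)" by (simp only: 2 eq[symmetric]) (simp only: 2[symmetric])
      show "snd (snd t n) = snd (snd u n)" by (intro injD[OF i]) (simp only: 3 eq)
    qed
    ultimately show "t = u" by (simp add: prod_eq_iff fun_eq_iff)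
  qed
  then have "inj ((`) to_nat \<circ> code)"
    by (intro inj_compose) (simp_all add: inj_image_eq_iff inj_on_def)
  then have "inj_on ((`) to_nat \<circ> code) T" by (rule inj_on_subset) simp
  then have "|T| \<le>o |UNIV :: nat set set|" using card_of_ordLeq by blast
  then show ?thesis using CH unfolding CH_def by (rule ordLeq_ordIso_trans)
qed

section \<open>The recursion\<close>

lemma promise_cong:
  assumes "\<forall>\<^sub>F G in generics p. C G = C' G \<and> I G = I' G" "promise A p C I"
  shows "promise A p C' I'"
proof -
  have tr: "\<forall>\<^sub>F G in generics p. E (C' G) (I' G)" if "\<forall>\<^sub>F G in generics p. E (C G) (I G)" for E
    using that assms(1) by eventually_elim simp
  show ?thesis
    using assms(2) tr[of "\<lambda>c i. infinite i"] tr[of "settled _"] tr[of "\<lambda>c i. dead _ c i \<or> alive _ c i"]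
    unfolding promise_def by meson
qed

definition term_of :: "(nat \<times> nat, 'p::preorder) name \<Rightarrow> 'p set \<Rightarrow> nat \<Rightarrow> nat set" where
  "term_of x G n = val x G `` {n}"

lemma decided_term_of: "decided (\<lambda>G. k \<in> term_of x G n)"
  unfolding term_of_def Image_singleton_iff by (rule decided_val)

text \<open>
  The index set is a function \<open>\<Phi>\<close> of the fin sequence, and \<open>y\<close> is a name for its value. The
  function serves the ground model, the name serves the extension.
\<close>

definition keeps_promises :: "'p::preorder itself \<Rightarrow> nat set set \<Rightarrow> bool" where
  "keeps_promises _ A \<longleftrightarrow> (\<forall>(p::'p) x. (\<forall>\<^sub>F G in generics p. fin_sequence (term_of x G)) \<longrightarrow>
     (\<exists>\<Phi> y. (\<forall>\<^sub>F G in generics p. val y G = \<Phi> (term_of x G)) \<and>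
       promise A p (term_of x) (\<lambda>G. \<Phi> (term_of x G))))"

text \<open>
  Recursion along a well-order, with countable proper initial segments, of the pairs of a
  condition and an enumerated countable name that is forced by it to be a fin sequence. The
  value at \<open>t\<close> consists of the new member and the function \<open>\<Phi>\<close> chosen for \<open>t\<close>.
\<close>

lemma exists_family_keeping_promises:
  assumes CH: "CH" and card: "|UNIV :: 'p::preorder set| \<le>o cardSuc natLeq"
    and bd: "bounding_forcing TYPE('p)" and B: "countable B" "almost_disjoint B"
  obtains A where "B \<subseteq> A" "almost_disjoint A" "keeps_promises TYPE('p) A"
proof -
  define C where "C t = term_of (range (snd t))" for t :: "'p \<times> (nat \<Rightarrow> (nat \<times> nat) \<times> 'p)"
  define T where "T = {t. \<forall>\<^sub>F G in generics (fst t). fin_sequence (C t G)}"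
  define R where "R = ( |T| ) - Id"
  have wo: "well_order_on T ( |T| )" by (rule card_of_well_order_on)
  then have wf: "wf R" unfolding R_def by (simp add: well_order_on_def)
  have R_T: "s \<in> T \<and> t \<in> T" if "(s, t) \<in> R" for s t
    using that wo unfolding R_def by (auto simp: well_order_on_def linear_order_on_def
        partial_order_on_def preorder_on_def refl_on_def)
  have R_total: "(s, t) \<in> R \<or> (t, s) \<in> R" if "s \<in> T" "t \<in> T" "s \<noteq> t" for s t
    using that wo unfolding R_def by (auto simp: well_order_on_def linear_order_on_def total_on_def)
  have R_trans: "(s, u) \<in> R" if "(s, t) \<in> R" "(t, u) \<in> R" for s t u
    using that wo unfolding R_def well_order_on_def linear_order_on_def partial_order_on_def
      preorder_on_def trans_def antisym_def by (auto, meson+)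
  define below where "below t = {s. (s, t) \<in> R}" for t
  have countable_below: "countable (below t)" if "t \<in> T" for t
  proof -
    have "|underS ( |T| ) t| <o |T|" 
      by (rule card_of_underS[OF card_of_Card_order]) (simp add: Field_card_of that)
    also have "|T| \<le>o cardSuc natLeq" by (rule card_countable_names[OF CH card])
    finally have "|underS ( |T| ) t| \<le>o natLeq"
      using cardSuc_ordLeq_ordLess[OF natLeq_Card_order card_of_Card_order[of "underS ( |T| ) t"]] by blast
    moreover have "below t = underS ( |T| ) t" by (auto simp: below_def R_def underS_def)
    ultimately show ?thesis by (simp add: countable_iff_natLeq)
  qed
  define stage :: "_ \<Rightarrow> _ \<Rightarrow> nat set set" where "stage f U = B \<union> (\<lambda>s. fst (f s)) ` U"
    for f :: "'p \<times> (nat \<Rightarrow> (nat \<times> nat) \<times> 'p) \<Rightarrow> nat set \<times> ((nat \<Rightarrow> nat set) \<Rightarrow> nat set)" and U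
  define kept where "kept A s \<Phi> \<longleftrightarrow> promise A (fst s) (C s) (\<lambda>G. \<Phi> (C s G))"
    for A s and \<Phi> :: "(nat \<Rightarrow> nat set) \<Rightarrow> nat set"
  define P where "P f t v \<longleftrightarrow> (t \<in> T \<longrightarrow> (let A = insert (fst v) (stage f (below t)) in
      almost_disjoint A \<and> (\<forall>s\<in>below t. kept A s (snd (f s))) \<and> kept A t (snd v) \<and>
      (\<forall>n. decided (\<lambda>G. n \<in> snd v (C t G)))))" for f t v
  \<comment> \<open>Any two members, and any member and promise, already occur together at some earlier step.\<close>
  have limit: "almost_disjoint (stage f U) \<and> (\<forall>s\<in>U. kept (stage f U) s (snd (f s)))"
    if U: "U \<subseteq> T" "\<And>s t. t \<in> U \<Longrightarrow> (s, t) \<in> R \<Longrightarrow> s \<in> U" and P: "\<And>s. s \<in> U \<Longrightarrow> P f s (f s)" for f U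
  proof
    let ?b = "\<lambda>s. fst (f s)"
    let ?A = "\<lambda>s. insert (?b s) (stage f (below s))"
    have A: "almost_disjoint (?A s)" "\<And>u. u \<in> below s \<Longrightarrow> kept (?A s) u (snd (f u))"
      "kept (?A s) s (snd (f s))" if "s \<in> U" for s
      using P[OF that] U(1) that unfolding P_def Let_def by auto
    have sub: "?A s \<subseteq> stage f U" if "s \<in> U" for s
      using U(2)[OF that] that unfolding stage_def below_def by blast
    have common: "(\<exists>s\<in>U. x \<in> ?A s \<and> y \<in> ?A s) \<or> (x \<in> B \<and> y \<in> B)"
      if "x \<in> stage f U" "y \<in> stage f U" for x y
    proof -
      have one: "\<exists>s\<in>U. x \<in> ?A s \<and> y \<in> ?A s"
        if x: "x = ?b s" and s: "s \<in> U" and y: "y \<in> stage f U" for x y s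
      proof -
        from y consider "y \<in> B" | u where "u \<in> U" "y = ?b u" unfolding stage_def by blast
        then show ?thesis
        proof cases
          case 1
          with x s show ?thesis by (intro bexI[of _ s]) (auto simp: stage_def)
        next
          case u: 2
          have "s = u \<or> (s, u) \<in> R \<or> (u, s) \<in> R" using R_total[of s u] U(1) s u(1) by blast
          then consider "s = u" | "?b s \<in> ?A u" | "?b u \<in> ?A s"
            unfolding stage_def below_def by blast
          then show ?thesis
          proof cases
            case 1
            with x s u show ?thesis by blast
          next
            case 2
            with x u show ?thesis by (intro bexI[of _ u]) simp_all
          next
            case 3
            with x s u show ?thesis by (intro bexI[of _ s]) simp_all
          qed
        qed
      qed
      show ?thesis
      proof (cases "x \<in> B \<and> y \<in> B")
        case False
        with that consider s where "s \<in> U" "x = ?b s" | s where "s \<in> U" "y = ?b s"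
          unfolding stage_def by blast
        then show ?thesis
        proof cases
          case 1
          from one[OF 1(2,1) \<open>y \<in> stage f U\<close>] show ?thesis ..
        next
          case 2
          from one[OF 2(2,1) \<open>x \<in> stage f U\<close>] show ?thesis by blast
        qed
      qed simp
    qed
    show "almost_disjoint (stage f U)"
      unfolding almost_disjoint_def
    proof (intro conjI ballI impI)
      show "infinite (stage f U)"
        using B(2) by (simp add: stage_def almost_disjoint_def)
      show "infinite x" if "x \<in> stage f U" for x
        
      proof -
        from common[OF that that] obtain F where "almost_disjoint F" "x \<in> F" using A(1) B(2) by blast
        then show ?thesis by (simp add: almost_disjoint_def)
      qed
      show "finite (x \<inter> y)" if "x \<in> stage f U" "y \<in> stage f U" "x \<noteq> y" for x y
      proof -
        from common[OF that(1,2)] obtain F where "almost_disjoint F" "x \<in> F" "y \<in> F"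
          using A(1) B(2) by blast
        then show ?thesis using that(3) by (rule almost_disjointD)
      qed
    qed
    show "\<forall>s\<in>U. kept (stage f U) s (snd (f s))"
    proof
      fix s assume s: "s \<in> U"
      note own = A(3)[OF s, unfolded kept_def promise_def]
      have "\<forall>\<^sub>F G in generics (fst s). settled x (C s G) (snd (f s) (C s G))" if x: "x \<in> stage f U" for x
      proof -
        have "?b s \<in> stage f U" using s unfolding stage_def by blast
        have "x \<in> ?A s \<or> (\<exists>u\<in>U. (s, u) \<in> R \<and> x \<in> ?A u)"
        proof -
          from x consider "x \<in> B" | u where "u \<in> U" "x = ?b u" unfolding stage_def by blast
          then show ?thesis
          proof cases
            case 1
            then show ?thesis by (simp add: stage_def)
          next
            case 2
            have "s = u \<or> (s, u) \<in> R \<or> (u, s) \<in> R" using R_total[of s u] U(1) s 2(1) by blast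
            then consider "s = u" | "(s, u) \<in> R" | "(u, s) \<in> R" by blast
            then show ?thesis
            proof cases
              case b: 2
              with 2 show ?thesis by blast
            next
              case 3
              with 2 show ?thesis unfolding stage_def below_def by blast
            qed (use 2 in blast)
          qed
        qed
        then show ?thesis
        proof
          assume "x \<in> ?A s"
          with own show ?thesis by blast
        next
          assume "\<exists>u\<in>U. (s, u) \<in> R \<and> x \<in> ?A u"
          then obtain u where u: "u \<in> U" "(s, u) \<in> R" "x \<in> ?A u" by blast
          then have "kept (?A u) s (snd (f s))" by (intro A(2)) (simp_all add: below_def)
          with u(3) show ?thesis unfolding kept_def promise_def by blast
        qed
      qed
      moreover obtain A0 where "A0 \<subseteq> ?A s" "countable A0" "\<forall>\<^sub>F G in generics (fst s).
          dead A0 (C s G) (snd (f s) (C s G)) \<or> alive A0 (C s G) (snd (f s) (C s G))"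
        using own by blast
      moreover from this(1) sub[OF s] have "A0 \<subseteq> stage f U" by (rule subset_trans)
      ultimately show "kept (stage f U) s (snd (f s))"
        unfolding kept_def promise_def using own by blast
    qed
  qed
  have Cdec: "decided (\<lambda>G. k \<in> C s G n)" for s n k unfolding C_def by (rule decided_term_of)
  have "\<exists>f. \<forall>t. P f t (f t)"
  proof (rule dependent_wf_choice[OF wf])
    fix f g :: "'p \<times> (nat \<Rightarrow> (nat \<times> nat) \<times> 'p) \<Rightarrow> nat set \<times> ((nat \<Rightarrow> nat set) \<Rightarrow> nat set)" and t v
    assume eq: "\<And>s. (s, t) \<in> R \<Longrightarrow> f s = g s"
    then have "stage f (below t) = stage g (below t)" unfolding stage_def below_def by auto
    then show "P f t v = P g t v" using eq unfolding P_def by (simp add: below_def)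
  next
    fix t and f :: "'p \<times> (nat \<Rightarrow> (nat \<times> nat) \<times> 'p) \<Rightarrow> nat set \<times> ((nat \<Rightarrow> nat set) \<Rightarrow> nat set)"
    assume IH: "\<And>s. (s, t) \<in> R \<Longrightarrow> P f s (f s)"
    show "\<exists>v. P f t v"
    proof (cases "t \<in> T")
      case True
      let ?A = "stage f (below t)"
      have sub: "below t \<subseteq> T" unfolding below_def using R_T by blast
      have lim: "almost_disjoint ?A \<and> (\<forall>s\<in>below t. kept ?A s (snd (f s)))"
      proof (rule limit[OF sub])
        show "s \<in> below t" if "u \<in> below t" "(s, u) \<in> R" for s u
          using that R_trans unfolding below_def by blast
      qed (use IH in \<open>simp add: below_def\<close>)
      have "\<exists>b \<Phi>. almost_disjoint (insert b ?A) \<and>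
        (\<forall>s\<in>below t. promise (insert b ?A) (fst s) (C s) (\<lambda>G. snd (f s) (C s G))) \<and>
        (\<forall>n. decided (\<lambda>G. n \<in> \<Phi> (C t G))) \<and>
        promise (insert b ?A) (fst t) (C t) (\<lambda>G. \<Phi> (C t G))"
      proof (rule extension_step[OF bd])
        show "almost_disjoint ?A" using lim by blast
        show "countable ?A" using B(1) countable_below[OF True] by (simp add: stage_def)
        show "countable (below t)" by (rule countable_below[OF True])
        show "\<forall>\<^sub>F G in generics (fst t). fin_sequence (C t G)" using True by (simp add: T_def)
        fix s assume s: "s \<in> below t"
        then have "s \<in> T" using sub by blast
        then show "\<forall>\<^sub>F G in generics (fst s). fin_sequence (C s G)" by (simp add: T_def)
        show "promise ?A (fst s) (C s) (\<lambda>G. snd (f s) (C s G))" using lim s by (simp add: kept_def)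
        show "decided (\<lambda>G. n \<in> snd (f s) (C s G))" for n
          using IH[of s] s \<open>s \<in> T\<close> by (simp add: below_def P_def Let_def)
      qed (rule Cdec)+
      then obtain b \<Phi> where "almost_disjoint (insert b ?A)"
        "\<forall>s\<in>below t. promise (insert b ?A) (fst s) (C s) (\<lambda>G. snd (f s) (C s G))"
        "\<forall>n. decided (\<lambda>G. n \<in> \<Phi> (C t G))"
        "promise (insert b ?A) (fst t) (C t) (\<lambda>G. \<Phi> (C t G))"
        by blast
      then have "P f t (b, \<Phi>)" by (simp add: P_def Let_def kept_def)
      then show ?thesis by blast
    qed (simp add: P_def)
  qed
  then obtain f where f: "\<And>t. P f t (f t)" by blast
  define A where "A = stage f T"
  have AD: "almost_disjoint A" and kept: "\<And>t. t \<in> T \<Longrightarrow> kept A t (snd (f t))"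
    using limit[of T f] R_T f unfolding A_def by auto
  show thesis
  proof (rule that)
    show "B \<subseteq> A" by (simp add: A_def stage_def)
    show "almost_disjoint A" by (rule AD)
    show "keeps_promises TYPE('p) A"
      unfolding keeps_promises_def
    proof (intro allI impI)
      fix p :: 'p and x
      assume fin: "\<forall>\<^sub>F G in generics p. fin_sequence (term_of x G)"
      obtain x' where x': "countable x'" and val: "\<forall>\<^sub>F G in generics p. val x' G = val x G"
        using countable_name_below[OF CH bd] by blast
      have eq: "\<forall>\<^sub>F G in generics p. term_of x' G = term_of x G"
        using val by eventually_elim (simp add: term_of_def fun_eq_iff)
      with fin have fin': "\<forall>\<^sub>F G in generics p. fin_sequence (term_of x' G)" by eventually_elim simp
      have "x' \<noteq> {}"
      proof
        assume "x' = {}"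
        with fin' show False by (simp add: term_of_def val_def fin_sequence_def)
      qed
      then have ran: "range (from_nat_into x') = x'" using x' by (simp add: range_from_nat_into)
      define t where "t = (p, from_nat_into x')"
      have C: "C t = term_of x'" by (simp add: C_def t_def ran)
      have "fst t = p" by (simp add: t_def)
      have "t \<in> T" using fin' unfolding T_def by (simp add: C \<open>fst t = p\<close>)
      define \<Phi> where "\<Phi> = snd (f t)"
      have "decided (\<lambda>G. n \<in> \<Phi> (term_of x' G))" for n
        using f[of t] \<open>t \<in> T\<close> by (simp add: P_def Let_def C \<Phi>_def)
      from val_name_of[OF this, of p] eq
      have "\<forall>\<^sub>F G in generics p. val (name_of (\<lambda>G. \<Phi> (term_of x' G))) G = \<Phi> (term_of x G)"
        by eventually_elim simp
      moreover have "promise A p (term_of x) (\<lambda>G. \<Phi> (term_of x G))"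
      proof (rule promise_cong)
        show "promise A p (term_of x') (\<lambda>G. \<Phi> (term_of x' G))"
          using kept[OF \<open>t \<in> T\<close>] by (simp add: kept_def C \<Phi>_def \<open>fst t = p\<close>)
        show "\<forall>\<^sub>F G in generics p. term_of x' G = term_of x G \<and> \<Phi> (term_of x' G) = \<Phi> (term_of x G)"
          using eq by eventually_elim simp
      qed
      ultimately show "\<exists>\<Phi> y. (\<forall>\<^sub>F G in generics p. val y G = \<Phi> (term_of x G)) \<and>
          promise A p (term_of x) (\<lambda>G. \<Phi> (term_of x G))"
        by blast
    qed
  qed
qed

section \<open>Consequences of kept promises\<close>

lemma infinite_trace_exists:
  assumes c: "fin_sequence c" and I: "infinite I" and da: "dead A c I \<or> alive A c I"
  shows "\<exists>a\<in>A. infinite (trace a c I)"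
  using da
proof
  assume "dead A c I"
  then obtain H where H: "H \<subseteq> A" "finite H" "finite {n \<in> I. \<not> c n \<subseteq> \<Union>H}"
    unfolding dead_def by blast
  have sub: "I - {n \<in> I. \<not> c n \<subseteq> \<Union>H} \<subseteq> (\<Union>a\<in>H. trace a c I)"
  proof
    fix n assume n: "n \<in> I - {n \<in> I. \<not> c n \<subseteq> \<Union>H}"
    obtain x where "x \<in> c n" using c unfolding fin_sequence_def by blast
    moreover from this n obtain a where "a \<in> H" "x \<in> a" by blast
    ultimately show "n \<in> (\<Union>a\<in>H. trace a c I)" using n by (auto simp: trace_def)
  qed
  have "infinite (I - {n \<in> I. \<not> c n \<subseteq> \<Union>H})" by (rule Diff_infinite_finite[OF H(3) I])
  with sub have "infinite (\<Union>a\<in>H. trace a c I)" using finite_subset by blast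
  with H(2) have "\<exists>a\<in>H. infinite (trace a c I)" by blast
  with H(1) show ?thesis by blast
next
  assume "alive A c I"
  then have "{a \<in> A. infinite (trace a c I)} \<noteq> {}" unfolding alive_def by (rule infinite_imp_nonempty)
  then show ?thesis by blast
qed

text \<open>
  The increasing enumeration of \<open>X\<close>, by singletons. The definition by cardinality makes
  membership a decided event if membership in \<open>X\<close> is.
\<close>

definition singletons :: "nat set \<Rightarrow> nat \<Rightarrow> nat set" where
  "singletons X n = {k \<in> X. card {j \<in> X. j < k} = n}"

lemma fin_sequence_singletons:
  assumes "infinite X"
  shows "fin_sequence (singletons X)"
proof -
  let ?e = "enumerate X"
  have mono: "strict_mono ?e" by (rule strict_mono_enumerate[OF assms])
  have "singletons X n = {?e n}" for n
  proof -
    have "card {j \<in> X. j < ?e m} = m" for m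
    proof -
      have "{j \<in> X. j < ?e m} = ?e ` {..<m}"
      proof (intro equalityI subsetI)
        fix j assume j: "j \<in> {j \<in> X. j < ?e m}"
        then obtain i where "?e i = j" using enumerate_Ex[OF assms] by blast
        with j mono show "j \<in> ?e ` {..<m}" by (auto simp: strict_mono_less)
      qed (use mono enumerate_in_set[OF assms] in \<open>auto simp: strict_mono_less\<close>)
      then show ?thesis using mono by (simp add: card_image strict_mono_imp_inj_on)
    qed
    note card = this
    show ?thesis
    proof (intro equalityI subsetI)
      fix k assume k: "k \<in> singletons X n"
      then obtain i where "?e i = k" using enumerate_Ex[OF assms] by (auto simp: singletons_def)
      with k card[of i] show "k \<in> {?e n}" by (auto simp: singletons_def)
    qed (use card[of n] enumerate_in_set[OF assms] in \<open>simp add: singletons_def\<close>)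
  qed
  with mono show ?thesis by (simp add: fin_sequence_def strict_mono_eq)
qed

lemma decided_singletons:
  assumes "\<And>k. decided (\<lambda>G. k \<in> X G)"
  shows "decided (\<lambda>G. k \<in> singletons (X G) n)"
proof -
  have "card S = n \<longleftrightarrow> (\<exists>xs. distinct xs \<and> length xs = n \<and> (\<forall>j. j \<in> set xs \<longleftrightarrow> j \<in> S))"
    if "finite S" for S :: "nat set"
    using finite_distinct_list[OF that] distinct_card by (metis set_eqI)
  then have "(\<lambda>G. k \<in> singletons (X G) n) = (\<lambda>G. k \<in> X G \<and>
    (\<exists>xs. distinct xs \<and> length xs = n \<and> (\<forall>j. j \<in> set xs \<longleftrightarrow> j \<in> X G \<and> j < k)))"
    by (simp add: singletons_def)
  moreover have "decided \<dots>" by (intro decided_intros assms)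
  ultimately show ?thesis by simp
qed

text \<open>
  Only those members of \<open>A\<close> that meet \<open>X\<close> in an infinite set can have an infinite trace on the
  singletons listing \<open>X\<close>.
\<close>

lemma infinite_Int_exists:
  assumes X: "infinite X" and I: "infinite I"
    and da: "dead A (singletons X) I \<or> alive A (singletons X) I"
  shows "\<exists>a\<in>A. infinite (a \<inter> X)"
proof -
  note c = fin_sequence_singletons[OF X]
  obtain a where a: "a \<in> A" "infinite (trace a (singletons X) I)"
    using infinite_trace_exists[OF c I da] by blast
  have "trace a (singletons X) I \<subseteq> {n. (a \<inter> X) \<inter> singletons X n \<noteq> {}}"
    by (auto simp: trace_def singletons_def)
  with a(2) finite_indices_meeting[OF c, of "a \<inter> X"] have "infinite (a \<inter> X)"
    using finite_subset by blast
  with a(1) show ?thesis by blast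
qed

subsection \<open>In the ground model\<close>

text \<open>
  At a check name the sampled sequence is constant, so \<open>\<Phi>\<close> yields one set for all sampled
  filters, and events that do not depend on the filter hold eventually only if they hold.
\<close>

lemma keeps_promises_ground:
  assumes keeps: "keeps_promises TYPE('p::preorder) A" and c: "fin_sequence c"
  shows "\<exists>I. infinite I \<and> (\<forall>a\<in>A. settled a c I) \<and> (dead A c I \<or> alive A c I)"
proof -
  obtain p :: 'p where True by blast
  let ?x = "check {(n, k). k \<in> c n}"
  have x: "\<forall>\<^sub>F G in generics p. term_of ?x G = c"
    using eventually_val_check[of "{(n, k). k \<in> c n}" p]
    by eventually_elim (simp add: term_of_def fun_eq_iff)
  then have "\<forall>\<^sub>F G in generics p. fin_sequence (term_of ?x G)"
    using c by (auto elim: eventually_mono)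
  with keeps obtain \<Phi> where "promise A p (term_of ?x) (\<lambda>G. \<Phi> (term_of ?x G))"
    unfolding keeps_promises_def by blast
  then have "promise A p (\<lambda>G. c) (\<lambda>G. \<Phi> c)"
    by (rule promise_cong[rotated]) (use x in eventually_elim, simp)
  then show ?thesis
    unfolding promise_def eventually_generics_ground using dead_mono alive_mono by blast
qed

lemma keeps_promises_MAD:
  assumes keeps: "keeps_promises TYPE('p::preorder) A" and AD: "almost_disjoint A"
  shows "MAD A"
  unfolding MAD_def
proof (intro conjI notI AD)
  assume "\<exists>B. almost_disjoint B \<and> A \<subset> B"
  then obtain B b where B: "almost_disjoint B" "A \<subseteq> B" "b \<in> B" "b \<notin> A" by blast
  have b: "infinite b" using B by (simp add: almost_disjoint_def)
  obtain I where "infinite I" "dead A (singletons b) I \<or> alive A (singletons b) I"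
    using keeps_promises_ground[OF keeps fin_sequence_singletons[OF b]] by blast
  from infinite_Int_exists[OF b this] obtain a where "a \<in> A" "infinite (a \<inter> b)" by blast
  with B almost_disjointD[OF B(1), of a b] show False by blast
qed

lemma infinite_Inter_cofinite:
  assumes "infinite I" "finite F" "\<And>X. X \<in> F \<Longrightarrow> finite (I - X)"
  shows "infinite {n \<in> I. \<forall>X\<in>F. n \<in> X}"
proof
  assume fin: "finite {n \<in> I. \<forall>X\<in>F. n \<in> X}"
  have "finite (\<Union>X\<in>F. I - X)" using assms(2,3) by (rule finite_UN_I)
  with fin have "finite ({n \<in> I. \<forall>X\<in>F. n \<in> X} \<union> (\<Union>X\<in>F. I - X))" by (rule finite_UnI)
  moreover have "I \<subseteq> {n \<in> I. \<forall>X\<in>F. n \<in> X} \<union> (\<Union>X\<in>F. I - X)" by blast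
  ultimately show False using assms(1) finite_subset by blast
qed

lemma keeps_promises_fin_intersecting:
  assumes keeps: "keeps_promises TYPE('p::preorder) A" and AD: "almost_disjoint A"
  shows "fin_intersecting A"
  unfolding fin_intersecting_def
proof (intro conjI AD allI impI)
  fix c assume "fin_sequence c"
  from keeps_promises_ground[OF keeps this]
  obtain I where I: "infinite I" "\<And>a. a \<in> A \<Longrightarrow> settled a c I" by blast
  have "centered ((\<lambda>a. {n \<in> I. a \<inter> c n \<noteq> {}}) ` A - {X. X \<subseteq> I \<and> finite X})"
    unfolding centered_def
  proof (intro allI impI)
    fix F assume F: "F \<subseteq> (\<lambda>a. {n \<in> I. a \<inter> c n \<noteq> {}}) ` A - {X. X \<subseteq> I \<and> finite X} \<and> finite F \<and> F \<noteq> {}"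
    have "finite (I - X)" if X: "X \<in> F" for X
    proof -
      obtain a where a: "a \<in> A" "X = trace a c I" using F X unfolding trace_def by blast
      have "infinite X" using F X by (auto simp: trace_def)
      with I(2)[OF a(1)] show ?thesis unfolding settled_def a(2) by simp
    qed
    with I(1) F have "infinite {n \<in> I. \<forall>X\<in>F. n \<in> X}" by (intro infinite_Inter_cofinite) auto
    moreover have "{n \<in> I. \<forall>X\<in>F. n \<in> X} \<subseteq> \<Inter>F" by blast
    ultimately show "infinite (\<Inter>F)" using finite_subset by blast
  qed
  with I(1) show "\<exists>I. infinite I \<and> centered ((\<lambda>a. {n \<in> I. a \<inter> c n \<noteq> {}}) ` A - {X. X \<subseteq> I \<and> finite X})"
    by blast
qed

subsection \<open>In the generic extension\<close>

lemma forces_impD: "p \<tturnstile> \<phi> \<^bold>\<longrightarrow> \<psi> \<Longrightarrow> q \<le> p \<Longrightarrow> q \<tturnstile> \<phi> \<Longrightarrow> \<exists>r\<le>q. r \<tturnstile> \<psi>"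
  by (simp add: forces_imp)

lemma forces_imp_represents:
  assumes imp: "p \<tturnstile> \<phi> \<^bold>\<longrightarrow> \<psi>" and "q \<le> p" and ante: "\<And>r. r \<le> q \<Longrightarrow> r \<tturnstile> \<phi>" and rep: "represents \<psi> E"
  shows "eventually E (generics q)"
proof (rule eventually_generics_local)
  fix r assume "r \<le> q"
  have "r \<le> p" using \<open>r \<le> q\<close> \<open>q \<le> p\<close> by (rule order_trans)
  from forces_impD[OF imp this ante[OF \<open>r \<le> q\<close>]]
  show "\<exists>s\<le>r. eventually E (generics s)" unfolding represents_forces[OF rep] .
qed

text \<open>
  An extension of the condition decides which element of \<open>A\<close> a given element of the check name
  is.
\<close>

lemma forces_almost_disjoint_Check:
  fixes p :: "'p::preorder"
  assumes AD: "almost_disjoint A"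
  shows "p \<tturnstile> almost_disjoint_name (Check A)"
  unfolding almost_disjoint_name_def forces_and
proof (intro conjI)
  show "p \<tturnstile> \<^bold>\<not> Finite_name (Check A)"
    unfolding forces_not
  proof (intro allI impI notI)
    fix q :: 'p assume "q \<tturnstile> Finite_name (Check A)"
    from forces_exD[OF this[unfolded Finite_name_def] order_refl] obtain r and k :: nat where
      "r \<tturnstile> (\<^bold>\<exists>S::(nat \<times> nat, 'p) name. \<^bold>\<forall>x. x \<^bold>\<in>\<^bold>\<in> Check A \<^bold>\<longrightarrow>
        (\<^bold>\<exists>i. ground (i < k) \<^bold>\<and> x \<^bold>= section_at S i))" by blast
    from forces_exD[OF this order_refl] obtain r and S :: "(nat \<times> nat, 'p) name" where
      S: "r \<tturnstile> (\<^bold>\<forall>x. x \<^bold>\<in>\<^bold>\<in> Check A \<^bold>\<longrightarrow> (\<^bold>\<exists>i. ground (i < k) \<^bold>\<and> x \<^bold>= section_at S i))" by blast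
    have listed: "\<forall>\<^sub>F G in generics r. \<exists>i. i < k \<and> a = val S G `` {i}" if "a \<in> A" for a
    proof -
      have rep: "represents (\<^bold>\<exists>i. ground (i < k) \<^bold>\<and> check a \<^bold>= section_at S i)
          (\<lambda>G. \<exists>i. i < k \<and> val (check a) G = val (section_at S i) G)"
        by (intro represents_intros represents_eq)
      have "r \<tturnstile> check a \<^bold>\<in>\<^bold>\<in> Check A \<^bold>\<longrightarrow> (\<^bold>\<exists>i. ground (i < k) \<^bold>\<and> check a \<^bold>= section_at S i)"
        using S unfolding forces_all by blast
      from forces_imp_represents[OF this order_refl forces_check_Mem_Check[OF that] rep]
        eventually_val_check[of a r]
      show ?thesis by eventually_elim (simp add: val_section_at)
    qed
    have "infinite A" using AD by (simp add: almost_disjoint_def)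
    from infinite_arbitrarily_large[OF this, of "Suc k"]
    obtain A1 where A1: "finite A1" "card A1 = Suc k" "A1 \<subseteq> A" by blast
    have "\<forall>\<^sub>F G in generics r. \<forall>a\<in>A1. \<exists>i. i < k \<and> a = val S G `` {i}"
      using A1 listed by (intro eventually_generics_all countable_finite) blast+
    then have "\<forall>\<^sub>F G in generics r. False"
    proof eventually_elim
      case (elim G)
      then have "A1 \<subseteq> (\<lambda>i. val S G `` {i}) ` {..<k}" by blast
      then have "card A1 \<le> k" using surj_card_le[of "{..<k}"] by simp
      with A1(2) show ?case by simp
    qed
    then show False by simp
  qed
  show "p \<tturnstile> (\<^bold>\<forall>x. x \<^bold>\<in>\<^bold>\<in> Check A \<^bold>\<longrightarrow> \<^bold>\<not> finite_name x)"
    unfolding forces_all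
  proof (intro allI forces_impI)
    fix x and q :: 'p assume "q \<tturnstile> x \<^bold>\<in>\<^bold>\<in> Check A"
    then obtain r a where r: "r \<le> q" "a \<in> A" "\<forall>\<^sub>F G in generics r. val x G = a"
      unfolding forces_Mem_Check by blast
    have "infinite a" using AD r(2) by (simp add: almost_disjoint_def)
    with r(3) have "r \<tturnstile> \<^bold>\<not> finite_name x"
      unfolding represents_forces[OF represents_not[OF represents_finite_name]]
      by (auto elim: eventually_mono)
    with r(1) show "\<exists>r\<le>q. r \<tturnstile> \<^bold>\<not> finite_name x" by blast
  qed
  show "p \<tturnstile> (\<^bold>\<forall>x. \<^bold>\<forall>y. x \<^bold>\<in>\<^bold>\<in> Check A \<^bold>\<and> y \<^bold>\<in>\<^bold>\<in> Check A \<^bold>\<and> \<^bold>\<not> (x \<^bold>= y) \<^bold>\<longrightarrow> finite_name (inter x y))"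
    unfolding forces_all
  proof (intro allI forces_impI)
    fix x y and q :: 'p assume "q \<tturnstile> x \<^bold>\<in>\<^bold>\<in> Check A \<^bold>\<and> y \<^bold>\<in>\<^bold>\<in> Check A \<^bold>\<and> \<^bold>\<not> (x \<^bold>= y)"
    then have q: "q \<tturnstile> x \<^bold>\<in>\<^bold>\<in> Check A" "q \<tturnstile> y \<^bold>\<in>\<^bold>\<in> Check A" "\<forall>\<^sub>F G in generics q. val x G \<noteq> val y G"
      unfolding forces_and represents_forces[OF represents_not[OF represents_eq]] by blast+
    obtain r a where r: "r \<le> q" "a \<in> A" "\<forall>\<^sub>F G in generics r. val x G = a"
      using q(1) unfolding forces_Mem_Check by blast
    obtain s b where s: "s \<le> r" "b \<in> A" "\<forall>\<^sub>F G in generics s. val y G = b"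
      using q(2) r(1) unfolding forces_Mem_Check by blast
    have "s \<le> q" using s(1) r(1) by (rule order_trans)
    have "\<forall>\<^sub>F G in generics s. finite (val (inter x y) G)"
      using s(3) generics_mono[OF s(1) r(3)] generics_mono[OF \<open>s \<le> q\<close> q(3)] eventually_val_inter[of x y s]
      by eventually_elim (use almost_disjointD[OF AD r(2) s(2)] in auto)
    then have "s \<tturnstile> finite_name (inter x y)" unfolding represents_forces[OF represents_finite_name] .
    with \<open>s \<le> q\<close> show "\<exists>r\<le>q. r \<tturnstile> finite_name (inter x y)" by blast
  qed
qed

text \<open>
  A new element \<open>x\<close> of a larger almost disjoint family would be infinite and almost disjoint
  from all members of \<open>A\<close>. The promise for the singletons listing \<open>x\<close> provides a countable
  subfamily \<open>A0\<close> in which some member meets \<open>x\<close> in an infinite set; the countability of \<open>A0\<close>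
  makes it possible to consider all its members at the same sampled filter.
\<close>

lemma forces_MAD_Check:
  fixes p :: "'p::preorder"
  assumes keeps: "keeps_promises TYPE('p) A" and AD: "almost_disjoint A"
  shows "p \<tturnstile> MAD_name (Check A)"
  unfolding MAD_name_def forces_and
proof (intro conjI forces_almost_disjoint_Check AD)
  show "p \<tturnstile> \<^bold>\<not> (\<^bold>\<exists>G. almost_disjoint_name G \<^bold>\<and> Check A \<^bold>\<subseteq>\<^bold>\<subseteq> G \<^bold>\<and> \<^bold>\<not> (G \<^bold>\<subseteq>\<^bold>\<subseteq> Check A))"
    unfolding forces_not[of p]
  proof (intro allI impI notI)
    fix q :: 'p
    assume "q \<tturnstile> (\<^bold>\<exists>G. almost_disjoint_name G \<^bold>\<and> Check A \<^bold>\<subseteq>\<^bold>\<subseteq> G \<^bold>\<and> \<^bold>\<not> (G \<^bold>\<subseteq>\<^bold>\<subseteq> Check A))"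
    from forces_exD[OF this order_refl] obtain r :: 'p and M where
      M: "r \<tturnstile> almost_disjoint_name M" "r \<tturnstile> Check A \<^bold>\<subseteq>\<^bold>\<subseteq> M" "r \<tturnstile> \<^bold>\<not> (M \<^bold>\<subseteq>\<^bold>\<subseteq> Check A)"
      unfolding forces_and by blast
    from M(3) have "\<not> (r \<tturnstile> M \<^bold>\<subseteq>\<^bold>\<subseteq> Check A)" unfolding forces_not by blast
    then obtain x s where s: "s \<le> r" "s \<tturnstile> x \<^bold>\<in>\<^bold>\<in> M" and new: "\<And>t. t \<le> s \<Longrightarrow> \<not> (t \<tturnstile> x \<^bold>\<in>\<^bold>\<in> Check A)"
      unfolding Sub_def forces_all forces_imp by blast
    have inf: "\<forall>\<^sub>F G in generics s. infinite (val x G)"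
    proof (rule forces_imp_represents[OF _ s(1)])
      show "r \<tturnstile> x \<^bold>\<in>\<^bold>\<in> M \<^bold>\<longrightarrow> \<^bold>\<not> finite_name x"
        using M(1) unfolding almost_disjoint_name_def forces_and forces_all by blast
      show "t \<tturnstile> x \<^bold>\<in>\<^bold>\<in> M" if "t \<le> s" for t using that s(2) by (rule Mem_mono)
    qed (intro represents_not represents_finite_name)
    have fin: "\<forall>\<^sub>F G in generics s. finite (a \<inter> val x G)" if a: "a \<in> A" for a
    proof -
      have "s \<tturnstile> check a \<^bold>\<in>\<^bold>\<in> M"
      proof (rule Mem_local)
        fix t assume "t \<le> s"
        then have "t \<le> r" using s(1) by (rule order_trans)
        have "r \<tturnstile> check a \<^bold>\<in>\<^bold>\<in> Check A \<^bold>\<longrightarrow> check a \<^bold>\<in>\<^bold>\<in> M" using M(2) unfolding Sub_def forces_all by blast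
        from forces_impD[OF this \<open>t \<le> r\<close> forces_check_Mem_Check[OF a]]
        show "\<exists>u\<le>t. u \<tturnstile> check a \<^bold>\<in>\<^bold>\<in> M" .
      qed
      have "\<not> (t \<tturnstile> x \<^bold>= check a)" if "t \<le> s" for t
      proof
        assume "t \<tturnstile> x \<^bold>= check a"
        then have "\<forall>\<^sub>F G in generics t. val (check a) G = val x G"
          unfolding represents_forces[OF represents_eq] by eventually_elim simp
        from Mem_cong[OF this forces_check_Mem_Check[OF a]] new[OF that] show False by blast
      qed
      then have neq: "s \<tturnstile> \<^bold>\<not> (x \<^bold>= check a)" unfolding forces_not by blast
      have "\<forall>\<^sub>F G in generics s. finite (val (inter x (check a)) G)"
      proof (rule forces_imp_represents[OF _ s(1)])
        show "r \<tturnstile> x \<^bold>\<in>\<^bold>\<in> M \<^bold>\<and> check a \<^bold>\<in>\<^bold>\<in> M \<^bold>\<and> \<^bold>\<not> (x \<^bold>= check a) \<^bold>\<longrightarrow> finite_name (inter x (check a))"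
          using M(1) unfolding almost_disjoint_name_def forces_and forces_all by blast
        show "t \<tturnstile> x \<^bold>\<in>\<^bold>\<in> M \<^bold>\<and> check a \<^bold>\<in>\<^bold>\<in> M \<^bold>\<and> \<^bold>\<not> (x \<^bold>= check a)" if "t \<le> s" for t
          unfolding forces_and
        proof (intro conjI)
          show "t \<tturnstile> x \<^bold>\<in>\<^bold>\<in> M" using that s(2) by (rule Mem_mono)
          show "t \<tturnstile> check a \<^bold>\<in>\<^bold>\<in> M" using that \<open>s \<tturnstile> check a \<^bold>\<in>\<^bold>\<in> M\<close> by (rule Mem_mono)
          show "t \<tturnstile> \<^bold>\<not> (x \<^bold>= check a)"
            using neq generics_mono[OF that]
            unfolding represents_forces[OF represents_not[OF represents_eq]] by blast
        qed
      qed (rule represents_finite_name)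
      with eventually_val_inter[of x "check a" s] eventually_val_check[of a s]
      show ?thesis by eventually_elim (simp add: Int_commute)
    qed
    let ?c = "name_of (\<lambda>G. {(n, k). k \<in> singletons (val x G) n})"
    have "decided (\<lambda>G. e \<in> {(n, k). k \<in> singletons (val x G) n})" for e
      by (cases e) (simp add: decided_singletons decided_val)
    from val_name_of[OF this, of s] have c: "\<forall>\<^sub>F G in generics s. term_of ?c G = singletons (val x G)"
      by eventually_elim (simp add: term_of_def fun_eq_iff)
    with inf have "\<forall>\<^sub>F G in generics s. fin_sequence (term_of ?c G)"
      by eventually_elim (simp add: fin_sequence_singletons)
    with keeps obtain \<Phi> where "promise A s (term_of ?c) (\<lambda>G. \<Phi> (term_of ?c G))"
      unfolding keeps_promises_def by blast
    then obtain A0 where A0: "A0 \<subseteq> A" "countable A0"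
      "\<forall>\<^sub>F G in generics s. infinite (\<Phi> (term_of ?c G))"
      "\<forall>\<^sub>F G in generics s. dead A0 (term_of ?c G) (\<Phi> (term_of ?c G)) \<or>
         alive A0 (term_of ?c G) (\<Phi> (term_of ?c G))"
      unfolding promise_def by blast
    have "\<forall>\<^sub>F G in generics s. \<forall>a\<in>A0. finite (a \<inter> val x G)"
      using A0(1,2) fin by (intro eventually_generics_all) blast+
    with c inf A0(3,4) have "\<forall>\<^sub>F G in generics s. False"
    proof eventually_elim
      case (elim G)
      have "\<exists>a\<in>A0. infinite (a \<inter> val x G)"
        using elim(3,4) unfolding elim(1) by (rule infinite_Int_exists[OF elim(2)])
      with elim(5) show ?case by blast
    qed
    then show False by simp
  qed
qed

text \<open>
  Used to decide finitely many questions by one extension.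
\<close>

lemma extend_finitely_often:
  fixes r :: "'p::preorder"
  assumes "finite J" "\<And>i q. i \<in> J \<Longrightarrow> q \<le> r \<Longrightarrow> \<exists>s\<le>q. Q i s" "\<And>i q s. Q i q \<Longrightarrow> s \<le> q \<Longrightarrow> Q i s"
  shows "\<exists>s\<le>r. \<forall>i\<in>J. Q i s"
  using assms(1,2)
proof (induction J)
  case empty
  then show ?case by auto
next
  case (insert j J)
  from insert.IH insert.prems obtain s where s: "s \<le> r" "\<forall>i\<in>J. Q i s" by blast
  from insert.prems[of j s] s(1) obtain t where t: "t \<le> s" "Q j t" by blast
  with s(2) assms(3) have "\<forall>i\<in>insert j J. Q i t" by blast
  moreover have "t \<le> r" using t(1) s(1) by (rule order_trans)
  ultimately show ?case by blast
qed

text \<open>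
  The formula for the infinite traces on \<open>I\<close> that occurs in \<open>fin_intersecting_name\<close>.
\<close>

definition trace_formula :: "nat set set \<Rightarrow> (nat \<times> nat, 'p::preorder) name \<Rightarrow> (nat, 'p) name \<Rightarrow>
    (nat, 'p) name \<Rightarrow> 'p sentence" where
  "trace_formula A C I x =
     ((\<^bold>\<exists>a. a \<^bold>\<in>\<^bold>\<in> Check A \<^bold>\<and>
        (\<^bold>\<forall>n. n \<^bold>\<in> x \<^bold>\<longleftrightarrow> n \<^bold>\<in> I \<^bold>\<and> (\<^bold>\<exists>k. k \<^bold>\<in> a \<^bold>\<and> k \<^bold>\<in> section_at C n))) \<^bold>\<and>
      \<^bold>\<not> (x \<^bold>\<subseteq> I \<^bold>\<and> finite_name x))"

lemma trace_formula_cofinite: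
  fixes p :: "'p::preorder"
  assumes settled: "\<And>a. a \<in> A \<Longrightarrow> \<forall>\<^sub>F G in generics p. settled a (term_of C G) (val I G)"
    and "q \<le> p" and q: "q \<tturnstile> trace_formula A C I x"
  shows "\<exists>r\<le>q. \<forall>\<^sub>F G in generics r. finite (val I G - val x G)"
proof -
  from q have ex: "q \<tturnstile> (\<^bold>\<exists>a. a \<^bold>\<in>\<^bold>\<in> Check A \<^bold>\<and>
        (\<^bold>\<forall>n. n \<^bold>\<in> x \<^bold>\<longleftrightarrow> n \<^bold>\<in> I \<^bold>\<and> (\<^bold>\<exists>k. k \<^bold>\<in> a \<^bold>\<and> k \<^bold>\<in> section_at C n)))"
    and neg: "q \<tturnstile> \<^bold>\<not> (x \<^bold>\<subseteq> I \<^bold>\<and> finite_name x)"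
    unfolding trace_formula_def forces_and by blast+
  from forces_exD[OF ex order_refl] obtain r a where r: "r \<le> q" "r \<tturnstile> a \<^bold>\<in>\<^bold>\<in> Check A"
    "r \<tturnstile> (\<^bold>\<forall>n. n \<^bold>\<in> x \<^bold>\<longleftrightarrow> n \<^bold>\<in> I \<^bold>\<and> (\<^bold>\<exists>k. k \<^bold>\<in> a \<^bold>\<and> k \<^bold>\<in> section_at C n))"
    unfolding forces_and by blast
  from r(2) obtain s b where s: "s \<le> r" "b \<in> A" "\<forall>\<^sub>F G in generics s. val a G = b"
    unfolding forces_Mem_Check by blast
  have rep: "represents (\<^bold>\<forall>n. n \<^bold>\<in> x \<^bold>\<longleftrightarrow> n \<^bold>\<in> I \<^bold>\<and> (\<^bold>\<exists>k. k \<^bold>\<in> a \<^bold>\<and> k \<^bold>\<in> section_at C n))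
    (\<lambda>G. \<forall>n. n \<in> val x G \<longleftrightarrow> n \<in> val I G \<and> (\<exists>k. k \<in> val a G \<and> k \<in> val (section_at C n) G))"
    by (intro represents_intros)
  have rep': "represents (\<^bold>\<not> (x \<^bold>\<subseteq> I \<^bold>\<and> finite_name x)) (\<lambda>G. \<not> (val x G \<subseteq> val I G \<and> finite (val x G)))"
    by (intro represents_not represents_and represents_sub represents_finite_name)
  have "s \<le> q" using s(1) r(1) by (rule order_trans)
  then have "s \<le> p" using \<open>q \<le> p\<close> by (rule order_trans)
  have "\<forall>\<^sub>F G in generics s. finite (val I G - val x G)"
    using generics_mono[OF \<open>s \<le> p\<close> settled[OF s(2)]] s(3)
      generics_mono[OF s(1) r(3)[unfolded represents_forces[OF rep]]]
      generics_mono[OF \<open>s \<le> q\<close> neg[unfolded represents_forces[OF rep']]]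
  proof eventually_elim
    case (elim G)
    have "val x G = trace b (term_of C G) (val I G)"
      using elim(2,3) unfolding trace_def term_of_def val_section_at by blast
    with elim(1,4) show ?case unfolding settled_def trace_def by auto
  qed
  with \<open>s \<le> q\<close> show ?thesis by blast
qed

text \<open>
  A finite family \<open>F\<close> of the extension is listed by sections \<open>0, \<dots>, k - 1\<close> of a name \<open>S\<close>. After
  one extension it is decided which sections belong to \<open>F\<close>, and these are cofinite in \<open>I\<close>. Their
  intersection has an explicit name \<open>?z\<close>, although \<open>F\<close> is an arbitrary name.
\<close>

lemma forces_centered_name:
  fixes p :: "'p::preorder"
  assumes inf: "\<forall>\<^sub>F G in generics p. infinite (val I G)"
    and settled: "\<And>a. a \<in> A \<Longrightarrow> \<forall>\<^sub>F G in generics p. settled a (term_of C G) (val I G)"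
  shows "p \<tturnstile> centered_name (trace_formula A C I)"
  unfolding centered_name_def forces_all[of p]
proof (intro allI forces_impI)
  fix F :: "((nat, 'p) name, 'p) name" and q
  assume "q \<le> p" and "q \<tturnstile> (\<^bold>\<forall>x. x \<^bold>\<in>\<^bold>\<in> F \<^bold>\<longrightarrow> trace_formula A C I x) \<^bold>\<and> Finite_name F \<^bold>\<and> (\<^bold>\<exists>x. x \<^bold>\<in>\<^bold>\<in> F)"
  then have K: "q \<tturnstile> x \<^bold>\<in>\<^bold>\<in> F \<^bold>\<longrightarrow> trace_formula A C I x" and Fin: "q \<tturnstile> Finite_name F" for x
    unfolding forces_and forces_all by blast+
  from forces_exD[OF Fin[unfolded Finite_name_def] order_refl] obtain r0 and k :: nat where
    r0: "r0 \<le> q" "r0 \<tturnstile> (\<^bold>\<exists>S::(nat \<times> nat, 'p) name. \<^bold>\<forall>x. x \<^bold>\<in>\<^bold>\<in> F \<^bold>\<longrightarrow>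
        (\<^bold>\<exists>i. ground (i < k) \<^bold>\<and> x \<^bold>= section_at S i))" by blast
  from forces_exD[OF r0(2) order_refl] obtain r1 and S :: "(nat \<times> nat, 'p) name" where
    r1: "r1 \<le> r0" "\<And>x. r1 \<tturnstile> x \<^bold>\<in>\<^bold>\<in> F \<^bold>\<longrightarrow> (\<^bold>\<exists>i. ground (i < k) \<^bold>\<and> x \<^bold>= section_at S i)"
    unfolding forces_all by blast
  \<comment> \<open>\<open>r2\<close> decides for each section whether it belongs to \<open>F\<close>.\<close>
  have "\<exists>s\<le>r1. \<forall>i\<in>{..<k}. (s \<tturnstile> section_at S i \<^bold>\<in>\<^bold>\<in> F) \<or> (\<forall>t\<le>s. \<not> (t \<tturnstile> section_at S i \<^bold>\<in>\<^bold>\<in> F))"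
  proof (rule extend_finitely_often)
    fix i and u v :: 'p
    show "\<exists>s\<le>u. (s \<tturnstile> section_at S i \<^bold>\<in>\<^bold>\<in> F) \<or> (\<forall>t\<le>s. \<not> (t \<tturnstile> section_at S i \<^bold>\<in>\<^bold>\<in> F))" by blast
    assume "(u \<tturnstile> section_at S i \<^bold>\<in>\<^bold>\<in> F) \<or> (\<forall>t\<le>u. \<not> (t \<tturnstile> section_at S i \<^bold>\<in>\<^bold>\<in> F))" "v \<le> u"
    then show "(v \<tturnstile> section_at S i \<^bold>\<in>\<^bold>\<in> F) \<or> (\<forall>t\<le>v. \<not> (t \<tturnstile> section_at S i \<^bold>\<in>\<^bold>\<in> F))"
      using Mem_mono order_trans by blast
  qed simp
  then obtain r2 where r2: "r2 \<le> r1" and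
    dec: "\<And>i. i < k \<Longrightarrow> (r2 \<tturnstile> section_at S i \<^bold>\<in>\<^bold>\<in> F) \<or> (\<forall>t\<le>r2. \<not> (t \<tturnstile> section_at S i \<^bold>\<in>\<^bold>\<in> F))"
    by blast
  have "r2 \<le> q" using r2 r1(1) r0(1) order_trans by blast
  define J where "J = {i. i < k \<and> (r2 \<tturnstile> section_at S i \<^bold>\<in>\<^bold>\<in> F)}"
  \<comment> \<open>At \<open>r3\<close> each of these sections is the trace of a member of \<open>A\<close>, hence cofinite in \<open>I\<close>.\<close>
  have "\<exists>s\<le>r2. \<forall>i\<in>J. \<forall>\<^sub>F G in generics s. finite (val I G - val S G `` {i})"
  proof (rule extend_finitely_often)
    show "finite J" by (simp add: J_def)
    fix i u assume i: "i \<in> J" and u: "u \<le> r2"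
    have "u \<tturnstile> section_at S i \<^bold>\<in>\<^bold>\<in> F" using i u Mem_mono by (auto simp: J_def)
    moreover have "u \<le> q" using u \<open>r2 \<le> q\<close> by (rule order_trans)
    ultimately obtain v where v: "v \<le> u" "v \<tturnstile> trace_formula A C I (section_at S i)"
      using forces_impD[OF K] by blast
    have "v \<le> p" using v(1) \<open>u \<le> q\<close> \<open>q \<le> p\<close> order_trans by blast
    from trace_formula_cofinite[OF settled this v(2)] obtain s where
      "s \<le> v" "\<forall>\<^sub>F G in generics s. finite (val I G - val S G `` {i})"
      unfolding val_section_at by blast
    moreover from this(1) v(1) have "s \<le> u" by (rule order_trans)
    ultimately show "\<exists>s\<le>u. \<forall>\<^sub>F G in generics s. finite (val I G - val S G `` {i})" by blast
  qed (rule generics_mono)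
  then obtain r3 where r3: "r3 \<le> r2" and
    cof: "\<And>i. i \<in> J \<Longrightarrow> \<forall>\<^sub>F G in generics r3. finite (val I G - val S G `` {i})" by blast
  have "countable J" by simp
  let ?z = "name_of (\<lambda>G. {n. \<forall>i\<in>J. n \<in> val S G `` {i}})"
  have "decided (\<lambda>G. n \<in> {n. \<forall>i\<in>J. n \<in> val S G `` {i}})" for n
    unfolding mem_Collect_eq Image_singleton_iff by (intro decided_ball decided_val \<open>countable J\<close>)
  note z = val_name_of[OF this]
  have "r3 \<tturnstile> (\<^bold>\<exists>y. (\<^bold>\<forall>n. n \<^bold>\<in> y \<^bold>\<longleftrightarrow> (\<^bold>\<forall>x. x \<^bold>\<in>\<^bold>\<in> F \<^bold>\<longrightarrow> n \<^bold>\<in> x)) \<^bold>\<and> \<^bold>\<not> finite_name y)"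
  proof (rule forces_exI[of _ _ ?z])
    fix s assume s: "s \<le> r3"
    have "s \<le> r2" using s r3 by (rule order_trans)
    have "s \<le> p" using \<open>s \<le> r2\<close> \<open>r2 \<le> q\<close> \<open>q \<le> p\<close> order_trans by blast
    have "\<forall>\<^sub>F G in generics s. \<forall>i\<in>J. finite (val I G - val S G `` {i})"
      using generics_mono[OF s cof] by (intro eventually_generics_all \<open>countable J\<close>) blast
    with z[of s] generics_mono[OF \<open>s \<le> p\<close> inf] have "\<forall>\<^sub>F G in generics s. infinite (val ?z G)"
    proof eventually_elim
      case (elim G)
      have "infinite {n \<in> val I G. \<forall>X\<in>(\<lambda>i. val S G `` {i}) ` J. n \<in> X}"
        using elim(2,3) by (intro infinite_Inter_cofinite) (auto simp: J_def)
      moreover have "{n \<in> val I G. \<forall>X\<in>(\<lambda>i. val S G `` {i}) ` J. n \<in> X} \<subseteq> val ?z G"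
        unfolding elim(1) by blast
      ultimately show ?case using finite_subset by blast
    qed
    then have "s \<tturnstile> \<^bold>\<not> finite_name ?z"
      unfolding represents_forces[OF represents_not[OF represents_finite_name]] .
    moreover have "s \<tturnstile> n \<^bold>\<in> ?z \<^bold>\<longleftrightarrow> (\<^bold>\<forall>x. x \<^bold>\<in>\<^bold>\<in> F \<^bold>\<longrightarrow> n \<^bold>\<in> x)" for n
      unfolding fiff_def forces_and
    proof (intro conjI forces_impI)
      fix t assume "t \<le> s" "t \<tturnstile> n \<^bold>\<in> ?z"
      have "t \<le> r2" using \<open>t \<le> s\<close> \<open>s \<le> r2\<close> by (rule order_trans)
      have nz: "\<forall>\<^sub>F G in generics t. n \<in> val ?z G"
        using \<open>t \<tturnstile> n \<^bold>\<in> ?z\<close> unfolding represents_forces[OF represents_mem] .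
      have "t \<tturnstile> (\<^bold>\<forall>x. x \<^bold>\<in>\<^bold>\<in> F \<^bold>\<longrightarrow> n \<^bold>\<in> x)"
        unfolding forces_all
      proof (intro allI forces_impI)
        fix x u assume u: "u \<le> t" "u \<tturnstile> x \<^bold>\<in>\<^bold>\<in> F"
        have "u \<le> r2" using u(1) \<open>t \<le> r2\<close> by (rule order_trans)
        then have "u \<le> r1" using r2 by (rule order_trans)
        from forces_impD[OF r1(2) this u(2)] obtain v where
          v: "v \<le> u" "v \<tturnstile> (\<^bold>\<exists>i. ground (i < k) \<^bold>\<and> x \<^bold>= section_at S i)" by blast
        from forces_exD[OF v(2) order_refl] obtain w i where
          w: "w \<le> v" "w \<tturnstile> ground (i < k) \<^bold>\<and> x \<^bold>= section_at S i" by blast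
        from w(2) have "i < k" and eq: "\<forall>\<^sub>F G in generics w. val x G = val (section_at S i) G"
          unfolding forces_and represents_forces[OF represents_eq]
            represents_forces[OF represents_ground] by simp_all
        have "w \<le> u" using w(1) v(1) by (rule order_trans)
        then have "w \<tturnstile> section_at S i \<^bold>\<in>\<^bold>\<in> F" by (intro Mem_cong[OF eq] Mem_mono[OF _ u(2)])
        moreover have "w \<le> r2" using \<open>w \<le> u\<close> \<open>u \<le> r2\<close> by (rule order_trans)
        ultimately have "i \<in> J" using dec[OF \<open>i < k\<close>] \<open>i < k\<close> unfolding J_def by blast
        have "w \<le> t" using \<open>w \<le> u\<close> u(1) by (rule order_trans)
        from generics_mono[OF this nz] z[of w] eq have "\<forall>\<^sub>F G in generics w. n \<in> val x G"
          by eventually_elim (use \<open>i \<in> J\<close> in \<open>simp add: val_section_at\<close>)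
        then have "w \<tturnstile> n \<^bold>\<in> x" unfolding represents_forces[OF represents_mem] .
        with \<open>w \<le> u\<close> show "\<exists>w\<le>u. w \<tturnstile> n \<^bold>\<in> x" by blast
      qed
      then show "\<exists>r\<le>t. r \<tturnstile> (\<^bold>\<forall>x. x \<^bold>\<in>\<^bold>\<in> F \<^bold>\<longrightarrow> n \<^bold>\<in> x)" by blast
    next
      fix t assume "t \<le> s" and all: "t \<tturnstile> (\<^bold>\<forall>x. x \<^bold>\<in>\<^bold>\<in> F \<^bold>\<longrightarrow> n \<^bold>\<in> x)"
      have "t \<le> r2" using \<open>t \<le> s\<close> \<open>s \<le> r2\<close> by (rule order_trans)
      have "\<forall>\<^sub>F G in generics t. n \<in> val (section_at S i) G" if i: "i \<in> J" for i
      proof (rule forces_imp_represents[OF _ order_refl])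
        show "t \<tturnstile> section_at S i \<^bold>\<in>\<^bold>\<in> F \<^bold>\<longrightarrow> n \<^bold>\<in> section_at S i"
          using all unfolding forces_all by blast
        show "u \<tturnstile> section_at S i \<^bold>\<in>\<^bold>\<in> F" if "u \<le> t" for u
        proof (rule Mem_mono)
          show "u \<le> r2" using that \<open>t \<le> r2\<close> by (rule order_trans)
          show "r2 \<tturnstile> section_at S i \<^bold>\<in>\<^bold>\<in> F" using i by (simp add: J_def)
        qed
      qed (rule represents_mem)
      then have "\<forall>\<^sub>F G in generics t. \<forall>i\<in>J. n \<in> val (section_at S i) G"
        by (intro eventually_generics_all \<open>countable J\<close>)
      with z[of t] have "\<forall>\<^sub>F G in generics t. n \<in> val ?z G"
        by eventually_elim (simp add: val_section_at)
      then have "t \<tturnstile> n \<^bold>\<in> ?z" unfolding represents_forces[OF represents_mem] .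
      then show "\<exists>r\<le>t. r \<tturnstile> n \<^bold>\<in> ?z" by blast
    qed
    ultimately show "s \<tturnstile> (\<^bold>\<forall>n. n \<^bold>\<in> ?z \<^bold>\<longleftrightarrow> (\<^bold>\<forall>x. x \<^bold>\<in>\<^bold>\<in> F \<^bold>\<longrightarrow> n \<^bold>\<in> x)) \<^bold>\<and> \<^bold>\<not> finite_name ?z"
      unfolding forces_and forces_all[of s "\<lambda>n. n \<^bold>\<in> ?z \<^bold>\<longleftrightarrow> (\<^bold>\<forall>x. x \<^bold>\<in>\<^bold>\<in> F \<^bold>\<longrightarrow> n \<^bold>\<in> x)"] by blast
  qed
  moreover have "r3 \<le> q" using r3 \<open>r2 \<le> q\<close> by (rule order_trans)
  ultimately show "\<exists>r\<le>q. r \<tturnstile>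
    (\<^bold>\<exists>y. (\<^bold>\<forall>n. n \<^bold>\<in> y \<^bold>\<longleftrightarrow> (\<^bold>\<forall>x. x \<^bold>\<in>\<^bold>\<in> F \<^bold>\<longrightarrow> n \<^bold>\<in> x)) \<^bold>\<and> \<^bold>\<not> finite_name y)" by blast
qed

lemma forces_fin_intersecting_Check:
  fixes p :: "'p::preorder"
  assumes keeps: "keeps_promises TYPE('p) A" and AD: "almost_disjoint A"
  shows "p \<tturnstile> fin_intersecting_name (Check A)"
proof -
  have "p \<tturnstile> (\<^bold>\<forall>C. fin_sequence_name C \<^bold>\<longrightarrow>
       (\<^bold>\<exists>I. \<^bold>\<not> finite_name I \<^bold>\<and> centered_name (trace_formula A C I)))"
    unfolding forces_all
  proof (intro allI forces_impI)
    fix C and q :: 'p assume "q \<tturnstile> fin_sequence_name C"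
    then have "\<forall>\<^sub>F G in generics q. fin_sequence (term_of C G)"
      unfolding represents_forces[OF represents_fin_sequence_name] term_of_def .
    with keeps obtain \<Phi> y where y: "\<forall>\<^sub>F G in generics q. val y G = \<Phi> (term_of C G)"
      and prom: "promise A q (term_of C) (\<lambda>G. \<Phi> (term_of C G))"
      unfolding keeps_promises_def by blast
    have "promise A q (term_of C) (val y)"
      by (rule promise_cong[OF _ prom]) (use y in eventually_elim, simp)
    then have inf: "\<forall>\<^sub>F G in generics q. infinite (val y G)"
      and settled: "\<And>a. a \<in> A \<Longrightarrow> \<forall>\<^sub>F G in generics q. settled a (term_of C G) (val y G)"
      unfolding promise_def by blast+
    have "q \<tturnstile> (\<^bold>\<exists>I. \<^bold>\<not> finite_name I \<^bold>\<and> centered_name (trace_formula A C I))"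
    proof (rule forces_exI[of _ _ y])
      fix r assume r: "r \<le> q"
      have "r \<tturnstile> centered_name (trace_formula A C y)"
        using generics_mono[OF r inf] generics_mono[OF r settled] by (rule forces_centered_name)
      moreover have "r \<tturnstile> \<^bold>\<not> finite_name y"
        unfolding represents_forces[OF represents_not[OF represents_finite_name]]
        by (rule generics_mono[OF r inf])
      ultimately show "r \<tturnstile> \<^bold>\<not> finite_name y \<^bold>\<and> centered_name (trace_formula A C y)"
        unfolding forces_and by blast
    qed
    then show "\<exists>r\<le>q. r \<tturnstile> (\<^bold>\<exists>I. \<^bold>\<not> finite_name I \<^bold>\<and> centered_name (trace_formula A C I))" by blast
  qed
  with forces_almost_disjoint_Check[OF AD, of p] show ?thesis
    unfolding fin_intersecting_name_def forces_and trace_formula_def[abs_def] by blast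
qed

text \<open>
  By CH an almost disjoint family of size less than the continuum is countable, so the second
  half of the statement is an instance of the first.
\<close>

theorem theorem34:
  assumes CH: "CH"
    and proper: "proper_forcing TYPE('p::preorder)"
    and card: "|UNIV :: 'p set| \<le>o cardSuc natLeq"
    and bounding: "\<And>(f :: (nat \<times> nat, 'p) name) (p :: 'p). p \<tturnstile> total_function f \<Longrightarrow>
          \<exists>h :: nat \<Rightarrow> nat. p \<tturnstile> f \<^bold>\<le>\<^sup>* check_fun h"
  shows "(\<forall>B. countable B \<and> almost_disjoint B \<longrightarrow>
            (\<exists>A. B \<subseteq> A \<and> indestructible_MAD TYPE('p) A \<and> fin_intersecting A \<and>
                 preserves_fin_intersecting TYPE('p) A)) \<and>
         exist_generically (\<lambda>A. indestructible_MAD TYPE('p) A \<and> fin_intersecting A \<and>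
                 preserves_fin_intersecting TYPE('p) A)"
proof -
  let ?good = "\<lambda>A. indestructible_MAD TYPE('p) A \<and> fin_intersecting A \<and>
      preserves_fin_intersecting TYPE('p) A"
  have bd: "bounding_forcing TYPE('p)" unfolding bounding_forcing_def using bounding by blast
  have main: "\<exists>A. B \<subseteq> A \<and> almost_disjoint A \<and> ?good A" if B: "countable B" "almost_disjoint B" for B
  proof -
    obtain A where A: "B \<subseteq> A" "almost_disjoint A" "keeps_promises TYPE('p) A"
      by (rule exists_family_keeping_promises[OF CH card bd B])
    have "indestructible_MAD TYPE('p) A"
      unfolding indestructible_MAD_def forced_def
      by (intro conjI allI keeps_promises_MAD[OF A(3,2)] forces_MAD_Check[OF A(3,2)])
    moreover have "preserves_fin_intersecting TYPE('p) A"
      unfolding preserves_fin_intersecting_def forced_def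
      by (intro allI forces_fin_intersecting_Check[OF A(3,2)])
    ultimately show ?thesis using A(1,2) keeps_promises_fin_intersecting[OF A(3,2)] by auto
  qed
  have countable: "countable B" if "|B| <o |UNIV :: nat set set|" for B :: "nat set set"
  proof -
    have "|B| <o cardSuc natLeq" using that CH unfolding CH_def by (rule ordLess_ordIso_trans)
    then have "|B| \<le>o natLeq"
      using cardSuc_ordLeq_ordLess[OF natLeq_Card_order card_of_Card_order[of B]] by simp
    then show ?thesis by (simp add: countable_iff_natLeq)
  qed
  show ?thesis
    unfolding exist_generically_def
  proof (intro conjI allI impI)
    fix B :: "nat set set"
    show "\<exists>A. B \<subseteq> A \<and> ?good A" if "countable B \<and> almost_disjoint B"
      using main[of B] that by auto
    show "\<exists>A. B \<subseteq> A \<and> almost_disjoint A \<and> ?good A"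
      if "almost_disjoint B \<and> |B| <o |UNIV :: nat set set|"
      using that by (intro main countable) simp_all
  qed
qed

end
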